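(* Let $n\ge2$, $\frac34<a\le1$, $b=\frac12$, and $0<c_0\le1$. If $F$ is the $(a,b)$-set of divergence (a "set of type II"), then $$\dim_H\big(F\cap[0,c_0]^n\big)\ge\alpha:=1+(n-1)a.$$
   Context: For $k\ge k_0$ let $R_k=2^k$, $D_k=R_k^{(n-(n-1)a+nb)/(n+1)}$, $Q_k=R_k^{\frac{n-1}{n+1}(2a-b-1)}$. A point $(p_1/q,\dots,p_n/q)$, $p_j,q\in\mathbb{Z}$, is an admissible fraction if $\gcd(p_1,q)=1$ and: $p_2,\dots,p_n$ arbitrary when $q$ is odd; all even when $q\equiv0\pmod4$; all odd when $q\equiv2\pmod4$. Fix $0<c\ll1$. Let $\mathcal{A}_k$ be the collection of axis-parallel boxes ("slabs") of dimensions $cR_k^{-1/2}\times cR_k^{-1}\times\cdots\times cR_k^{-1}$ (long side in the $x_1$ direction) centered at $\big(2p_1R_k/(qD_k^2),p_2/(D_kq),\dots,p_n/(D_kq)\big)$ with $(p_1/q,\dots,p_n/q)$ admissible and $1\le q\le Q_k$; $F_k=\bigcup_{s\in\mathcal{A}_k}s$ and $F=\limsup_{k\to\infty}F_k=\bigcap_N\bigcup_{k\ge N}F_k$. $\dim_H$ denotes Hausdorff dimension. *)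

theory Defs
  imports "HOL-Analysis.Analysis"
begin

definition hausdorff_content :: "real \<Rightarrow> real \<Rightarrow> 'a::metric_space set \<Rightarrow> ennreal" where
  "hausdorff_content s \<delta> E =
     (INF U \<in> {U :: nat \<Rightarrow> 'a set. E \<subseteq> (\<Union>i. U i) \<and>
                 (\<forall>i. bounded (U i) \<and> diameter (U i) \<le> \<delta>)}.
        (\<Sum>i. ennreal (diameter (U i) powr s)))"

definition hausdorff_measure :: "real \<Rightarrow> 'a::metric_space set \<Rightarrow> ennreal" where
  "hausdorff_measure s E = (SUP \<delta> \<in> {0<..}. hausdorff_content s \<delta> E)"

text \<open>dim_H E = inf { s > 0 : H^s(E) = 0 } (infimum in the extended reals; restricting
  to s > 0 avoids the convention 0 powr 0 = 0 and does not change the value).\<close>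
definition hausdorff_dim :: "'a::metric_space set \<Rightarrow> ereal" where
  "hausdorff_dim E = Inf {ereal s | s. 0 < s \<and> hausdorff_measure s E = 0}"

text \<open>Points of R^n are represented as pairs (x_1, (x_2,...,x_n)) in
  real \<times> real^'m with n = CARD('m) + 1 (Euclidean metric).\<close>

definition R_k :: "nat \<Rightarrow> real" where
  "R_k k = 2 ^ k"

definition D_k :: "nat \<Rightarrow> real \<Rightarrow> real \<Rightarrow> nat \<Rightarrow> real" where
  "D_k n a b k = R_k k powr ((real n - (real n - 1) * a + real n * b) / (real n + 1))"

definition Q_k :: "nat \<Rightarrow> real \<Rightarrow> real \<Rightarrow> nat \<Rightarrow> real" where
  "Q_k n a b k = R_k k powr ((real n - 1) / (real n + 1) * (2 * a - b - 1))"

text \<open>admissible fraction (p_1/q, p_2/q, ..., p_n/q); P gives p_2,...,p_n.\<close>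
definition admissible :: "int \<Rightarrow> ('m::finite \<Rightarrow> int) \<Rightarrow> int \<Rightarrow> bool" where
  "admissible p1 P q \<longleftrightarrow> gcd p1 q = 1 \<and>
     (q mod 4 = 0 \<longrightarrow> (\<forall>j. even (P j))) \<and>
     (q mod 4 = 2 \<longrightarrow> (\<forall>j. odd (P j)))"

definition slab :: "real \<Rightarrow> real \<Rightarrow> real \<Rightarrow> (real^'m::finite) \<Rightarrow> (real \<times> (real^'m)) set" where
  "slab w1 w z1 z = {x. \<bar>fst x - z1\<bar> \<le> w1 / 2 \<and> (\<forall>j. \<bar>snd x $ j - z $ j\<bar> \<le> w / 2)}"

definition F_k :: "real \<Rightarrow> real \<Rightarrow> real \<Rightarrow> nat \<Rightarrow> (real \<times> (real^'m::finite)) set" where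
  "F_k a b c k =
     (let n = CARD('m) + 1; R = R_k k; D = D_k n a b k; Q = Q_k n a b k in
      \<Union> {slab (c * R powr (-1/2)) (c * R powr (-1))
              (2 * real_of_int p1 * R / (real_of_int q * D ^ 2))
              (\<chi> j. real_of_int (P j) / (D * real_of_int q))
          | p1 P q. admissible p1 P q \<and> 1 \<le> q \<and> real_of_int q \<le> Q})"

definition divergence_set :: "real \<Rightarrow> real \<Rightarrow> real \<Rightarrow> (real \<times> (real^'m::finite)) set" where
  "divergence_set a b c = (\<Inter>N. \<Union>k\<in>{N..}. F_k a b c k)"

definition cube :: "real \<Rightarrow> (real \<times> (real^'m::finite)) set" where
  "cube c0 = {x. 0 \<le> fst x \<and> fst x \<le> c0 \<and> (\<forall>j. 0 \<le> snd x $ j \<and> snd x $ j \<le> c0)}"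

end

theory Submission
  imports Defs "HOL-Number_Theory.Totient"
begin

text \<open>The lower bound is proved by the energy method. At level \<open>k\<close> only odd \<open>q\<close> between \<open>Q\<^sub>k / 2\<close> and
  \<open>Q\<^sub>k\<close> are used, so that \<open>p\<^sub>2, \<dots>, p\<^sub>n\<close> are unrestricted, and \<open>g\<^sub>k\<close> is the average over these \<open>q\<close> of the
  normalised sums of the indicators of the slabs with denominator \<open>q\<close>. Each of these sums is a product of
  one-dimensional combs. The combs are periodic with periods tending to \<open>0\<close>, so \<open>g\<^sub>k\<close> tends weakly to \<open>1\<close>.
  The sum of the squares of the \<open>g\<^sub>k\<close>-masses of the dyadic cubes of side \<open>1 / 2 ^ t\<close> is bounded by
  \<open>C 2 powr (- s t)\<close> uniformly in \<open>k\<close>, for every \<open>s < 1 + (n - 1) a\<close>: in the direction of \<open>x\<^sub>1\<close> the slabs cover the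
  line up to a factor \<open>q / totient q \<le> k + 1\<close>, and in the other directions the number of close pairs \<open>P / q\<close>,
  \<open>P' / q'\<close> is controlled by \<open>gcd q q'\<close>. The products \<open>g\<^bsub>k\<^sub>1\<^esub> \<cdots> g\<^bsub>k\<^sub>j\<^esub>\<close> along a sparse
  subsequence then keep mass bounded below and energy bounded above, which bounds the Hausdorff content of
  the intersection of their supports from below.\<close>

section \<open>Dyadic energy and covers\<close>

text \<open>At \<open>b = 1/2\<close> the exponents satisfy \<open>D^2 * Q = R^(3/2)\<close> and
  \<open>D^(n-1) * Q^n = R^((n-1) a)\<close>. By the first identity, for \<open>q\<close> between
  \<open>Q / 2\<close> and \<open>Q\<close> the first coordinates of the centres are multiples of a
  number between \<open>2 R^(-1/2)\<close> and \<open>4 R^(-1/2)\<close>, comparable with the slab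
  length; only coprimality opens larger gaps, so the direction of \<open>x1\<close> contributes a
  full dimension. By the second, the arithmetic term of the transverse energy is
  \<open>R^(-(n-1) a)\<close> up to logarithms, while the slabs have thickness about
  \<open>1 / R\<close>; this contributes \<open>(n-1) a\<close>. The logarithms cost powers of
  \<open>k\<close>, affordable because every \<open>s\<close> strictly below the target suffices.
  The obstacle in the limiting step: multiplying a bounded density by \<open>g k\<close> inflates
  the uniform energy bound by the square of its supremum, which is not controlled along the
  products. Energies are therefore compared scale by scale: equidistribution settles the finitely
  many coarse scales, and the gap between \<open>s\<close> and the exponent of the uniform bound
  settles all fine scales at once.\<close>

definition mass :: "('a::euclidean_space \<Rightarrow> real) \<Rightarrow> 'a set \<Rightarrow> real" where
  "mass f A = (\<integral>x. indicator A x * f x \<partial>lborel)"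

text \<open>Closed cubes, although neighbours then share faces: every cell is a \<open>cbox\<close>,
  and boxes are the only sets on which convergence of masses is assumed.\<close>

definition cell :: "nat \<Rightarrow> ('a \<Rightarrow> int) \<Rightarrow> 'a::euclidean_space set" where
  "cell t z = cbox (\<Sum>b\<in>Basis. (real_of_int (z b) / 2 ^ t) *\<^sub>R b)
                   (\<Sum>b\<in>Basis. ((real_of_int (z b) + 1) / 2 ^ t) *\<^sub>R b)"

text \<open>The index \<open>2 ^ t\<close> is included because the floor of
  \<open>2 ^ t * (x \<bullet> b)\<close> attains it when the coordinate equals
  \<open>1\<close>.\<close>

definition cells :: "nat \<Rightarrow> ('a::euclidean_space \<Rightarrow> int) set" where
  "cells t = PiE Basis (\<lambda>_. {0..2 ^ t})"

definition energy :: "('a::euclidean_space \<Rightarrow> real) \<Rightarrow> nat \<Rightarrow> real" where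
  "energy f t = (\<Sum>z\<in>cells t. (mass f (cell t z))\<^sup>2)"

lemma finite_cells [simp]: "finite (cells t)"
  unfolding cells_def by (intro finite_PiE) auto

lemma mem_cell:
  "x \<in> cell t z \<longleftrightarrow>
     (\<forall>b\<in>Basis. real_of_int (z b) \<le> 2 ^ t * (x \<bullet> b) \<and> 2 ^ t * (x \<bullet> b) \<le> real_of_int (z b) + 1)"
  unfolding cell_def mem_box by (simp add: divide_le_eq le_divide_eq mult.commute)

lemma ex_cell:
  assumes "x \<in> cbox 0 One"
  shows "\<exists>z\<in>cells t. x \<in> cell t z"
proof (intro bexI)
  show "x \<in> cell t (restrict (\<lambda>b. \<lfloor>2 ^ t * (x \<bullet> b)\<rfloor>) Basis)"
    unfolding mem_cell by (simp add: of_int_floor_le real_of_int_floor_add_one_ge)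
  have "\<lfloor>2 ^ t * (x \<bullet> b)\<rfloor> \<in> {0..2 ^ t}" if "b \<in> Basis" for b
  proof -
    have "0 \<le> x \<bullet> b" "x \<bullet> b \<le> 1" using assms that by (auto simp: mem_box)
    then have "0 \<le> 2 ^ t * (x \<bullet> b)" "2 ^ t * (x \<bullet> b) \<le> real_of_int (2 ^ t)" by simp_all
    then show ?thesis using floor_mono[of "2 ^ t * (x \<bullet> b)" "real_of_int (2 ^ t)"]
      by (simp only: floor_of_int) simp
  qed
  then show "restrict (\<lambda>b. \<lfloor>2 ^ t * (x \<bullet> b)\<rfloor>) Basis \<in> cells t"
    unfolding cells_def by auto
qed

lemma cell_borel [measurable]: "cell t z \<in> sets borel"
  unfolding cell_def by simp

lemma card_PiE_int_intervals:
  fixes f :: "'a::euclidean_space \<Rightarrow> int"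
  shows "card (PiE Basis (\<lambda>b. {f b - 2..f b + 1})) = 4 ^ DIM('a)"
  by (simp add: card_PiE)

lemma card_cells_meeting_ball:
  fixes x :: "'a::euclidean_space"
  assumes "e \<le> 1 / 2 ^ t"
  shows "card {z\<in>cells t. cell t z \<inter> ball x e \<noteq> {}} \<le> 4 ^ DIM('a)"
proof -
  have "{z\<in>cells t. cell t z \<inter> ball x e \<noteq> {}}
        \<subseteq> PiE Basis (\<lambda>b. {\<lfloor>2 ^ t * (x \<bullet> b)\<rfloor> - 2..\<lfloor>2 ^ t * (x \<bullet> b)\<rfloor> + 1})"
  proof
    fix z assume "z \<in> {z\<in>cells t. cell t z \<inter> ball x e \<noteq> {}}"
    then obtain y where z: "z \<in> cells t" and y: "y \<in> cell t z" "y \<in> ball x e" by blast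
    show "z \<in> PiE Basis (\<lambda>b. {\<lfloor>2 ^ t * (x \<bullet> b)\<rfloor> - 2..\<lfloor>2 ^ t * (x \<bullet> b)\<rfloor> + 1})"
    proof (intro PiE_I)
      fix b :: 'a assume b: "b \<in> Basis"
      have "\<bar>x \<bullet> b - y \<bullet> b\<bar> \<le> norm (x - y)"
        using Basis_le_norm[OF b, of "x - y"] by (simp add: inner_diff_left)
      also have "\<dots> < 1 / 2 ^ t" using y(2) assms by (simp add: dist_norm)
      finally have "2 ^ t * \<bar>x \<bullet> b - y \<bullet> b\<bar> < 1" by (simp add: field_simps)
      then have "\<bar>2 ^ t * (x \<bullet> b) - 2 ^ t * (y \<bullet> b)\<bar> < 1"
        by (simp add: abs_mult flip: right_diff_distrib)
      moreover have "real_of_int (z b) \<le> 2 ^ t * (y \<bullet> b)" "2 ^ t * (y \<bullet> b) \<le> real_of_int (z b) + 1"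
        using y(1) b unfolding mem_cell by auto
      ultimately have "real_of_int (z b - 1) \<le> 2 ^ t * (x \<bullet> b)" "2 ^ t * (x \<bullet> b) < real_of_int (z b + 2)"
        unfolding of_int_diff of_int_add by linarith+
      then have "z b - 1 \<le> \<lfloor>2 ^ t * (x \<bullet> b)\<rfloor>" "\<lfloor>2 ^ t * (x \<bullet> b)\<rfloor> < z b + 2"
        by (simp_all only: le_floor_iff floor_less_iff)
      then show "z b \<in> {\<lfloor>2 ^ t * (x \<bullet> b)\<rfloor> - 2..\<lfloor>2 ^ t * (x \<bullet> b)\<rfloor> + 1}"
        by simp
    next
      fix b :: 'a assume "b \<notin> Basis"
      then show "z b = undefined" using z unfolding cells_def by (rule PiE_arb[rotated])
    qed
  qed
  then have "card {z\<in>cells t. cell t z \<inter> ball x e \<noteq> {}}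
     \<le> card (PiE Basis (\<lambda>b. {\<lfloor>2 ^ t * (x \<bullet> b)\<rfloor> - 2..\<lfloor>2 ^ t * (x \<bullet> b)\<rfloor> + 1}))"
    by (rule card_mono[rotated]) (intro finite_PiE, auto)
  also have "\<dots> = 4 ^ DIM('a)" by (rule card_PiE_int_intervals)
  finally show ?thesis .
qed

definition density_on :: "'a::euclidean_space set \<Rightarrow> ('a \<Rightarrow> real) \<Rightarrow> bool" where
  "density_on W f \<longleftrightarrow> f \<in> borel_measurable borel \<and> (\<forall>x. 0 \<le> f x) \<and> bdd_above (range f)
     \<and> (\<forall>x. x \<notin> W \<longrightarrow> f x = 0)"

lemma density_on_bound:
  assumes "density_on W f"
  obtains M where "0 < M" "\<And>x. f x \<le> M"
proof -
  obtain M where "\<And>x. f x \<le> M"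
    using assms unfolding density_on_def bdd_above_def by auto
  then have "f x \<le> max M 1" for x by (simp add: le_max_iff_disj)
  then show ?thesis by (intro that[of "max M 1"]) auto
qed

lemma integrable_density_on:
  assumes "density_on (cbox l u) f" "A \<in> sets borel"
  shows "integrable lborel (\<lambda>x. indicator A x * f x)"
proof -
  obtain M where M: "0 < M" "\<And>x. f x \<le> M" using density_on_bound[OF assms(1)] by blast
  have [measurable]: "f \<in> borel_measurable borel" and f: "\<And>x. 0 \<le> f x" "\<And>x. x \<notin> cbox l u \<Longrightarrow> f x = 0"
    using assms(1) unfolding density_on_def by auto
  note assms(2)[measurable]
  show ?thesis
  proof (rule Bochner_Integration.integrable_bound)
    show "integrable lborel (\<lambda>x. M * indicator (cbox l u) x)"
      using emeasure_lborel_cbox_finite[of l u]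
      by (intro integrable_mult_right integrable_real_indicator) (auto simp: less_top)
    show "AE x in lborel. norm (indicator A x * f x) \<le> norm (M * indicator (cbox l u) x)"
      using f M by (auto simp: indicator_def abs_le_iff intro: order_less_imp_le)
  qed simp
qed

lemma mass_nonneg:
  assumes "\<And>x. 0 \<le> f x"
  shows "0 \<le> mass f A"
  unfolding mass_def using assms by (intro integral_nonneg_AE) auto

lemma ex_dyadic_scale:
  fixes e :: real
  assumes "0 < e" "e \<le> 1"
  shows "\<exists>t::nat. e \<le> 1 / 2 ^ t \<and> 1 / 2 ^ t \<le> 2 * e"
proof -
  define t where "t = nat \<lfloor>log 2 (1 / e)\<rfloor>"
  have "0 \<le> log 2 (1 / e)" using assms by simp
  then have t: "real t \<le> log 2 (1 / e)" "log 2 (1 / e) < real t + 1"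
    unfolding t_def by linarith+
  have "2 powr real t \<le> 1 / e" using t(1) assms by (simp add: le_log_iff)
  moreover have "1 / e < 2 powr (real t + 1)" using t(2) assms by (simp add: log_less_iff)
  ultimately show ?thesis using assms
    by (intro exI[of _ t]) (simp add: powr_realpow powr_add field_simps)
qed

lemma sum_UNION_le:
  fixes f :: "'b \<Rightarrow> real"
  assumes "finite I" "\<And>i. i \<in> I \<Longrightarrow> finite (A i)" "\<And>x. 0 \<le> f x"
  shows "sum f (\<Union>i\<in>I. A i) \<le> (\<Sum>i\<in>I. sum f (A i))"
  using assms
proof (induction I rule: finite_induct)
  case (insert i I)
  have "sum f (A i \<union> (\<Union>i\<in>I. A i)) \<le> sum f (A i) + sum f (\<Union>i\<in>I. A i)"
    using insert by (subst sum_Un) (auto intro!: sum_nonneg)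
  also have "\<dots> \<le> sum f (A i) + (\<Sum>i\<in>I. sum f (A i))" using insert by auto
  finally show ?case using insert by simp
qed simp

text \<open>Cauchy--Schwarz in the form \<open>m \<le> (\<lambda> r m\<^sup>2 + 1 / (\<lambda> r)) / 2\<close> turns the energy bound into a lower
  bound for the Hausdorff sums.\<close>

lemma mass_le_cover:
  fixes f :: "'a::euclidean_space \<Rightarrow> real"
  assumes f: "density_on (cbox 0 One) f"
    and I: "finite I" and e: "\<And>i. i \<in> I \<Longrightarrow> 0 < e i \<and> e i \<le> 1"
    and cov: "\<And>x. f x \<noteq> 0 \<Longrightarrow> \<exists>i\<in>I. x \<in> ball (c i) (e i)"
    and E: "\<And>T. (\<Sum>t<T. 2 powr (s * t) * energy f t) \<le> E"
    and s: "0 < s" and lam: "0 < lam"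
  shows "mass f UNIV \<le> lam * E / 2 + 4 ^ DIM('a) * 2 powr s * (\<Sum>i\<in>I. e i powr s) / (2 * lam)"
proof -
  have f0: "\<And>x. 0 \<le> f x" "\<And>x. x \<notin> cbox 0 One \<Longrightarrow> f x = 0"
    using f unfolding density_on_def by auto
  note int = integrable_density_on[OF f]
  obtain t where t: "\<And>i. i \<in> I \<Longrightarrow> e i \<le> 1 / 2 ^ t i \<and> 1 / 2 ^ t i \<le> 2 * e i"
    using that bchoice[of I "\<lambda>i t. e i \<le> 1 / 2 ^ t \<and> 1 / 2 ^ t \<le> 2 * e i"] ex_dyadic_scale e by blast
  define Z where "Z i = {z\<in>cells (t i). cell (t i) z \<inter> ball (c i) (e i) \<noteq> {}}" for i
  have finZ: "finite (Z i)" for i unfolding Z_def by auto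
  \<comment> \<open>A set of pairs (scale, index) rather than a family over \<open>I\<close>: a cube
    met by several balls must be counted once, since the energy contains its squared mass only
    once.\<close>
  define \<C> where "\<C> = (\<Union>i\<in>I. (\<lambda>z. (t i, z)) ` Z i)"
  have fin: "finite \<C>" unfolding \<C>_def using I finZ by auto
  define T where "T = Suc (Max (insert 0 (t ` I)))"
  have sub: "\<C> \<subseteq> Sigma {..<T} cells"
    unfolding \<C>_def Z_def T_def using I by (auto simp: less_Suc_eq_le)
  have m0: "0 \<le> mass f A" for A using f0 by (intro mass_nonneg) auto
  have "mass f UNIV \<le> (\<integral>x. (\<Sum>p\<in>\<C>. indicator (cell (fst p) (snd p)) x * f x) \<partial>lborel)"
    unfolding mass_def
  proof (rule integral_mono)
    show "integrable lborel (\<lambda>x. \<Sum>p\<in>\<C>. indicator (cell (fst p) (snd p)) x * f x)"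
      by (intro Bochner_Integration.integrable_sum int) auto
    fix x :: 'a
    show "indicator UNIV x * f x \<le> (\<Sum>p\<in>\<C>. indicator (cell (fst p) (snd p)) x * f x)"
    proof (cases "f x = 0")
      case False
      then obtain i where i: "i \<in> I" "x \<in> ball (c i) (e i)" using cov by blast
      obtain z where z: "z \<in> cells (t i)" "x \<in> cell (t i) z"
        using ex_cell f0(2) False by blast
      have "(t i, z) \<in> \<C>"
      proof -
        have "z \<in> Z i" unfolding Z_def using i z by auto
        then show ?thesis unfolding \<C>_def using i by blast
      qed
      then have "indicator (cell (t i) z) x * f x \<le> (\<Sum>p\<in>\<C>. indicator (cell (fst p) (snd p)) x * f x)"
        using member_le_sum[of "(t i, z)" \<C> "\<lambda>p. indicator (cell (fst p) (snd p)) x * f x"] f0 fin by auto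
      then show ?thesis using z by simp
    qed simp
  qed (use int[of UNIV] in simp)
  also have "\<dots> = (\<Sum>p\<in>\<C>. mass f (cell (fst p) (snd p)))"
    unfolding mass_def by (intro Bochner_Integration.integral_sum int) auto
  also have "\<dots> \<le> (\<Sum>p\<in>\<C>. lam / 2 * (2 powr (s * fst p) * (mass f (cell (fst p) (snd p)))\<^sup>2)
                     + 2 powr (- s * fst p) / (2 * lam))"
  proof (rule sum_mono)
    fix p :: "nat \<times> ('a \<Rightarrow> int)"
    define r where "r = lam * 2 powr (s * fst p)"
    have r: "0 < r" using lam unfolding r_def by simp
    define m where "m = mass f (cell (fst p) (snd p))"
    have "0 \<le> (r * m - 1)\<^sup>2 / (2 * r)" using r by simp
    also have "\<dots> = r / 2 * m\<^sup>2 + 1 / (2 * r) - m"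
      using r by (simp add: field_simps power2_eq_square)
    finally have "m \<le> r / 2 * m\<^sup>2 + 1 / (2 * r)" by simp
    then show "m \<le> lam / 2 * (2 powr (s * fst p) * m\<^sup>2) + 2 powr (- s * fst p) / (2 * lam)"
      unfolding r_def by (simp add: powr_minus field_simps)
  qed
  also have "\<dots> = lam / 2 * (\<Sum>p\<in>\<C>. 2 powr (s * fst p) * (mass f (cell (fst p) (snd p)))\<^sup>2)
                   + (\<Sum>p\<in>\<C>. 2 powr (- s * fst p)) / (2 * lam)"
    by (simp add: sum.distrib sum_distrib_left sum_divide_distrib)
  also have "(\<Sum>p\<in>\<C>. 2 powr (s * fst p) * (mass f (cell (fst p) (snd p)))\<^sup>2)
             \<le> (\<Sum>p\<in>Sigma {..<T} cells. 2 powr (s * fst p) * (mass f (cell (fst p) (snd p)))\<^sup>2)"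
    by (intro sum_mono2 sub finite_SigmaI) auto
  also have "\<dots> = (\<Sum>t<T. 2 powr (s * t) * energy f t)"
    by (simp add: energy_def sum.Sigma sum_distrib_left split_def)
  also have "\<dots> \<le> E" by (rule E)
  also have "(\<Sum>p\<in>\<C>. 2 powr (- s * fst p)) \<le> (\<Sum>i\<in>I. \<Sum>p\<in>(\<lambda>z. (t i, z)) ` Z i. 2 powr (- s * fst p))"
    unfolding \<C>_def using finZ by (intro sum_UNION_le I) auto
  also have "\<dots> \<le> (\<Sum>i\<in>I. 4 ^ DIM('a) * (2 powr s * e i powr s))"
  proof (rule sum_mono)
    fix i assume i: "i \<in> I"
    have "(\<Sum>p\<in>(\<lambda>z. (t i, z)) ` Z i. 2 powr (- s * fst p)) = card (Z i) * 2 powr (- s * t i)"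
      by (subst sum.reindex) (auto simp: inj_on_def)
    also have "\<dots> \<le> 4 ^ DIM('a) * 2 powr (- s * t i)"
      using card_cells_meeting_ball[of "e i" "t i" "c i"] t[OF i] unfolding Z_def
      by (intro mult_right_mono) (auto simp: numeral_power_le_of_nat_cancel_iff simp flip: of_nat_le_iff)
    also have "2 powr (- s * t i) = (1 / 2 ^ t i) powr s"
      by (simp add: powr_divide powr_minus powr_powr field_simps flip: powr_realpow)
    also have "\<dots> \<le> (2 * e i) powr s"
      using t[OF i] s by (intro powr_mono2) auto
    also have "\<dots> = 2 powr s * e i powr s" using e[OF i] by (simp add: powr_mult)
    finally show "(\<Sum>p\<in>(\<lambda>z. (t i, z)) ` Z i. 2 powr (- s * fst p)) \<le> 4 ^ DIM('a) * (2 powr s * e i powr s)"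
      by simp
  qed
  also have "\<dots> = 4 ^ DIM('a) * 2 powr s * (\<Sum>i\<in>I. e i powr s)"
    by (simp add: sum_distrib_left mult.assoc)
  finally show ?thesis using lam by (simp add: divide_right_mono field_simps)
qed

section \<open>Limsup sets of equidistributed boxes\<close>

lemma density_on_mono: "density_on W f \<Longrightarrow> W \<subseteq> V \<Longrightarrow> density_on V f"
  unfolding density_on_def by auto

lemma mass_UNIV:
  assumes "\<And>x. x \<notin> W \<Longrightarrow> f x = 0"
  shows "mass f UNIV = mass f W"
  unfolding mass_def using assms by (intro Bochner_Integration.integral_cong) (auto simp: indicator_def)

text \<open>At a fixed scale the energy is a polynomial in finitely many masses of boxes, so weak
  convergence passes to it. No uniformity in \<open>t\<close> is claimed.\<close>

lemma tendsto_energy: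
  assumes "\<And>a b. (\<lambda>k. mass (F k) (cbox a b)) \<longlonglongrightarrow> mass f (cbox a b)"
  shows "(\<lambda>k. energy (F k) t) \<longlonglongrightarrow> energy f t"
  unfolding energy_def cell_def by (intro tendsto_intros assms)

text \<open>Isolates the soft half of the argument; the arithmetic enters only through
  \<open>equidist\<close> and \<open>energy_le\<close>. The box \<open>cbox 0 v\<close> in which the
  limsup set is studied may be smaller than the unit cube, to which the dyadic cells always
  refer.\<close>

locale box_sequence =
  fixes g :: "nat \<Rightarrow> 'a::euclidean_space \<Rightarrow> real"
    and I :: "nat \<Rightarrow> 'i set" and w :: "nat \<Rightarrow> 'i \<Rightarrow> real" and l h :: "nat \<Rightarrow> 'i \<Rightarrow> 'a"
    and v :: 'a and C s' :: real
  assumes fin: "finite (I k)"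
    and w_nonneg: "i \<in> I k \<Longrightarrow> 0 \<le> w k i"
    and g_eq: "g k x = (\<Sum>i\<in>I k. w k i * indicator (cbox (l k i) (h k i)) x)"
    and v_pos: "b \<in> Basis \<Longrightarrow> 0 < v \<bullet> b"
    and v_le: "b \<in> Basis \<Longrightarrow> v \<bullet> b \<le> 1"
    and equidist: "cbox a b \<subseteq> cbox 0 v \<Longrightarrow> (\<lambda>k. mass (g k) (cbox a b)) \<longlonglongrightarrow> measure lborel (cbox a b)"
    and energy_le: "energy (g k) t \<le> C * 2 powr (- s' * t)"
begin

text \<open>The invariant of the construction. Convergence is demanded on every box, not only on
  cells, so that the property survives multiplication by a further \<open>g j\<close>.\<close>

definition test_density :: "('a \<Rightarrow> real) \<Rightarrow> bool" where
  "test_density f \<longleftrightarrow> density_on (cbox 0 v) f \<and>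
     (\<forall>a b. (\<lambda>k. mass (\<lambda>x. f x * g k x) (cbox a b)) \<longlonglongrightarrow> mass f (cbox a b))"

lemma cbox_v_subset: "cbox 0 v \<subseteq> cbox 0 One"
  using v_le by (auto simp: subset_box)

lemma g_nonneg: "0 \<le> g k x"
  unfolding g_eq by (intro sum_nonneg) (auto intro!: w_nonneg mult_nonneg_nonneg)

lemma g_measurable [measurable]: "g k \<in> borel_measurable borel"
proof -
  have "(\<lambda>x. \<Sum>i\<in>I k. w k i * indicator (cbox (l k i) (h k i)) x) \<in> borel_measurable borel"
    by measurable
  then show ?thesis unfolding g_eq[abs_def] .
qed

lemma g_bounded: "g k x \<le> (\<Sum>i\<in>I k. w k i)"
  unfolding g_eq using w_nonneg by (intro sum_mono) (auto simp: indicator_def)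

lemma integrable_g:
  assumes [measurable]: "A \<in> sets borel"
  shows "integrable lborel (\<lambda>x. indicator A x * g k x)"
proof (rule Bochner_Integration.integrable_bound)
  show "integrable lborel (\<lambda>x. \<Sum>i\<in>I k. w k i * indicator (cbox (l k i) (h k i)) x)"
    using emeasure_lborel_cbox_finite
    by (intro Bochner_Integration.integrable_sum integrable_mult_right integrable_real_indicator)
       (auto simp: less_top[symmetric])
  show "AE x in lborel. norm (indicator A x * g k x) \<le> norm (\<Sum>i\<in>I k. w k i * indicator (cbox (l k i) (h k i)) x)"
    using g_nonneg unfolding g_eq by (auto simp: indicator_def)
qed simp

lemma density_mult_g:
  assumes "density_on (cbox 0 v) f"
  shows "density_on (cbox 0 v) (\<lambda>x. f x * g k x)"
proof -
  obtain M where M: "0 < M" "\<And>x. f x \<le> M" using density_on_bound[OF assms] by blast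
  have [measurable]: "f \<in> borel_measurable borel" and f: "\<And>x. 0 \<le> f x" "\<And>x. x \<notin> cbox 0 v \<Longrightarrow> f x = 0"
    using assms(1) unfolding density_on_def by auto
  have "f x * g k x \<le> M * (\<Sum>i\<in>I k. w k i)" for x
    using M g_bounded g_nonneg f by (intro mult_mono) auto
  then have "bdd_above (range (\<lambda>x. f x * g k x))" by (auto simp: bdd_above_def)
  then show ?thesis unfolding density_on_def using f g_nonneg by auto
qed

lemma mass_mult_g:
  assumes f: "density_on (cbox 0 v) f"
  shows "mass (\<lambda>x. f x * g k x) (cbox a b) = (\<Sum>i\<in>I k. w k i * mass f (cbox a b \<inter> cbox (l k i) (h k i)))"
proof -
  have "mass (\<lambda>x. f x * g k x) (cbox a b)
      = (\<integral>x. (\<Sum>i\<in>I k. w k i * (indicator (cbox a b \<inter> cbox (l k i) (h k i)) x * f x)) \<partial>lborel)"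
    unfolding mass_def g_eq
    by (intro Bochner_Integration.integral_cong) (auto simp: sum_distrib_left indicator_def intro!: sum.cong)
  also have "\<dots> = (\<Sum>i\<in>I k. w k i * mass f (cbox a b \<inter> cbox (l k i) (h k i)))"
    unfolding mass_def
    by (subst Bochner_Integration.integral_sum) (auto intro!: integrable_mult_right integrable_density_on[OF f])
  finally show ?thesis .
qed

text \<open>\<open>g j\<close> is a finite combination of indicators of boxes and the intersection
  of two boxes is a box, so convergence for \<open>f * g j\<close> reduces to finitely many
  instances of convergence for \<open>f\<close>.\<close>

lemma test_density_mult_g:
  assumes f: "test_density f"
  shows "test_density (\<lambda>x. f x * g j x)"
  unfolding test_density_def
proof (intro conjI allI)
  have d: "density_on (cbox 0 v) f" using f unfolding test_density_def by auto
  show "density_on (cbox 0 v) (\<lambda>x. f x * g j x)" by (rule density_mult_g[OF d])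
  fix a b
  have "(\<lambda>k. \<Sum>i\<in>I j. w j i * mass (\<lambda>x. f x * g k x) (cbox a b \<inter> cbox (l j i) (h j i)))
        \<longlonglongrightarrow> (\<Sum>i\<in>I j. w j i * mass f (cbox a b \<inter> cbox (l j i) (h j i)))"
    using f unfolding test_density_def Int_interval by (intro tendsto_intros) auto
  moreover have "(\<Sum>i\<in>I j. w j i * mass (\<lambda>x. f x * g k x) (cbox a b \<inter> cbox (l j i) (h j i)))
      = mass (\<lambda>x. f x * g j x * g k x) (cbox a b)" for k
    using mass_mult_g[OF density_mult_g[OF d, of k], where k = j] by (simp add: mult_ac)
  ultimately show "(\<lambda>k. mass (\<lambda>x. f x * g j x * g k x) (cbox a b)) \<longlonglongrightarrow> mass (\<lambda>x. f x * g j x) (cbox a b)"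
    by (simp add: mass_mult_g[OF d])
qed

lemma test_density_init: "test_density (indicator (cbox 0 v))"
  unfolding test_density_def
proof (intro conjI allI)
  show "density_on (cbox 0 v) (indicator (cbox 0 v))"
    unfolding density_on_def by (auto simp: bdd_above_def indicator_def)
  fix a b :: 'a
  have "(\<lambda>k. mass (g k) (cbox a b \<inter> cbox 0 v)) \<longlonglongrightarrow> measure lborel (cbox a b \<inter> cbox 0 v)"
  proof -
    obtain c d where cd: "cbox a b \<inter> cbox 0 v = cbox c d" using Int_interval by blast
    then have "cbox c d \<subseteq> cbox 0 v" by blast
    then show ?thesis unfolding cd by (rule equidist)
  qed
  moreover have "mass (g k) (cbox a b \<inter> cbox 0 v) = mass (\<lambda>x. indicator (cbox 0 v) x * g k x) (cbox a b)" for k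
    unfolding mass_def by (intro Bochner_Integration.integral_cong) (auto simp: indicator_def)
  moreover have "measure lborel (cbox a b \<inter> cbox 0 v) = mass (indicator (cbox 0 v)) (cbox a b)"
    unfolding mass_def by (simp flip: indicator_inter_arith)
  ultimately show "(\<lambda>k. mass (\<lambda>x. indicator (cbox 0 v) x * g k x) (cbox a b)) \<longlonglongrightarrow> mass (indicator (cbox 0 v)) (cbox a b)"
    by simp
qed

text \<open>The factor \<open>M\<^sup>2\<close> depends on the current density, so this bound cannot
  be iterated with a fixed constant. It serves at large \<open>t\<close>, where geometric decay
  beats any constant.\<close>

lemma energy_mult_g_le:
  assumes d: "density_on (cbox 0 v) f" and M: "\<And>x. f x \<le> M"
  shows "energy (\<lambda>x. f x * g k x) t \<le> M\<^sup>2 * C * 2 powr (- s' * t)"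
proof -
  have f: "0 \<le> f x" for x using d unfolding density_on_def by auto
  have "mass (\<lambda>x. f x * g k x) (cell t z) \<le> M * mass (g k) (cell t z)" for z
  proof -
    have "mass (\<lambda>x. f x * g k x) (cell t z) \<le> (\<integral>x. M * (indicator (cell t z) x * g k x) \<partial>lborel)"
      unfolding mass_def using M f g_nonneg
      by (intro integral_mono integrable_mult_right integrable_g integrable_density_on[OF density_mult_g[OF d]])
         (auto simp: indicator_def intro: mult_right_mono)
    then show ?thesis unfolding mass_def by simp
  qed
  then have "energy (\<lambda>x. f x * g k x) t \<le> (\<Sum>z\<in>cells t. (M * mass (g k) (cell t z))\<^sup>2)"
    unfolding energy_def using f g_nonneg by (intro sum_mono power_mono mass_nonneg) auto
  also have "\<dots> = M\<^sup>2 * energy (g k) t"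
    unfolding energy_def by (simp add: power_mult_distrib sum_distrib_left)
  also have "\<dots> \<le> M\<^sup>2 * (C * 2 powr (- s' * t))" by (intro mult_left_mono energy_le) auto
  finally show ?thesis by (simp add: mult_ac)
qed

lemma C_nonneg: "0 \<le> C"
proof -
  have "0 \<le> energy (g 0) 0" unfolding energy_def by (intro sum_nonneg) auto
  then show ?thesis using energy_le[of 0 0] by simp
qed

text \<open>The sum over coarse scales converges, as \<open>k\<close> grows, to that of
  \<open>f\<close>; the sum over fine scales is small for all \<open>k\<close> simultaneously
  because \<open>s < s'\<close>. Hence a late \<open>k\<close> raises the energy and lowers the mass
  by at most \<open>\<eta>\<close>.\<close>

lemma step:
  assumes f: "test_density f" and E: "\<And>T. (\<Sum>t<T. 2 powr (s * t) * energy f t) \<le> E"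
    and s: "s < s'" and \<eta>: "0 < \<eta>"
  shows "\<exists>k>N. (\<forall>T. (\<Sum>t<T. 2 powr (s * t) * energy (\<lambda>x. f x * g k x) t) \<le> E + \<eta>)
           \<and> mass f UNIV - \<eta> \<le> mass (\<lambda>x. f x * g k x) UNIV"
proof -
  have d: "density_on (cbox 0 v) f"
    and lim: "\<And>a b. (\<lambda>k. mass (\<lambda>x. f x * g k x) (cbox a b)) \<longlonglongrightarrow> mass f (cbox a b)"
    using f unfolding test_density_def by auto
  have f0: "\<And>x. x \<notin> cbox 0 v \<Longrightarrow> f x = 0" using d unfolding density_on_def by auto
  obtain M where M: "0 < M" "\<And>x. f x \<le> M" using density_on_bound[OF d] by blast
  define r where "r = 2 powr (s - s')"
  have r: "0 < r" "r < 1" unfolding r_def using s powr_less_mono[of "s - s'" 0 2] by auto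
  have "summable (\<lambda>t. M\<^sup>2 * C * r ^ t)" using r by (intro summable_mult summable_geometric) auto
  \<comment> \<open>The cut-off depends on \<open>f\<close> (through \<open>M\<close>) but not on
    \<open>k\<close>; only afterwards is \<open>k\<close> taken large for the scales below
    \<open>T0\<close>.\<close>
  then obtain T0 where T0: "\<And>n. norm (\<Sum>t\<in>{T0..<n}. M\<^sup>2 * C * r ^ t) < \<eta> / 2"
    using \<eta> unfolding summable_Cauchy by (metis half_gt_zero order_refl)
  have e0: "0 \<le> energy F t" for F :: "'a \<Rightarrow> real" and t unfolding energy_def by (intro sum_nonneg) auto
  have tail: "(\<Sum>t\<in>{T0..<n}. 2 powr (s * t) * energy (\<lambda>x. f x * g k x) t) \<le> \<eta> / 2" for k n
  proof -
    have "2 powr (s * t) * energy (\<lambda>x. f x * g k x) t \<le> M\<^sup>2 * C * r ^ t" for t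
    proof -
      have "2 powr (s * t) * energy (\<lambda>x. f x * g k x) t \<le> 2 powr (s * t) * (M\<^sup>2 * C * 2 powr (- s' * t))"
        using energy_mult_g_le[OF d M(2)] by (intro mult_left_mono) auto
      also have "2 powr (s * t) * (M\<^sup>2 * C * 2 powr (- s' * t)) = M\<^sup>2 * C * (2 powr (s * t) * 2 powr (- s' * t))"
        by simp
      also have "2 powr (s * t) * 2 powr (- s' * t) = 2 powr ((s - s') * t)"
        unfolding powr_add[symmetric] by (simp add: algebra_simps)
      also have "\<dots> = r ^ t" unfolding r_def by (simp add: powr_powr flip: powr_realpow)
      finally show ?thesis .
    qed
    then have "(\<Sum>t\<in>{T0..<n}. 2 powr (s * t) * energy (\<lambda>x. f x * g k x) t) \<le> (\<Sum>t\<in>{T0..<n}. M\<^sup>2 * C * r ^ t)"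
      by (intro sum_mono)
    then show ?thesis using T0[of n] by (simp add: abs_less_iff)
  qed
  have "(\<lambda>k. \<Sum>t<T0. 2 powr (s * t) * energy (\<lambda>x. f x * g k x) t) \<longlonglongrightarrow> (\<Sum>t<T0. 2 powr (s * t) * energy f t)"
    by (intro tendsto_intros tendsto_energy lim)
  then have "\<forall>\<^sub>F k in sequentially. (\<Sum>t<T0. 2 powr (s * t) * energy (\<lambda>x. f x * g k x) t) < E + \<eta> / 2"
    by (rule order_tendstoD) (use E[of T0] \<eta> in linarith)
  moreover have "\<forall>\<^sub>F k in sequentially. mass f (cbox 0 v) - \<eta> < mass (\<lambda>x. f x * g k x) (cbox 0 v)"
    by (rule order_tendstoD[OF lim]) (use \<eta> in simp)
  ultimately have "\<forall>\<^sub>F k in sequentially. (\<Sum>t<T0. 2 powr (s * t) * energy (\<lambda>x. f x * g k x) t) < E + \<eta> / 2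
     \<and> mass f (cbox 0 v) - \<eta> < mass (\<lambda>x. f x * g k x) (cbox 0 v) \<and> N < k"
    using eventually_gt_at_top[of N] by eventually_elim auto
  then obtain k where k: "(\<Sum>t<T0. 2 powr (s * t) * energy (\<lambda>x. f x * g k x) t) < E + \<eta> / 2"
     "mass f (cbox 0 v) - \<eta> < mass (\<lambda>x. f x * g k x) (cbox 0 v)" "N < k"
    unfolding eventually_sequentially by blast
  show ?thesis
  proof (intro exI[of _ k] conjI allI k)
    show "mass f UNIV - \<eta> \<le> mass (\<lambda>x. f x * g k x) UNIV"
      using k(2) mass_UNIV[of "cbox 0 v" f] mass_UNIV[of "cbox 0 v" "\<lambda>x. f x * g k x"] f0 by auto
    fix T
    have "(\<Sum>t<T. 2 powr (s * t) * energy (\<lambda>x. f x * g k x) t)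
        \<le> (\<Sum>t\<in>{..<T0} \<union> {T0..<T}. 2 powr (s * t) * energy (\<lambda>x. f x * g k x) t)"
      using e0 by (intro sum_mono2) (auto simp: not_less)
    also have "\<dots> = (\<Sum>t<T0. 2 powr (s * t) * energy (\<lambda>x. f x * g k x) t)
        + (\<Sum>t\<in>{T0..<T}. 2 powr (s * t) * energy (\<lambda>x. f x * g k x) t)"
      by (intro sum.union_disjoint) auto
    finally show "(\<Sum>t<T. 2 powr (s * t) * energy (\<lambda>x. f x * g k x) t) \<le> E + \<eta>"
      using k(1) tail[of k T] by linarith
  qed
qed

text \<open>The indicator is the weak limit of its products with \<open>g k\<close>, whose energies
  satisfy the uniform bound with \<open>M = 1\<close>; the bound passes to the limit at each scale
  and is summed as a geometric series.\<close>

lemma energy_init: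
  assumes s: "s < s'"
  shows "(\<Sum>t<T. 2 powr (s * t) * energy (indicator (cbox 0 v)) t) \<le> C / (1 - 2 powr (s - s'))"
proof -
  define r where "r = 2 powr (s - s')"
  have r: "0 < r" "r < 1" unfolding r_def using s powr_less_mono[of "s - s'" 0 2] by auto
  have d: "density_on (cbox 0 v) (indicator (cbox 0 v))"
    and lim: "\<And>a b. (\<lambda>k. mass (\<lambda>x. indicator (cbox 0 v) x * g k x) (cbox a b))
                 \<longlonglongrightarrow> mass (indicator (cbox 0 v)) (cbox a b)"
    using test_density_init unfolding test_density_def by auto
  have "energy (indicator (cbox 0 v)) t \<le> C * 2 powr (- s' * t)" for t
  proof (rule LIMSEQ_le_const2[OF tendsto_energy[OF lim]])
    show "\<exists>N. \<forall>n\<ge>N. energy (\<lambda>x. indicator (cbox 0 v) x * g n x) t \<le> C * 2 powr (- s' * t)"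
      using energy_mult_g_le[OF d, of 1] by (auto simp: indicator_def)
  qed
  then have "2 powr (s * t) * energy (indicator (cbox 0 v)) t \<le> 2 powr (s * t) * (C * 2 powr (- s' * t))" for t
    by (intro mult_left_mono) auto
  also have "2 powr (s * real t) * (C * 2 powr (- s' * t)) = C * r ^ t" for t
    unfolding r_def by (simp add: powr_powr powr_add[symmetric] algebra_simps flip: powr_realpow)
  finally have "(\<Sum>t<T. 2 powr (s * t) * energy (indicator (cbox 0 v)) t) \<le> (\<Sum>t<T. C * r ^ t)"
    by (intro sum_mono)
  also have "\<dots> = C * (\<Sum>t<T. r ^ t)" by (simp add: sum_distrib_left)
  also have "\<dots> \<le> C * (1 / (1 - r))"
    using r C_nonneg sum_le_suminf[of "\<lambda>t. r ^ t" "{..<T}"] suminf_geometric[of r]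
    by (intro mult_left_mono) (auto simp: summable_geometric)
  finally show ?thesis unfolding r_def by simp
qed

end

section \<open>Ball covers of sets of vanishing Hausdorff measure\<close>

lemma hausdorff_measure_mono:
  assumes "A \<subseteq> B"
  shows "hausdorff_measure s A \<le> hausdorff_measure s B"
  unfolding hausdorff_measure_def hausdorff_content_def
  using assms by (intro SUP_mono) (blast intro!: INF_superset_mono)

text \<open>Compactness will require open sets with positive radii, whereas covering sets are
  arbitrary and may be single points. Each diameter is enlarged strictly, at a summable
  cost.\<close>

lemma hausdorff_measure_0_ball_cover:
  fixes X :: "'a::metric_space set"
  assumes 0: "hausdorff_measure s X = 0" and s: "0 < s" and \<epsilon>: "0 < \<epsilon>"
  obtains c :: "nat \<Rightarrow> 'a" and e where "X \<subseteq> (\<Union>i. ball (c i) (e i))" "\<And>i. 0 < e i"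
    "\<And>n. (\<Sum>i<n. e i powr s) \<le> \<epsilon>"
proof -
  have "hausdorff_content s 1 X \<le> hausdorff_measure s X"
    unfolding hausdorff_measure_def by (intro SUP_upper) auto
  then have "hausdorff_content s 1 X < ennreal (\<epsilon> / 2)" using 0 \<epsilon> by (simp add: ennreal_zero_less_divide)
  then obtain U where U: "X \<subseteq> (\<Union>i. U i)" "\<And>i. bounded (U i)"
    and sum: "(\<Sum>i. ennreal (diameter (U i) powr s)) < ennreal (\<epsilon> / 2)"
    unfolding hausdorff_content_def INF_less_iff by blast
  \<comment> \<open>The slack is added to the \<open>s\<close>-th power of the diameter, so that the
    costs simply add up; over all \<open>i\<close> it amounts to
    \<open>\<epsilon> / 2\<close>.\<close>
  define \<delta> where "\<delta> i = diameter (U i) powr s + \<epsilon> / 2 * (1 / 2) ^ Suc i" for i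
  define e where "e i = \<delta> i powr (1 / s)" for i
  have \<delta>: "diameter (U i) powr s < \<delta> i" "0 < \<delta> i" for i
    using \<epsilon> unfolding \<delta>_def by (auto intro: add_nonneg_pos)
  have es: "e i powr s = \<delta> i" for i unfolding e_def using \<delta>(2)[of i] s by (simp add: powr_powr)
  have e: "diameter (U i) < e i" for i
  proof -
    have "(diameter (U i) powr s) powr (1 / s) < e i"
      unfolding e_def using \<delta> s by (intro powr_less_mono2) auto
    then show ?thesis using diameter_ge_0[OF U(2)[of i]] s by (simp add: powr_powr)
  qed
  \<comment> \<open>For an empty \<open>U i\<close> the centre is arbitrary, which is harmless: the
    ball only enlarges the cover.\<close>
  define c where "c i = (SOME x. x \<in> U i)" for i
  show ?thesis
  proof (rule that[of c e])
    show "0 < e i" for i unfolding e_def using \<delta>(2)[of i] by simp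
    show "X \<subseteq> (\<Union>i. ball (c i) (e i))"
    proof
      fix x assume "x \<in> X"
      then obtain i where i: "x \<in> U i" using U by blast
      then have "c i \<in> U i" unfolding c_def by (rule someI)
      then have "dist (c i) x \<le> diameter (U i)" using i U(2) by (intro diameter_bounded_bound) auto
      then show "x \<in> (\<Union>i. ball (c i) (e i))" using e[of i] by (auto intro: le_less_trans)
    qed
    fix n
    have "ennreal (\<Sum>i<n. diameter (U i) powr s) = (\<Sum>i<n. ennreal (diameter (U i) powr s))"
      by (simp add: sum_ennreal)
    also have "\<dots> \<le> (\<Sum>i. ennreal (diameter (U i) powr s))" by (intro sum_le_suminf) auto
    also note sum
    finally have 1: "(\<Sum>i<n. diameter (U i) powr s) \<le> \<epsilon> / 2" using \<epsilon> by (simp add: ennreal_less_iff sum_nonneg)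
    have "(\<Sum>i<n. (1 / 2) ^ Suc i :: real) \<le> 1"
      using sum_le_suminf[of "\<lambda>i. (1 / 2) ^ Suc i :: real" "{..<n}"] power_half_series
      by (auto simp: sums_iff)
    then have "\<epsilon> / 2 * (\<Sum>i<n. (1 / 2) ^ Suc i) \<le> \<epsilon> / 2 * 1" using \<epsilon> by (intro mult_left_mono) auto
    moreover have "(\<Sum>i<n. e i powr s) = (\<Sum>i<n. diameter (U i) powr s) + \<epsilon> / 2 * (\<Sum>i<n. (1 / 2) ^ Suc i)"
      unfolding es \<delta>_def sum.distrib sum_distrib_left by simp
    ultimately show "(\<Sum>i<n. e i powr s) \<le> \<epsilon>" using 1 by linarith
  qed
qed

context box_sequence
begin

definition boxes :: "nat \<Rightarrow> 'a set" where
  "boxes k = (\<Union>i\<in>I k. cbox (l k i) (h k i))"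

lemma closed_boxes: "closed (boxes k)"
  unfolding boxes_def using fin by (intro closed_UN) auto

lemma g_eq_0: "x \<notin> boxes k \<Longrightarrow> g k x = 0"
  unfolding g_eq boxes_def by (intro sum.neutral) auto

text \<open>Compactness takes the place of a limit measure: the sets \<open>K n\<close> supporting
  the products are nested and compact, so a ball cover of their intersection already covers some
  \<open>K N\<close> with finitely many balls, and \<open>mass_le_cover\<close> is applied to the
  single density \<open>f N\<close>.\<close>

theorem hausdorff_measure_limsup_nonzero:
  assumes s: "0 < s" "s < s'"
  shows "hausdorff_measure s (cbox 0 v \<inter> (\<Inter>N. \<Union>k\<in>{N..}. boxes k)) \<noteq> 0"
proof
  assume zero: "hausdorff_measure s (cbox 0 v \<inter> (\<Inter>N. \<Union>k\<in>{N..}. boxes k)) = 0"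
  let ?f0 = "indicator (cbox 0 v) :: 'a \<Rightarrow> real"
  define E where "E = C / (1 - 2 powr (s - s'))"
  define m0 where "m0 = mass ?f0 UNIV"
  have "m0 = measure lborel (cbox 0 v)"
    unfolding m0_def mass_def by simp
  also have "\<dots> = (\<Prod>b\<in>Basis. v \<bullet> b)"
    using v_pos by (simp add: content_cbox order_less_imp_le)
  finally have m0: "0 < m0" using v_pos by (simp add: prod_pos)
  have E0: "0 \<le> E" unfolding E_def using C_nonneg s powr_less_mono[of "s - s'" 0 2]
    by (intro divide_nonneg_nonneg) auto
  \<comment> \<open>The total budget for all steps: the energy may grow by at most \<open>1\<close>
    and the mass may drop by at most half. Stage \<open>n\<close> spends
    \<open>\<delta> / 2 ^ Suc n\<close>, and \<open>\<delta> * (1 - 1 / 2 ^ n)\<close> is the amount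
    spent before it.\<close>
  define \<delta> where "\<delta> = min 1 (m0 / 2)"
  have \<delta>: "0 < \<delta>" "\<delta> \<le> 1" "\<delta> \<le> m0 / 2" unfolding \<delta>_def using m0 by auto
  define P where "P n p \<longleftrightarrow> test_density (fst p) \<and>
     (\<forall>T. (\<Sum>t<T. 2 powr (s * t) * energy (fst p) t) \<le> E + \<delta> * (1 - 1 / 2 ^ n)) \<and>
     m0 - \<delta> * (1 - 1 / 2 ^ n) \<le> mass (fst p) UNIV" for n and p :: "('a \<Rightarrow> real) \<times> nat"
  have "\<exists>p. (\<forall>n. P n (p n) \<and> (snd (p n) < snd (p (Suc n)) \<and>
     fst (p (Suc n)) = (\<lambda>x. fst (p n) x * g (snd (p (Suc n))) x))) \<and> fst (p 0) = ?f0"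
  proof -
    \<comment> \<open>The clause for \<open>n = 0\<close> pins down the initial density, which
      dependent choice would otherwise leave unspecified.\<close>
    have "\<exists>p. \<forall>n. (P n (p n) \<and> (n = 0 \<longrightarrow> fst (p n) = ?f0)) \<and> (snd (p n) < snd (p (Suc n)) \<and>
       fst (p (Suc n)) = (\<lambda>x. fst (p n) x * g (snd (p (Suc n))) x))"
    proof (rule dependent_nat_choice)
      show "\<exists>p. P 0 p \<and> (0 = 0 \<longrightarrow> fst p = ?f0)"
        unfolding P_def using energy_init[OF s(2)] test_density_init
        by (intro exI[of _ "(?f0, 0)"]) (auto simp: E_def m0_def)
      fix p n assume "P n p \<and> (n = 0 \<longrightarrow> fst p = ?f0)"
      then have p: "test_density (fst p)"
         "\<And>T. (\<Sum>t<T. 2 powr (s * t) * energy (fst p) t) \<le> E + \<delta> * (1 - 1 / 2 ^ n)"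
         "m0 - \<delta> * (1 - 1 / 2 ^ n) \<le> mass (fst p) UNIV" unfolding P_def by auto
      obtain k where k: "snd p < k"
         "\<And>T. (\<Sum>t<T. 2 powr (s * t) * energy (\<lambda>x. fst p x * g k x) t)
             \<le> E + \<delta> * (1 - 1 / 2 ^ n) + \<delta> / 2 ^ Suc n"
         "mass (fst p) UNIV - \<delta> / 2 ^ Suc n \<le> mass (\<lambda>x. fst p x * g k x) UNIV"
        using step[OF p(1,2) s(2), of "\<delta> / 2 ^ Suc n" "snd p"] \<delta> by auto
      have eq: "\<delta> * (1 - 1 / 2 ^ n) + \<delta> / 2 ^ Suc n = \<delta> * (1 - 1 / 2 ^ Suc n)"
        by (simp add: field_simps)
      have "P (Suc n) (\<lambda>x. fst p x * g k x, k)"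
        unfolding P_def fst_conv
      proof (intro conjI allI)
        show "(\<Sum>t<T. 2 powr (s * t) * energy (\<lambda>x. fst p x * g k x) t) \<le> E + \<delta> * (1 - 1 / 2 ^ Suc n)" for T
          using k(2)[of T] unfolding eq[symmetric] by (simp only: add.assoc)
        show "m0 - \<delta> * (1 - 1 / 2 ^ Suc n) \<le> mass (\<lambda>x. fst p x * g k x) UNIV"
          using k(3) p(3) unfolding eq[symmetric] by linarith
      qed (rule test_density_mult_g[OF p(1)])
      then show "\<exists>q. (P (Suc n) q \<and> (Suc n = 0 \<longrightarrow> fst q = ?f0)) \<and>
          (snd p < snd q \<and> fst q = (\<lambda>x. fst p x * g (snd q) x))"
        using k(1) by (intro exI[of _ "(\<lambda>x. fst p x * g k x, k)"]) auto
    qed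
    then show ?thesis by blast
  qed
  then obtain p where p: "\<And>n. P n (p n)" "\<And>n. snd (p n) < snd (p (Suc n))"
     "\<And>n. fst (p (Suc n)) = (\<lambda>x. fst (p n) x * g (snd (p (Suc n))) x)" "fst (p 0) = ?f0" by auto
  define f where "f n = fst (p n)" for n
  define \<kappa> where "\<kappa> n = snd (p n)" for n
  have mono: "strict_mono \<kappa>" unfolding \<kappa>_def using p(2) by (rule strict_mono_Suc_iff[THEN iffD2, rule_format])
  \<comment> \<open>The index is shifted because \<open>\<kappa> 0\<close> is a dummy: the product
    starts with the indicator of the box, and its first genuine factor is
    \<open>g (\<kappa> 1)\<close>.\<close>
  define K where "K n = cbox 0 v \<inter> (\<Inter>j\<in>{..<n}. boxes (\<kappa> (Suc j)))" for n
  have fK: "f n x \<noteq> 0 \<Longrightarrow> x \<in> K n" for n x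
  proof (induction n)
    case 0
    then show ?case unfolding f_def K_def p(4) by (auto simp: indicator_def)
  next
    case (Suc n)
    then have "f n x * g (\<kappa> (Suc n)) x \<noteq> 0" unfolding f_def \<kappa>_def p(3) by simp
    then have "f n x \<noteq> 0" "x \<in> boxes (\<kappa> (Suc n))" using g_eq_0 by force+
    then show ?case using Suc.IH unfolding K_def by (auto simp: less_Suc_eq)
  qed
  have limsup: "(\<Inter>n. K n) \<subseteq> cbox 0 v \<inter> (\<Inter>N. \<Union>k\<in>{N..}. boxes k)"
  proof
    fix x assume x: "x \<in> (\<Inter>n. K n)"
    have "x \<in> (\<Union>k\<in>{N..}. boxes k)" for N
    proof -
      have "x \<in> K (Suc N)" using x by blast
      then have "x \<in> boxes (\<kappa> (Suc N))" unfolding K_def by blast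
      moreover have "N \<le> \<kappa> (Suc N)" using seq_suble[OF mono, of "Suc N"] by linarith
      ultimately show ?thesis by auto
    qed
    moreover have "x \<in> cbox 0 v" using x unfolding K_def by blast
    ultimately show "x \<in> cbox 0 v \<inter> (\<Inter>N. \<Union>k\<in>{N..}. boxes k)" by blast
  qed
  define A where "A = 4 ^ DIM('a) * 2 powr s"
  \<comment> \<open>Chosen so that the energy term of the cover estimate equals
    \<open>m0 / 4\<close>. With \<open>\<epsilon>\<close> below, the cover term is at most
    \<open>m0 / 8\<close>, and the sum stays under the guaranteed mass
    \<open>m0 / 2\<close>.\<close>
  define lam where "lam = m0 / (2 * (E + 1))"
  have A: "0 < A" unfolding A_def by simp
  have lam: "0 < lam" unfolding lam_def using m0 E0 by simp
  \<comment> \<open>The cap \<open>1\<close> forces every radius to be at most \<open>1\<close>, as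
    the choice of dyadic scales requires.\<close>
  define \<epsilon> where "\<epsilon> = min 1 (lam * m0 / (4 * A))"
  have \<epsilon>: "0 < \<epsilon>" "\<epsilon> \<le> 1" "\<epsilon> \<le> lam * m0 / (4 * A)"
    unfolding \<epsilon>_def using A lam m0 by auto
  then have \<epsilon>A: "A * \<epsilon> / (2 * lam) \<le> m0 / 8"
    using A lam by (simp add: field_simps)
  obtain c :: "nat \<Rightarrow> 'a" and e where cov: "cbox 0 v \<inter> (\<Inter>N. \<Union>k\<in>{N..}. boxes k) \<subseteq> (\<Union>i. ball (c i) (e i))"
     and e: "\<And>i. 0 < e i" "\<And>n. (\<Sum>i<n. e i powr s) \<le> \<epsilon>"
    by (rule hausdorff_measure_0_ball_cover[OF zero s(1) \<epsilon>(1)], rule that)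
  have e1: "e i \<le> 1" for i
  proof -
    have "e i powr s \<le> (\<Sum>j<Suc i. e j powr s)" by (intro member_le_sum) auto
    also have "\<dots> \<le> 1" using e(2)[of "Suc i"] \<epsilon>(2) by linarith
    finally show ?thesis using gr_one_powr[of "e i" s] s(1) by (meson not_le)
  qed
  \<comment> \<open>With the complement of \<open>K n\<close> added, these open sets increase with
    \<open>n\<close> and cover the whole compact box. So one of them contains the box, which says
    that finitely many balls cover \<open>K N\<close>.\<close>
  define V where "V n = (\<Union>i\<in>{..<n}. ball (c i) (e i)) \<union> - K n" for n
  have Kmono: "K n \<subseteq> K m" if "m \<le> n" for m n using that unfolding K_def by auto
  have Vmono: "V m \<subseteq> V n" if "m \<le> n" for m n
    using that Kmono[OF that] unfolding V_def by (auto intro: less_le_trans)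
  have closedK: "closed (K n)" for n
    unfolding K_def using closed_boxes by (intro closed_Int closed_cbox closed_INT) auto
  have "cbox 0 v \<subseteq> (\<Union>n. V n)"
  proof
    fix x assume "x \<in> cbox 0 v"
    show "x \<in> (\<Union>n. V n)"
    proof (cases "x \<in> (\<Inter>n. K n)")
      case True
      then have "x \<in> (\<Union>i. ball (c i) (e i))" by (intro subsetD[OF cov] subsetD[OF limsup])
      then obtain i where "x \<in> ball (c i) (e i)" by (rule UN_E)
      then have "x \<in> V (Suc i)" unfolding V_def by (intro UnI1 UN_I[of i]) auto
      then show ?thesis by blast
    qed (auto simp: V_def)
  qed
  note V_cover = this
  have open_V: "open (V n)" for n unfolding V_def using closedK by (intro open_Un open_UN) auto
  obtain S where S: "finite S" "cbox 0 v \<subseteq> (\<Union>n\<in>S. V n)"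
    by (rule compactE_image[OF compact_cbox[of 0 v] open_V V_cover])
  define N where "N = Max (insert 0 S)"
  have "n \<le> N" if "n \<in> S" for n unfolding N_def using S(1) that by simp
  then have "cbox 0 v \<subseteq> V N" using S(2) Vmono by blast
  then have KN: "K N \<subseteq> (\<Union>i\<in>{..<N}. ball (c i) (e i))" unfolding V_def K_def by blast
  have PN: "test_density (f N)" "\<And>T. (\<Sum>t<T. 2 powr (s * t) * energy (f N) t) \<le> E + \<delta> * (1 - 1 / 2 ^ N)"
     "m0 - \<delta> * (1 - 1 / 2 ^ N) \<le> mass (f N) UNIV"
    using p(1)[of N] unfolding P_def f_def by auto
  have \<delta>N: "\<delta> * (1 - 1 / 2 ^ N) \<le> \<delta> * 1" using \<delta> by (intro mult_left_mono) auto
  have "mass (f N) UNIV \<le> lam * (E + 1) / 2 + 4 ^ DIM('a) * 2 powr s * (\<Sum>i\<in>{..<N}. e i powr s) / (2 * lam)"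
  proof (rule mass_le_cover)
    show "density_on (cbox 0 One) (f N)"
      using PN(1) density_on_mono[OF _ cbox_v_subset] unfolding test_density_def by blast
    show "(\<Sum>t<T. 2 powr (s * t) * energy (f N) t) \<le> E + 1" for T
      using PN(2)[of T] \<delta>N \<delta> by linarith
    show "\<exists>i\<in>{..<N}. x \<in> ball (c i) (e i)" if "f N x \<noteq> 0" for x using fK[OF that] KN by blast
  qed (use e e1 s lam in auto)
  also have "lam * (E + 1) / 2 = m0 / 4" unfolding lam_def using E0 by (simp add: field_simps)
  also have "4 ^ DIM('a) * 2 powr s * (\<Sum>i\<in>{..<N}. e i powr s) / (2 * lam) \<le> A * \<epsilon> / (2 * lam)"
    unfolding A_def using e(2)[of N] lam by (intro divide_right_mono mult_left_mono) auto
  also note \<epsilon>A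
  finally show False using PN(3) \<delta>N \<delta> m0 by linarith
qed

end

section \<open>One-dimensional combs\<close>

definition overlap :: "real \<Rightarrow> real \<Rightarrow> real \<Rightarrow> real \<Rightarrow> real" where
  "overlap a b c w = max 0 (min b (c + w / 2) - max a (c - w / 2))"

lemma overlap_nonneg: "0 \<le> overlap a b c w"
  unfolding overlap_def by simp

lemma overlap_le_width: "0 \<le> w \<Longrightarrow> overlap a b c w \<le> w"
  unfolding overlap_def by simp

lemma overlap_le_length: "a \<le> b \<Longrightarrow> overlap a b c w \<le> b - a"
  unfolding overlap_def by simp

lemma emeasure_lborel_Ico_max: "emeasure lborel {x..<y::real} = ennreal (max 0 (y - x))"
  by (cases "x \<le> y") auto

text \<open>Half-open intervals, so that pieces sharing an endpoint still count as disjoint. It is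
  used both for many bars in one cell and for many cells meeting one bar.\<close>

lemma sum_disjoint_intervals_le:
  fixes lo hi :: "'i \<Rightarrow> real"
  assumes fin: "finite T" and ab: "a \<le> b"
    and sub: "\<And>i. i \<in> T \<Longrightarrow> a \<le> lo i \<and> hi i \<le> b"
    and disj: "\<And>i j. i \<in> T \<Longrightarrow> j \<in> T \<Longrightarrow> i \<noteq> j \<Longrightarrow> {lo i..<hi i} \<inter> {lo j..<hi j} = {}"
  shows "(\<Sum>i\<in>T. max 0 (hi i - lo i)) \<le> b - a"
proof -
  have "(\<Sum>i\<in>T. max 0 (hi i - lo i)) = (\<Sum>i\<in>T. measure lborel {lo i..<hi i})"
    by (intro sum.cong refl) (simp add: measure_def emeasure_lborel_Ico_max)
  also have "\<dots> = measure lborel (\<Union>i\<in>T. {lo i..<hi i})"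
    using fin disj
    by (intro measure_finite_Union[symmetric]) (auto simp: disjoint_family_on_def emeasure_lborel_Ico_max)
  also have "\<dots> \<le> measure lborel {a..b}"
    using fin sub fmeasurable_cbox[of a b]
    by (intro measure_mono_fmeasurable) (force intro!: sets.finite_UN)+
  also have "\<dots> = b - a" using ab by simp
  finally show ?thesis .
qed

lemma sum_overlap_separated_le:
  assumes "finite T" "a \<le> b" and sep: "\<And>p q. p \<in> T \<Longrightarrow> q \<in> T \<Longrightarrow> p \<noteq> q \<Longrightarrow> w \<le> \<bar>c p - c q\<bar>"
  shows "(\<Sum>p\<in>T. overlap a b (c p) w) \<le> b - a"
  unfolding overlap_def
proof (rule sum_disjoint_intervals_le)
  fix p q assume pq: "p \<in> T" "q \<in> T" "p \<noteq> q"
  show "{max a (c p - w / 2)..<min b (c p + w / 2)} \<inter> {max a (c q - w / 2)..<min b (c q + w / 2)} = {}"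
    using sep[OF pq] by (auto simp: abs_if split: if_splits)
qed (use assms in auto)

lemma sum_overlap_grid_le:
  assumes "0 \<le> w"
  shows "(\<Sum>i\<in>{0..2 ^ t :: int}. overlap (real_of_int i / 2 ^ t) ((real_of_int i + 1) / 2 ^ t) c w) \<le> w"
proof -
  have "(\<Sum>i\<in>{0..2 ^ t :: int}. overlap (real_of_int i / 2 ^ t) ((real_of_int i + 1) / 2 ^ t) c w)
    \<le> (c + w / 2) - (c - w / 2)"
    unfolding overlap_def
  proof (rule sum_disjoint_intervals_le)
    fix i j :: int assume "i \<noteq> j"
    then have "i + 1 \<le> j \<or> j + 1 \<le> i" by linarith
    then have "real_of_int i + 1 \<le> real_of_int j \<or> real_of_int j + 1 \<le> real_of_int i"
      by (metis of_int_1 of_int_add of_int_le_iff)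
    then have "(real_of_int i + 1) / 2 ^ t \<le> real_of_int j / 2 ^ t \<or> (real_of_int j + 1) / 2 ^ t \<le> real_of_int i / 2 ^ t"
      by (auto intro: divide_right_mono)
    then show "{max (real_of_int i / 2 ^ t) (c - w / 2)..<min ((real_of_int i + 1) / 2 ^ t) (c + w / 2)} \<inter>
          {max (real_of_int j / 2 ^ t) (c - w / 2)..<min ((real_of_int j + 1) / 2 ^ t) (c + w / 2)} = {}"
      by auto
  qed (use assms in auto)
  then show ?thesis by simp
qed

section \<open>Counting integers in intervals, residue classes and reduced residue classes\<close>

lemma int_interval_eq: "{p::int. \<alpha> \<le> real_of_int p \<and> real_of_int p \<le> \<beta>} = {\<lceil>\<alpha>\<rceil>..\<lfloor>\<beta>\<rfloor>}"
  by (auto simp: ceiling_le_iff le_floor_iff)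

lemma card_int_interval:
  shows "\<beta> - \<alpha> - 1 \<le> real (card {p::int. \<alpha> \<le> real_of_int p \<and> real_of_int p \<le> \<beta>})"
    and "0 \<le> \<beta> - \<alpha> + 1 \<Longrightarrow> real (card {p::int. \<alpha> \<le> real_of_int p \<and> real_of_int p \<le> \<beta>}) \<le> \<beta> - \<alpha> + 1"
proof -
  have card: "real (card {p::int. \<alpha> \<le> real_of_int p \<and> real_of_int p \<le> \<beta>}) = max 0 (of_int (\<lfloor>\<beta>\<rfloor> + 1 - \<lceil>\<alpha>\<rceil>))"
    unfolding int_interval_eq by (simp add: max_def)
  have "\<beta> < of_int \<lfloor>\<beta>\<rfloor> + 1" "of_int \<lceil>\<alpha>\<rceil> < \<alpha> + 1" "of_int \<lfloor>\<beta>\<rfloor> \<le> \<beta>" "\<alpha> \<le> of_int \<lceil>\<alpha>\<rceil>"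
    by linarith+
  then have "\<beta> - \<alpha> - 1 \<le> of_int (\<lfloor>\<beta>\<rfloor> + 1 - \<lceil>\<alpha>\<rceil>)" "of_int (\<lfloor>\<beta>\<rfloor> + 1 - \<lceil>\<alpha>\<rceil>) \<le> \<beta> - \<alpha> + 1"
    unfolding of_int_diff of_int_add of_int_1 by linarith+
  then show "\<beta> - \<alpha> - 1 \<le> real (card {p::int. \<alpha> \<le> real_of_int p \<and> real_of_int p \<le> \<beta>})"
    and "0 \<le> \<beta> - \<alpha> + 1 \<Longrightarrow> real (card {p::int. \<alpha> \<le> real_of_int p \<and> real_of_int p \<le> \<beta>}) \<le> \<beta> - \<alpha> + 1"
    unfolding card by (simp_all only: max.bounded_iff le_max_iff_disj simp_thms)
qed

lemma residue_class_eq: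
  assumes "0 < q"
  shows "{p::int. \<alpha> \<le> real_of_int p \<and> real_of_int p \<le> \<beta> \<and> p mod int q = \<kappa> mod int q}
    = (\<lambda>j. \<kappa> + int q * j) ` {j::int. (\<alpha> - \<kappa>) / q \<le> real_of_int j \<and> real_of_int j \<le> (\<beta> - \<kappa>) / q}"
proof (intro equalityI subsetI)
  fix p assume p: "p \<in> {p::int. \<alpha> \<le> real_of_int p \<and> real_of_int p \<le> \<beta> \<and> p mod int q = \<kappa> mod int q}"
  then have "int q dvd p - \<kappa>" by (simp add: mod_eq_dvd_iff)
  then obtain j where "p - \<kappa> = int q * j" by (auto simp: dvd_def)
  then have j: "p = \<kappa> + int q * j" by simp
  have "j \<in> {j::int. (\<alpha> - \<kappa>) / q \<le> real_of_int j \<and> real_of_int j \<le> (\<beta> - \<kappa>) / q}"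
    using p assms unfolding j by (auto simp: field_simps)
  then show "p \<in> (\<lambda>j. \<kappa> + int q * j) ` {j::int. (\<alpha> - \<kappa>) / q \<le> real_of_int j \<and> real_of_int j \<le> (\<beta> - \<kappa>) / q}"
    using j by blast
qed (use assms in \<open>auto simp: field_simps\<close>)

lemma card_residue_class:
  assumes q: "0 < q"
  shows "(\<beta> - \<alpha>) / q - 1 \<le> real (card {p::int. \<alpha> \<le> real_of_int p \<and> real_of_int p \<le> \<beta> \<and> p mod int q = \<kappa> mod int q})"
    and "\<alpha> \<le> \<beta> \<Longrightarrow> real (card {p::int. \<alpha> \<le> real_of_int p \<and> real_of_int p \<le> \<beta> \<and> p mod int q = \<kappa> mod int q}) \<le> (\<beta> - \<alpha>) / q + 1"
proof -
  have card: "card {p::int. \<alpha> \<le> real_of_int p \<and> real_of_int p \<le> \<beta> \<and> p mod int q = \<kappa> mod int q}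
     = card {j::int. (\<alpha> - \<kappa>) / q \<le> real_of_int j \<and> real_of_int j \<le> (\<beta> - \<kappa>) / q}"
    unfolding residue_class_eq[OF q] using q by (intro card_image) (auto simp: inj_on_def)
  have eq: "(\<beta> - \<kappa>) / q - (\<alpha> - \<kappa>) / q = (\<beta> - \<alpha>) / q" by (simp add: diff_divide_distrib)
  show "(\<beta> - \<alpha>) / q - 1 \<le> real (card {p::int. \<alpha> \<le> real_of_int p \<and> real_of_int p \<le> \<beta> \<and> p mod int q = \<kappa> mod int q})"
    using card_int_interval(1)[where \<alpha> = "(\<alpha> - \<kappa>) / q" and \<beta> = "(\<beta> - \<kappa>) / q"]
    unfolding card eq .
  show "real (card {p::int. \<alpha> \<le> real_of_int p \<and> real_of_int p \<le> \<beta> \<and> p mod int q = \<kappa> mod int q}) \<le> (\<beta> - \<alpha>) / q + 1"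
    if "\<alpha> \<le> \<beta>"
    using card_int_interval(2)[where \<alpha> = "(\<alpha> - \<kappa>) / q" and \<beta> = "(\<beta> - \<kappa>) / q"] that
    unfolding card eq by simp
qed

lemma finite_int_interval: "finite {p::int. \<alpha> \<le> real_of_int p \<and> real_of_int p \<le> \<beta>}"
  unfolding int_interval_eq by simp

lemma coprime_class_eq:
  assumes q: "0 < q"
  shows "{p::int. \<alpha> \<le> real_of_int p \<and> real_of_int p \<le> \<beta> \<and> coprime p (int q)}
    = (\<Union>\<kappa>\<in>totatives q. {p::int. \<alpha> \<le> real_of_int p \<and> real_of_int p \<le> \<beta> \<and> p mod int q = int \<kappa> mod int q})"
proof (intro equalityI subsetI)
  fix p assume p: "p \<in> {p::int. \<alpha> \<le> real_of_int p \<and> real_of_int p \<le> \<beta> \<and> coprime p (int q)}"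
  \<comment> \<open>The exception is due to \<open>totatives 1\<close>, which is \<open>{1}\<close>,
    while the residue modulo \<open>1\<close> is \<open>0\<close>.\<close>
  define \<kappa> where "\<kappa> = (if q = 1 then 1 else nat (p mod int q))"
  have "\<kappa> \<in> totatives q \<and> p mod int q = int \<kappa> mod int q"
  proof (cases "q = 1")
    case False
    have c: "coprime (p mod int q) (int q)" using p q by simp
    have "0 \<le> p mod int q" using q by auto
    then have \<kappa>: "int \<kappa> = p mod int q" unfolding \<kappa>_def using False by simp
    have "int \<kappa> < int q" unfolding \<kappa> using q by simp
    moreover have "coprime \<kappa> q" using c unfolding \<kappa>[symmetric] by simp
    moreover from this have "\<kappa> \<noteq> 0" using False by (intro notI) simp
    ultimately show ?thesis using \<kappa> unfolding in_totatives_iff by simp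
  qed (simp add: \<kappa>_def)
  then show "p \<in> (\<Union>\<kappa>\<in>totatives q. {p::int. \<alpha> \<le> real_of_int p \<and> real_of_int p \<le> \<beta> \<and> p mod int q = int \<kappa> mod int q})"
    using p by (auto intro!: bexI[of _ \<kappa>])
next
  fix p assume "p \<in> (\<Union>\<kappa>\<in>totatives q. {p::int. \<alpha> \<le> real_of_int p \<and> real_of_int p \<le> \<beta> \<and> p mod int q = int \<kappa> mod int q})"
  then obtain \<kappa> where k: "\<kappa> \<in> totatives q" "\<alpha> \<le> real_of_int p" "real_of_int p \<le> \<beta>" "p mod int q = int \<kappa> mod int q"
    by auto
  have "coprime (int \<kappa>) (int q)" using k(1) by (simp add: in_totatives_iff)
  then have "coprime (p mod int q) (int q)" unfolding k(4) using q by simp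
  then have "coprime p (int q)" using q by simp
  then show "p \<in> {p::int. \<alpha> \<le> real_of_int p \<and> real_of_int p \<le> \<beta> \<and> coprime p (int q)}" using k(2,3) by simp
qed

lemma totatives_mod_inj:
  assumes "\<kappa> \<in> totatives q" "\<kappa>' \<in> totatives q" "int \<kappa> mod int q = int \<kappa>' mod int q"
  shows "\<kappa> = \<kappa>'"
proof -
  have "int q dvd int \<kappa> - int \<kappa>'" using assms(3) by (simp add: mod_eq_dvd_iff)
  moreover have "\<bar>int \<kappa> - int \<kappa>'\<bar> < int q" using assms(1,2) by (auto simp: in_totatives_iff)
  ultimately have "int \<kappa> - int \<kappa>' = 0" using zdvd_not_zless[of "\<bar>int \<kappa> - int \<kappa>'\<bar>" "int q"] by (metis dvd_abs_iff zero_less_abs_iff)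
  then show ?thesis by simp
qed

text \<open>The count is sharp up to one element per reduced residue class. The error
  \<open>totient q\<close> looks large, but normalisation by \<open>comb_weight\<close> turns it
  into one period \<open>\<theta> * q\<close> of the comb.\<close>

lemma card_coprime_class:
  assumes q: "0 < q"
  shows "totient q * ((\<beta> - \<alpha>) / q - 1) \<le> real (card {p::int. \<alpha> \<le> real_of_int p \<and> real_of_int p \<le> \<beta> \<and> coprime p (int q)})"
    and "\<alpha> \<le> \<beta> \<Longrightarrow> real (card {p::int. \<alpha> \<le> real_of_int p \<and> real_of_int p \<le> \<beta> \<and> coprime p (int q)}) \<le> totient q * ((\<beta> - \<alpha>) / q + 1)"
proof -
  let ?C = "\<lambda>\<kappa>. {p::int. \<alpha> \<le> real_of_int p \<and> real_of_int p \<le> \<beta> \<and> p mod int q = int \<kappa> mod int q}"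
  have "card (\<Union>\<kappa>\<in>totatives q. ?C \<kappa>) = (\<Sum>\<kappa>\<in>totatives q. card (?C \<kappa>))"
  proof (intro card_UN_disjoint ballI impI)
    show "finite (?C \<kappa>)" for \<kappa> by (rule finite_subset[OF _ finite_int_interval[of \<alpha> \<beta>]]) blast
    fix \<kappa> \<kappa>' assume "\<kappa> \<in> totatives q" "\<kappa>' \<in> totatives q" "\<kappa> \<noteq> \<kappa>'"
    then show "?C \<kappa> \<inter> ?C \<kappa>' = {}" using totatives_mod_inj[of \<kappa> q \<kappa>'] by auto
  qed simp
  then have card: "real (card {p::int. \<alpha> \<le> real_of_int p \<and> real_of_int p \<le> \<beta> \<and> coprime p (int q)})
     = (\<Sum>\<kappa>\<in>totatives q. real (card (?C \<kappa>)))" unfolding coprime_class_eq[OF q] by simp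
  have "(\<Sum>\<kappa>\<in>totatives q. (\<beta> - \<alpha>) / q - 1) \<le> (\<Sum>\<kappa>\<in>totatives q. real (card (?C \<kappa>)))"
    by (intro sum_mono card_residue_class(1) q)
  then show "totient q * ((\<beta> - \<alpha>) / q - 1) \<le> real (card {p::int. \<alpha> \<le> real_of_int p \<and> real_of_int p \<le> \<beta> \<and> coprime p (int q)})"
    unfolding card totient_def by simp
  assume "\<alpha> \<le> \<beta>"
  then have "(\<Sum>\<kappa>\<in>totatives q. real (card (?C \<kappa>))) \<le> (\<Sum>\<kappa>\<in>totatives q. (\<beta> - \<alpha>) / q + 1)"
    by (intro sum_mono card_residue_class(2) q)
  then show "real (card {p::int. \<alpha> \<le> real_of_int p \<and> real_of_int p \<le> \<beta> \<and> coprime p (int q)}) \<le> totient q * ((\<beta> - \<alpha>) / q + 1)"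
    unfolding card totient_def by simp
qed

lemma overlap_neq_0: "overlap a b c w \<noteq> 0 \<Longrightarrow> max a (c - w / 2) < min b (c + w / 2)"
  unfolding overlap_def by linarith

definition centers :: "real \<Rightarrow> nat \<Rightarrow> int set" where
  "centers \<theta> q = {p. 0 \<le> p \<and> \<theta> * real_of_int p \<le> 1 \<and> coprime p (int q)}"

text \<open>Coprime multiples of \<open>\<theta>\<close> have mean density
  \<open>totient q / (\<theta> * q)\<close> and each carries a bar of length \<open>w\<close>; this
  weight makes the mean density of the comb equal to \<open>1\<close>.\<close>

definition comb_weight :: "real \<Rightarrow> nat \<Rightarrow> real \<Rightarrow> real" where
  "comb_weight \<theta> q w = \<theta> * q / (real (totient q) * w)"

definition comb :: "real \<Rightarrow> nat \<Rightarrow> real \<Rightarrow> real \<Rightarrow> real \<Rightarrow> real" where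
  "comb \<theta> q w a b = comb_weight \<theta> q w * (\<Sum>p\<in>centers \<theta> q. overlap a b (\<theta> * real_of_int p) w)"

lemma finite_centers [simp]:
  assumes "0 < \<theta>"
  shows "finite (centers \<theta> q)"
proof (rule finite_subset[OF _ finite_int_interval[of 0 "1 / \<theta>"]])
  show "centers \<theta> q \<subseteq> {p::int. 0 \<le> real_of_int p \<and> real_of_int p \<le> 1 / \<theta>}"
    unfolding centers_def using assms by (auto simp: field_simps)
qed

lemma comb_weight_nonneg: "0 \<le> \<theta> \<Longrightarrow> 0 \<le> w \<Longrightarrow> 0 \<le> comb_weight \<theta> q w"
  unfolding comb_weight_def by simp

lemma comb_nonneg:
  assumes "0 \<le> \<theta>" "0 \<le> w"
  shows "0 \<le> comb \<theta> q w a b"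
  unfolding comb_def using assms
  by (intro mult_nonneg_nonneg comb_weight_nonneg sum_nonneg overlap_nonneg)

text \<open>Bars meeting \<open>[a, b]\<close> have centres in its
  \<open>w / 2\<close>-neighbourhood, which accounts for \<open>w\<close>; the rounding in the
  coprime count accounts for one period \<open>\<theta> * q\<close>.\<close>

lemma comb_le:
  assumes \<theta>: "0 < \<theta>" and q: "0 < q" and w: "0 < w" and ab: "a \<le> b"
  shows "comb \<theta> q w a b \<le> (b - a) + w + \<theta> * q"
proof -
  define \<alpha> where "\<alpha> = (a - w / 2) / \<theta>"
  define \<beta> where "\<beta> = (b + w / 2) / \<theta>"
  let ?S = "{p::int. \<alpha> \<le> real_of_int p \<and> real_of_int p \<le> \<beta> \<and> coprime p (int q)}"
  have \<alpha>\<beta>: "\<alpha> \<le> \<beta>" unfolding \<alpha>_def \<beta>_def using ab w \<theta> by (intro divide_right_mono) auto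
  have fin: "finite ?S" by (rule finite_subset[OF _ finite_int_interval[of \<alpha> \<beta>]]) auto
  have tot: "0 < real (totient q)" using q by simp
  have "(\<Sum>p\<in>centers \<theta> q. overlap a b (\<theta> * real_of_int p) w) \<le> (\<Sum>p\<in>centers \<theta> q \<inter> ?S. overlap a b (\<theta> * real_of_int p) w)"
  proof (rule eq_refl, rule sum.mono_neutral_right)
    show "\<forall>p\<in>centers \<theta> q - (centers \<theta> q \<inter> ?S). overlap a b (\<theta> * real_of_int p) w = 0"
    proof
      fix p assume p: "p \<in> centers \<theta> q - (centers \<theta> q \<inter> ?S)"
      then have "real_of_int p < \<alpha> \<or> \<beta> < real_of_int p" unfolding centers_def by auto
      then have "\<theta> * real_of_int p + w / 2 < a \<or> b < \<theta> * real_of_int p - w / 2"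
        unfolding \<alpha>_def \<beta>_def using \<theta> by (auto simp: field_simps)
      then show "overlap a b (\<theta> * real_of_int p) w = 0" unfolding overlap_def by auto
    qed
  qed (use \<theta> in auto)
  also have "\<dots> \<le> (\<Sum>p\<in>centers \<theta> q \<inter> ?S. w)" using w by (intro sum_mono overlap_le_width) auto
  also have "\<dots> \<le> (\<Sum>p\<in>?S. w)" using fin w by (intro sum_mono2) auto
  also have "\<dots> = w * card ?S" by simp
  also have "\<dots> \<le> w * (totient q * ((\<beta> - \<alpha>) / q + 1))"
    using w card_coprime_class(2)[OF q \<alpha>\<beta>] by (intro mult_left_mono) auto
  finally have "comb \<theta> q w a b \<le> comb_weight \<theta> q w * (w * (totient q * ((\<beta> - \<alpha>) / q + 1)))"
    unfolding comb_def using \<theta> w by (intro mult_left_mono comb_weight_nonneg) auto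
  also have "\<dots> = \<theta> * (\<beta> - \<alpha>) + \<theta> * q"
    unfolding comb_weight_def using tot w q by (simp add: field_simps)
  also have "\<theta> * (\<beta> - \<alpha>) = b - a + w" unfolding \<alpha>_def \<beta>_def using \<theta> by (simp add: field_simps)
  finally show ?thesis by simp
qed

text \<open>Only bars lying entirely inside \<open>[a, b]\<close> are counted;
  \<open>0 \<le> a\<close> and \<open>b \<le> 1\<close> ensure that their centres belong to
  \<open>centers\<close>, which is cut off at \<open>0\<close> and \<open>1\<close>.\<close>

lemma comb_ge:
  assumes \<theta>: "0 < \<theta>" and q: "0 < q" and w: "0 < w" and ab: "0 \<le> a" "b \<le> 1"
  shows "(b - a) - w - \<theta> * q \<le> comb \<theta> q w a b"
proof -
  define \<alpha> where "\<alpha> = (a + w / 2) / \<theta>"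
  define \<beta> where "\<beta> = (b - w / 2) / \<theta>"
  let ?S = "{p::int. \<alpha> \<le> real_of_int p \<and> real_of_int p \<le> \<beta> \<and> coprime p (int q)}"
  have tot: "0 < real (totient q)" using q by simp
  have S: "a + w / 2 \<le> \<theta> * real_of_int p" "\<theta> * real_of_int p \<le> b - w / 2" if "p \<in> ?S" for p
    using that \<theta> unfolding \<alpha>_def \<beta>_def by (auto simp: field_simps)
  have sub: "?S \<subseteq> centers \<theta> q"
  proof
    fix p assume p: "p \<in> ?S"
    have "0 \<le> \<theta> * real_of_int p" "\<theta> * real_of_int p \<le> 1" using S[OF p] w ab by linarith+
    then show "p \<in> centers \<theta> q" unfolding centers_def using p \<theta> by (auto simp: zero_le_mult_iff)
  qed
  have "\<theta> * (\<beta> - \<alpha>) = b - a - w" unfolding \<alpha>_def \<beta>_def using \<theta> by (simp add: field_simps)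
  then have "(b - a) - w - \<theta> * q = \<theta> * (\<beta> - \<alpha>) - \<theta> * q" by simp
  also have "\<dots> = comb_weight \<theta> q w * (w * (totient q * ((\<beta> - \<alpha>) / q - 1)))"
    unfolding comb_weight_def using tot w q by (simp add: field_simps)
  also have "\<dots> \<le> comb_weight \<theta> q w * (w * card ?S)"
    using w \<theta> card_coprime_class(1)[OF q] by (intro mult_left_mono comb_weight_nonneg) auto
  also have "w * card ?S = (\<Sum>p\<in>?S. overlap a b (\<theta> * real_of_int p) w)"
  proof -
    have "overlap a b (\<theta> * real_of_int p) w = w" if "p \<in> ?S" for p
      using S[OF that] w unfolding overlap_def by (auto simp: min_def max_def)
    then have "(\<Sum>p\<in>?S. overlap a b (\<theta> * real_of_int p) w) = (\<Sum>p\<in>?S. w)" by (intro sum.cong refl)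
    then show ?thesis by simp
  qed
  also have "\<dots> \<le> (\<Sum>p\<in>centers \<theta> q. overlap a b (\<theta> * real_of_int p) w)"
    using sub \<theta> overlap_nonneg by (intro sum_mono2) auto
  finally show ?thesis
    unfolding comb_def using \<theta> w by (simp add: comb_weight_nonneg mult_left_mono)
qed

text \<open>Complements \<open>comb_le\<close> on intervals shorter than the period: for
  \<open>w \<le> \<theta>\<close> distinct bars do not overlap, so the density of the comb never
  exceeds its weight, up to endpoints.\<close>

lemma comb_le_weight:
  assumes \<theta>: "0 < \<theta>" and w: "0 < w" "w \<le> \<theta>" and ab: "a \<le> b"
  shows "comb \<theta> q w a b \<le> comb_weight \<theta> q w * (b - a)"
  unfolding comb_def
proof (intro mult_left_mono sum_overlap_separated_le)
  fix p p' :: int assume "p \<noteq> p'"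
  then have "1 \<le> \<bar>p - p'\<bar>" by linarith
  then have "1 \<le> \<bar>real_of_int p - real_of_int p'\<bar>" by (metis of_int_1_le_iff of_int_abs of_int_diff)
  then have "\<theta> * 1 \<le> \<theta> * \<bar>real_of_int p - real_of_int p'\<bar>" using \<theta> by (intro mult_left_mono) auto
  also have "\<dots> = \<bar>\<theta> * real_of_int p - \<theta> * real_of_int p'\<bar>" using \<theta> by (simp add: abs_mult flip: right_diff_distrib)
  finally show "w \<le> \<bar>\<theta> * real_of_int p - \<theta> * real_of_int p'\<bar>" using w by simp
qed (use assms in \<open>auto intro: comb_weight_nonneg\<close>)

text \<open>The values \<open>P q' - P' q\<close> are multiples of \<open>gcd q q'\<close>, and each of them determines \<open>P\<close> modulo
  \<open>q div gcd q q'\<close>.\<close>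

lemma card_close_pairs:
  fixes q q' :: nat and D L :: real
  assumes q: "0 < q" "0 < q'" and D: "1 \<le> D" and L: "0 \<le> L"
  defines "S \<equiv> {(P::int, P'::int). 0 \<le> P \<and> real_of_int P \<le> D * real q \<and> \<bar>real_of_int (P * int q' - P' * int q)\<bar> \<le> L}"
  shows "finite S" and "real (card S) \<le> (2 * L / gcd q q' + 1) * (D * gcd q q' + 1)"
proof -
  define d where "d = gcd q q'"
  define q1 where "q1 = q div d"
  have d: "0 < d" "q = q1 * d" "0 < q1" unfolding d_def q1_def using q by (auto simp: div_greater_zero_iff)
  define V where "V = {v::int. - L / d \<le> real_of_int v \<and> real_of_int v \<le> L / d}"
  have finV: "finite V" unfolding V_def by (rule finite_int_interval)
  have cardV: "real (card V) \<le> 2 * L / d + 1"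
    unfolding V_def using card_int_interval(2)[where \<alpha> = "- L / d" and \<beta> = "L / d"] L by simp
  define A where "A v = {(P::int, P'::int). 0 \<le> P \<and> real_of_int P \<le> D * real q \<and> P * int q' - P' * int q = v * int d}" for v :: int
  have mem_A: "x \<in> A v \<longleftrightarrow> 0 \<le> fst x \<and> real_of_int (fst x) \<le> D * real q
      \<and> fst x * int q' - snd x * int q = v * int d" for x v
    unfolding A_def by (simp add: split_def)
  have A: "finite (A v) \<and> real (card (A v)) \<le> D * d + 1" for v
  proof (cases "A v = {}")
    case True
    then show ?thesis using D by simp
  next
    case False
    then obtain P0 P0' where P0: "P0 * int q' - P0' * int q = v * int d" unfolding A_def by auto
    define B where "B = {P::int. 0 \<le> real_of_int P \<and> real_of_int P \<le> D * q \<and> P mod int q1 = P0 mod int q1}"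
    have finB: "finite B" unfolding B_def by (rule finite_subset[OF _ finite_int_interval[of 0 "D * q"]]) auto
    \<comment> \<open>For fixed \<open>v\<close> the numerator \<open>P\<close> determines
      \<open>P'\<close>, since \<open>q\<close> is positive; so it suffices to count the possible
      \<open>P\<close> in one residue class modulo \<open>q1\<close>.\<close>
    have inj: "inj_on fst (A v)"
    proof (rule inj_onI)
      fix x y assume "x \<in> A v" "y \<in> A v" "fst x = fst y"
      then have "fst x * int q' - snd x * int q = fst x * int q' - snd y * int q" unfolding mem_A by simp
      then have "snd x * int q = snd y * int q" by simp
      then show "x = y" using q \<open>fst x = fst y\<close> by (simp add: prod_eq_iff)
    qed
    have sub: "fst ` A v \<subseteq> B"
    proof
      fix P assume "P \<in> fst ` A v"
      then obtain x where "x \<in> A v" "P = fst x" by blast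
      then obtain P' where P: "0 \<le> P" "real_of_int P \<le> D * real q" "P * int q' - P' * int q = v * int d"
        unfolding mem_A by blast
      have "(P - P0) * int q' = (P' - P0') * int q" using P(3) P0 by (simp add: algebra_simps)
      then have "int q dvd (P - P0) * int q'" by simp
      then have "int q1 dvd P - P0"
      proof -
        define q1' where "q1' = q' div d"
        have q1': "q' = q1' * d" "coprime q1 q1'"
          unfolding q1_def q1'_def d_def using q by (auto intro: div_gcd_coprime)
        have "int q1 * int d dvd ((P - P0) * int q1') * int d"
          using \<open>int q dvd (P - P0) * int q'\<close> unfolding d(2) q1'(1) by (simp add: mult.assoc)
        then have "int q1 dvd (P - P0) * int q1'" using d(1) by simp
        then show ?thesis using q1'(2) by (simp add: coprime_dvd_mult_left_iff)
      qed
      then show "P \<in> B" unfolding B_def using P by (simp add: mod_eq_dvd_iff)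
    qed
    have "real (card B) \<le> (D * q - 0) / q1 + 1"
      unfolding B_def using d(3) D by (intro card_residue_class(2)) auto
    also have "\<dots> = D * d + 1" using d by simp
    finally have cB: "real (card B) \<le> D * d + 1" .
    have "finite (A v)" using finite_subset[OF sub finB] inj by (simp add: finite_image_iff)
    moreover have "card (A v) \<le> card B" using card_inj_on_le[OF inj sub finB] .
    ultimately show ?thesis using cB by simp
  qed
  have sub: "S \<subseteq> (\<Union>v\<in>V. A v)"
  proof
    fix x assume "x \<in> S"
    then obtain P P' where x: "x = (P, P')" "0 \<le> P" "real_of_int P \<le> D * real q" "\<bar>real_of_int (P * int q' - P' * int q)\<bar> \<le> L"
      unfolding S_def by auto
    have "int d dvd P * int q' - P' * int q" unfolding d_def by (simp add: dvd_diff)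
    then obtain v where v: "P * int q' - P' * int q = v * int d" by (auto simp: dvd_def mult.commute)
    have "\<bar>real_of_int v\<bar> * d \<le> L" using x(4) unfolding v by (simp add: abs_mult)
    then have "\<bar>real_of_int v\<bar> \<le> L / d" using d by (simp add: field_simps)
    then have "v \<in> V" unfolding V_def by (auto simp: abs_le_iff)
    then show "x \<in> (\<Union>v\<in>V. A v)" using x v unfolding A_def by auto
  qed
  show "finite S" using finite_subset[OF sub] finV A by blast
  have "card S \<le> card (\<Union>v\<in>V. A v)" using sub finV A by (intro card_mono) auto
  also have "\<dots> \<le> (\<Sum>v\<in>V. card (A v))" by (rule card_UN_le[OF finV])
  finally have "real (card S) \<le> (\<Sum>v\<in>V. real (card (A v)))" by (simp flip: of_nat_sum)
  also have "\<dots> \<le> (\<Sum>v\<in>V. D * d + 1)" using A by (intro sum_mono) auto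
  also have "\<dots> = card V * (D * d + 1)" by simp
  also have "\<dots> \<le> (2 * L / d + 1) * (D * d + 1)" using cardV D by (intro mult_right_mono) auto
  finally show "real (card S) \<le> (2 * L / gcd q q' + 1) * (D * gcd q q' + 1)" unfolding d_def .
qed

text \<open>A cell meeting both bars forces the centres to be within \<open>w\<close> plus the cell
  length. One factor is then bounded by its maximum, while the other sums to at most
  \<open>w\<close> over the grid.\<close>

lemma sum_overlap_pair_le:
  assumes w: "0 < w"
  shows "(\<Sum>i\<in>{0..2 ^ t :: int}. overlap (real_of_int i / 2 ^ t) ((real_of_int i + 1) / 2 ^ t) c w
            * overlap (real_of_int i / 2 ^ t) ((real_of_int i + 1) / 2 ^ t) c' w)
     \<le> (if \<bar>c - c'\<bar> \<le> w + 1 / 2 ^ t then min w (1 / 2 ^ t) * w else 0)"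
proof (cases "\<bar>c - c'\<bar> \<le> w + 1 / 2 ^ t")
  case True
  let ?o = "\<lambda>i. overlap (real_of_int i / 2 ^ t) ((real_of_int i + 1) / 2 ^ t)"
  have "?o i c' w \<le> min w (1 / 2 ^ t)" for i
    using overlap_le_width[of w "real_of_int i / 2 ^ t" "(real_of_int i + 1) / 2 ^ t" c'] w
      overlap_le_length[of "real_of_int i / 2 ^ t" "(real_of_int i + 1) / 2 ^ t" c' w]
    by (simp add: add_divide_distrib)
  then have "(\<Sum>i\<in>{0..2 ^ t}. ?o i c w * ?o i c' w) \<le> (\<Sum>i\<in>{0..2 ^ t}. ?o i c w * min w (1 / 2 ^ t))"
    by (intro sum_mono mult_left_mono overlap_nonneg)
  also have "\<dots> = (\<Sum>i\<in>{0..2 ^ t}. ?o i c w) * min w (1 / 2 ^ t)" by (simp add: sum_distrib_right)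
  also have "\<dots> \<le> w * min w (1 / 2 ^ t)" using w by (intro mult_right_mono sum_overlap_grid_le) auto
  finally show ?thesis using True by (simp add: mult.commute)
next
  case False
  have "overlap (real_of_int i / 2 ^ t) ((real_of_int i + 1) / 2 ^ t) c w
       * overlap (real_of_int i / 2 ^ t) ((real_of_int i + 1) / 2 ^ t) c' w = 0" for i
  proof -
    have "(real_of_int i + 1) / 2 ^ t = real_of_int i / 2 ^ t + 1 / 2 ^ t" by (simp add: add_divide_distrib)
    then have "max (real_of_int i / 2 ^ t) (c - w / 2) < min ((real_of_int i + 1) / 2 ^ t) (c + w / 2) \<Longrightarrow>
       max (real_of_int i / 2 ^ t) (c' - w / 2) < min ((real_of_int i + 1) / 2 ^ t) (c' + w / 2) \<Longrightarrow> False"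
      using False by (simp add: abs_if split: if_splits)
    then show ?thesis using overlap_neq_0 by fastforce
  qed
  then show ?thesis using False by (simp only: sum.neutral_const if_False order_refl)
qed

text \<open>The term \<open>4 * (w + 1 / 2 ^ t)\<close> is, up to a constant, what independent
  equidistributed centres would give. The \<open>gcd\<close> term is the excess caused by
  coincidences \<open>P / q = P' / q'\<close>.\<close>

lemma sum_comb_pair_le:
  fixes q q' :: nat and D w :: real
  assumes q: "0 < q" "0 < q'" and D: "1 \<le> D" and w: "0 < w"
  shows "(\<Sum>i\<in>{0..2 ^ t :: int}. comb (1 / (D * q)) 1 w (real_of_int i / 2 ^ t) ((real_of_int i + 1) / 2 ^ t)
            * comb (1 / (D * q')) 1 w (real_of_int i / 2 ^ t) ((real_of_int i + 1) / 2 ^ t))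
     \<le> min 1 ((1 / 2 ^ t) / w) * (4 * (w + 1 / 2 ^ t) + 2 * real (gcd q q') / (D * q * q'))"
proof -
  define r :: real where "r = 1 / 2 ^ t"
  have r: "0 < r" unfolding r_def by simp
  let ?o = "\<lambda>i. overlap (real_of_int i / 2 ^ t) ((real_of_int i + 1) / 2 ^ t)"
  define \<theta> where "\<theta> = 1 / (D * q)"
  define \<theta>' where "\<theta>' = 1 / (D * q')"
  have \<theta>: "0 < \<theta>" "0 < \<theta>'" unfolding \<theta>_def \<theta>'_def using D q by auto
  define d where "d = real (gcd q q')"
  have d: "1 \<le> d" unfolding d_def using q by (simp add: Suc_leI)
  \<comment> \<open>Clearing denominators: the centres \<open>P / (D * q)\<close> and
    \<open>P' / (D * q')\<close> are within \<open>w + r\<close> exactly if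
    \<open>P * q' - P' * q\<close> is at most \<open>L\<close> in absolute value.\<close>
  define L where "L = (w + r) * (D * q * q')"
  have L: "0 \<le> L" unfolding L_def using w r D by simp
  define S where "S = {(P::int, P'::int). 0 \<le> P \<and> real_of_int P \<le> D * real q \<and> \<bar>real_of_int (P * int q' - P' * int q)\<bar> \<le> L}"
  have S: "finite S" "real (card S) \<le> (2 * L / d + 1) * (D * d + 1)"
    unfolding S_def d_def using card_close_pairs[OF q D L] by auto
  have sub: "{x \<in> centers \<theta> 1 \<times> centers \<theta>' 1. \<bar>\<theta> * fst x - \<theta>' * snd x\<bar> \<le> w + r} \<subseteq> S"
  proof
    fix x assume "x \<in> {x \<in> centers \<theta> 1 \<times> centers \<theta>' 1. \<bar>\<theta> * fst x - \<theta>' * snd x\<bar> \<le> w + r}"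
    then obtain P P' where x: "x = (P, P')" "P \<in> centers \<theta> 1" "P' \<in> centers \<theta>' 1" "\<bar>\<theta> * P - \<theta>' * P'\<bar> \<le> w + r"
      by (cases x) auto
    have "0 < D * q" "0 < D * q * q'" using D q by auto
    have "P \<le> D * q" using x(2) \<open>0 < D * q\<close> unfolding centers_def \<theta>_def by (simp add: field_simps)
    moreover have "0 \<le> P" using x(2) unfolding centers_def by auto
    moreover have "\<bar>real_of_int (P * int q' - P' * int q)\<bar> \<le> L"
    proof -
      have "\<theta> * P - \<theta>' * P' = real_of_int (P * int q' - P' * int q) / (D * q * q')"
        unfolding \<theta>_def \<theta>'_def using q D by (simp add: field_simps)
      then have "\<bar>real_of_int (P * int q' - P' * int q)\<bar> / (D * q * q') \<le> w + r"
        using x(4) \<open>0 < D * q * q'\<close> by (simp add: abs_divide)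
      then show ?thesis unfolding L_def using \<open>0 < D * q * q'\<close> by (simp add: pos_divide_le_eq)
    qed
    ultimately show "x \<in> S" unfolding S_def x(1) by simp
  qed
  have eq: "(\<Sum>i\<in>{0..2 ^ t}. comb \<theta> 1 w (real_of_int i / 2 ^ t) ((real_of_int i + 1) / 2 ^ t)
            * comb \<theta>' 1 w (real_of_int i / 2 ^ t) ((real_of_int i + 1) / 2 ^ t))
      = (\<theta> / w) * (\<theta>' / w) * (\<Sum>i\<in>{0..2 ^ t}. \<Sum>x\<in>centers \<theta> 1 \<times> centers \<theta>' 1. ?o i (\<theta> * fst x) w * ?o i (\<theta>' * snd x) w)"
    unfolding comb_def comb_weight_def
    by (simp add: sum_product sum.cartesian_product sum_distrib_left split_def mult_ac)
  have "(\<Sum>i\<in>{0..2 ^ t}. \<Sum>x\<in>centers \<theta> 1 \<times> centers \<theta>' 1. ?o i (\<theta> * fst x) w * ?o i (\<theta>' * snd x) w)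
      = (\<Sum>x\<in>centers \<theta> 1 \<times> centers \<theta>' 1. \<Sum>i\<in>{0..2 ^ t}. ?o i (\<theta> * fst x) w * ?o i (\<theta>' * snd x) w)"
    by (rule sum.swap)
  also have "\<dots> \<le> (\<Sum>x\<in>centers \<theta> 1 \<times> centers \<theta>' 1. if \<bar>\<theta> * fst x - \<theta>' * snd x\<bar> \<le> w + r then min w r * w else 0)"
    unfolding r_def by (intro sum_mono sum_overlap_pair_le w)
  also have "\<dots> = (\<Sum>x\<in>{x \<in> centers \<theta> 1 \<times> centers \<theta>' 1. \<bar>\<theta> * fst x - \<theta>' * snd x\<bar> \<le> w + r}. min w r * w)"
    by (rule sum.inter_filter[symmetric]) (use \<theta> in simp)
  also have "\<dots> \<le> (\<Sum>x\<in>S. min w r * w)" using sub S(1) w r by (intro sum_mono2) auto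
  also have "\<dots> = card S * (min w r * w)" by simp
  also have "\<dots> \<le> ((2 * L / d + 1) * (D * d + 1)) * (min w r * w)"
    using S(2) w r by (intro mult_right_mono) auto
  also have "\<dots> \<le> ((2 * L / d + 1) * (2 * (D * d))) * (min w r * w)"
  proof -
    have "1 * 1 \<le> D * d" using D d by (intro mult_mono) auto
    then show ?thesis using w r L d by (intro mult_right_mono mult_left_mono) auto
  qed
  also have "(2 * L / d + 1) * (2 * (D * d)) = 4 * L * D + 2 * D * d" using d by (simp add: field_simps)
  finally have bound: "(\<Sum>i\<in>{0..2 ^ t}. \<Sum>x\<in>centers \<theta> 1 \<times> centers \<theta>' 1. ?o i (\<theta> * fst x) w * ?o i (\<theta>' * snd x) w)
     \<le> (4 * L * D + 2 * D * d) * (min w r * w)" .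
  have "(\<Sum>i\<in>{0..2 ^ t}. comb \<theta> 1 w (real_of_int i / 2 ^ t) ((real_of_int i + 1) / 2 ^ t)
            * comb \<theta>' 1 w (real_of_int i / 2 ^ t) ((real_of_int i + 1) / 2 ^ t))
     \<le> (\<theta> / w) * (\<theta>' / w) * ((4 * L * D + 2 * D * d) * (min w r * w))"
    unfolding eq using \<theta> w by (intro mult_left_mono bound) auto
  also have "\<dots> = (min w r / w) * (4 * (w + r) + 2 * d / (D * q * q'))"
    unfolding \<theta>_def \<theta>'_def L_def using D q w by (simp add: field_simps)
  also have "min w r / w = min 1 (r / w)" using w by (simp add: min_def field_simps)
  finally show ?thesis unfolding \<theta>_def \<theta>'_def d_def r_def .
qed

section \<open>Arithmetic estimates\<close>

text \<open>The \<open>i\<close>-th smallest of distinct integers that are at least \<open>2\<close>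
  is at least \<open>i + 1\<close>, so the product dominates the telescoping product of
  \<open>1 - 1 / (i + 1)\<close>.\<close>

lemma prod_one_minus_inverse_ge:
  fixes A :: "nat set"
  assumes "finite A" "\<And>p. p \<in> A \<Longrightarrow> 2 \<le> p"
  shows "1 / (card A + 1) \<le> (\<Prod>p\<in>A. 1 - 1 / real p)"
  using assms
proof (induction A rule: finite_linorder_max_induct)
  case (insert b A)
  have "A \<subseteq> {2..<b}" using insert by auto
  then have "card A \<le> b - 2" using card_mono[of "{2..<b}" A] by simp
  moreover have "2 \<le> b" using insert by auto
  ultimately have b: "card A + 2 \<le> b" by simp
  have "1 / (card A + 2) = (1 / (card A + 1)) * (1 - 1 / (card A + 2))" by (simp add: field_simps)
  also have "\<dots> \<le> (\<Prod>p\<in>A. 1 - 1 / real p) * (1 - 1 / real b)"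
  proof (intro mult_mono)
    show "1 / (card A + 1) \<le> (\<Prod>p\<in>A. 1 - 1 / real p)" using insert by auto
    then show "0 \<le> (\<Prod>p\<in>A. 1 - 1 / real p)" by (rule order_trans[rotated]) simp
    show "1 - 1 / real (card A + 2) \<le> 1 - 1 / real b" using b by (simp add: frac_le)
  qed simp
  finally show ?case using insert by (auto simp: mult.commute add.commute)
qed simp

text \<open>Each distinct prime factor contributes at least a factor \<open>2\<close>, so
  \<open>q\<close> has at most \<open>k\<close> of them. The loss \<open>k + 1\<close> is
  logarithmic in the scale and will be absorbed by an arbitrarily small exponent.\<close>

lemma totient_lower_bound:
  assumes "0 < q" "q \<le> 2 ^ k"
  shows "real q \<le> totient q * (real k + 1)"
proof -
  have "2 ^ card (prime_factors q) = (\<Prod>p\<in>prime_factors q. 2 :: nat)" by simp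
  also have "\<dots> \<le> (\<Prod>p\<in>prime_factors q. p ^ multiplicity p q)"
  proof (intro prod_mono conjI)
    fix p assume p: "p \<in> prime_factors q"
    then have "2 \<le> p" by (auto intro: prime_ge_2_nat)
    moreover have "1 \<le> multiplicity p q" using p assms by (simp add: prime_factors_multiplicity Suc_leI)
    ultimately have "2 ^ 1 \<le> p ^ multiplicity p q"
      by (meson order_trans power_increasing power_mono le_trans one_le_numeral zero_le)
    then show "2 \<le> p ^ multiplicity p q" by simp
  qed simp
  also have "\<dots> = q" using prime_factorization_nat[OF assms(1)] by simp
  also have "q \<le> 2 ^ k" by fact
  finally have "card (prime_factors q) \<le> k" by simp
  then have "1 / (real k + 1) \<le> 1 / (card (prime_factors q) + 1)" by (intro divide_left_mono) auto
  also have "\<dots> \<le> (\<Prod>p\<in>prime_factors q. 1 - 1 / real p)"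
    by (intro prod_one_minus_inverse_ge) (auto intro: prime_ge_2_nat)
  finally have "real q * (1 / (real k + 1)) \<le> totient q"
    unfolding totient_formula2 by (intro mult_left_mono) auto
  then show ?thesis by (simp add: field_simps)
qed

lemma card_multiples_le:
  assumes "0 < d"
  shows "real (card {q\<in>{1..M}. d dvd q}) \<le> real M / d"
proof -
  have "{q\<in>{1..M}. d dvd q} \<subseteq> (\<lambda>j. d * j) ` {1..M div d}"
  proof
    fix q assume q: "q \<in> {q\<in>{1..M}. d dvd q}"
    then obtain j where j: "q = d * j" by auto
    then have "j \<in> {1..M div d}" using q assms by (auto simp: less_eq_div_iff_mult_less_eq mult.commute Suc_leI)
    then show "q \<in> (\<lambda>j. d * j) ` {1..M div d}" using j by blast
  qed
  then have "card {q\<in>{1..M}. d dvd q} \<le> card {1..M div d}"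
    by (meson surj_card_le finite_atLeastAtMost)
  also have "\<dots> = M div d" by simp
  finally have "real (card {q\<in>{1..M}. d dvd q}) \<le> real (M div d)" by simp
  also have "\<dots> \<le> real M / d"
  proof -
    have "real (M div d * d) \<le> real M" unfolding of_nat_le_iff by simp
    then show ?thesis using assms by (simp add: pos_le_divide_eq)
  qed
  finally show ?thesis .
qed

text \<open>Bound the power of the gcd by the sum of \<open>d ^ m\<close> over common divisors
  \<open>d\<close> and exchange the sums. There are at most \<open>M / d\<close> multiples of
  \<open>d\<close>, so each \<open>d\<close> contributes at most
  \<open>M ^ 2 * d ^ (m - 1) / d\<close>, hence at most \<open>M ^ (m + 1) / d\<close>.\<close>

lemma sum_gcd_power_le:
  assumes m: "0 < m"
  shows "(\<Sum>q\<in>{1..M}. \<Sum>q'\<in>{1..M}. real (gcd q q') ^ m) \<le> real M ^ (m + 1) * harm M"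
proof -
  let ?A = "\<lambda>d. {q\<in>{1..M}. d dvd q}"
  have "real (gcd q q') ^ m \<le> (\<Sum>d\<in>{1..M}. real d ^ m * (of_bool (d dvd q) * of_bool (d dvd q')))"
    if "q \<in> {1..M}" "q' \<in> {1..M}" for q q'
  proof -
    have "gcd q q' \<le> q" "q \<le> M" "0 < q" using that by (auto intro: gcd_le1_nat)
    then have "gcd q q' \<le> M" "0 < gcd q q'" by (meson order_trans) (use \<open>0 < q\<close> in simp)
    then have "gcd q q' \<in> {1..M}" by (simp only: atLeastAtMost_iff Suc_le_eq One_nat_def simp_thms)
    then show ?thesis
      using member_le_sum[of "gcd q q'" "{1..M}" "\<lambda>d. real d ^ m * (of_bool (d dvd q) * of_bool (d dvd q'))"]
      by simp
  qed
  then have "(\<Sum>q\<in>{1..M}. \<Sum>q'\<in>{1..M}. real (gcd q q') ^ m)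
     \<le> (\<Sum>q\<in>{1..M}. \<Sum>q'\<in>{1..M}. \<Sum>d\<in>{1..M}. real d ^ m * (of_bool (d dvd q) * of_bool (d dvd q')))"
    by (intro sum_mono) auto
  also have "\<dots> = (\<Sum>q\<in>{1..M}. \<Sum>d\<in>{1..M}. \<Sum>q'\<in>{1..M}. real d ^ m * (of_bool (d dvd q) * of_bool (d dvd q')))"
    by (intro sum.cong refl sum.swap)
  also have "\<dots> = (\<Sum>d\<in>{1..M}. \<Sum>q\<in>{1..M}. \<Sum>q'\<in>{1..M}. real d ^ m * (of_bool (d dvd q) * of_bool (d dvd q')))"
    by (rule sum.swap)
  also have "\<dots> = (\<Sum>d\<in>{1..M}. real d ^ m * (real (card (?A d)) * real (card (?A d))))"
  proof (rule sum.cong)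
    fix d
    have c: "real (card (?A d)) = (\<Sum>q\<in>{1..M}. of_bool (d dvd q))"
      by (simp add: of_bool_def sum.If_cases Int_def)
    show "(\<Sum>q\<in>{1..M}. \<Sum>q'\<in>{1..M}. real d ^ m * (of_bool (d dvd q) * of_bool (d dvd q')))
       = real d ^ m * (real (card (?A d)) * real (card (?A d)))"
      unfolding c by (subst sum_product) (simp only: sum_distrib_left)
  qed simp
  also have "\<dots> \<le> (\<Sum>d\<in>{1..M}. real M ^ (m + 1) * inverse (real d))"
  proof (rule sum_mono)
    fix d assume d: "d \<in> {1..M}"
    have "real d ^ m * (real (card (?A d)) * real (card (?A d))) \<le> real d ^ m * ((real M / d) * (real M / d))"
      using card_multiples_le[of d M] d by (intro mult_left_mono mult_mono) auto
    also have "\<dots> = real d ^ (m - 1) * (real M ^ 2 / d)"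
      using m d by (cases m) (auto simp: field_simps power2_eq_square)
    also have "\<dots> \<le> real M ^ (m - 1) * (real M ^ 2 / d)"
      using d by (intro mult_right_mono power_mono) auto
    also have "\<dots> = real M ^ (m + 1) * inverse (real d)"
      using m by (cases m) (auto simp: field_simps power2_eq_square)
    finally show "real d ^ m * (real (card (?A d)) * real (card (?A d))) \<le> real M ^ (m + 1) * inverse (real d)" .
  qed
  also have "\<dots> = real M ^ (m + 1) * harm M" unfolding harm_def by (simp add: sum_distrib_left)
  finally show ?thesis .
qed

lemma harm_le_Suc:
  assumes "0 < M" "M \<le> 2 ^ k"
  shows "harm M \<le> real k + 1"
proof -
  obtain n where n: "M = Suc n" using assms by (cases M) auto
  have "harm (Suc n) - ln (real (Suc n)) \<le> harm (Suc 0) - ln (real (Suc 0))"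
    using decseq_harm_diff_ln unfolding decseq_def by (metis le0)
  then have "harm M \<le> 1 + ln (real M)" unfolding n by (simp add: harm_def)
  also have "ln (real M) \<le> ln (2 ^ k)" using assms by (intro ln_mono) (auto simp flip: of_nat_le_iff)
  also have "\<dots> = k * ln 2" by (simp add: ln_realpow)
  also have "\<dots> \<le> real k * 1" using ln_2_less_1 by (intro mult_left_mono) auto
  finally show ?thesis by simp
qed

section \<open>The density carried by the slabs of one level\<close>

lemma measure_cbox_Int_centered:
  fixes a c :: "'a::euclidean_space"
  assumes "\<And>b. b \<in> Basis \<Longrightarrow> 0 \<le> w b"
  shows "measure lborel (cbox a c \<inter> cbox (\<Sum>b\<in>Basis. (x b - w b / 2) *\<^sub>R b) (\<Sum>b\<in>Basis. (x b + w b / 2) *\<^sub>R b))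
     = (\<Prod>b\<in>Basis. overlap (a \<bullet> b) (c \<bullet> b) (x b) (w b))"
proof (cases "\<forall>b\<in>Basis. max (a \<bullet> b) (x b - w b / 2) \<le> min (c \<bullet> b) (x b + w b / 2)")
  case True
  then show ?thesis
    unfolding Int_interval
    by (subst measure_lborel_cbox_eq) (auto simp: overlap_def inner_diff_left intro!: prod.cong)
next
  case False
  then obtain b where b: "b \<in> Basis" "\<not> max (a \<bullet> b) (x b - w b / 2) \<le> min (c \<bullet> b) (x b + w b / 2)" by blast
  then have "overlap (a \<bullet> b) (c \<bullet> b) (x b) (w b) = 0" unfolding overlap_def by linarith
  then have "(\<Prod>b\<in>Basis. overlap (a \<bullet> b) (c \<bullet> b) (x b) (w b)) = 0"
    using b(1) by (intro prod_zero) auto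
  moreover have "measure lborel (cbox a c \<inter> cbox (\<Sum>b\<in>Basis. (x b - w b / 2) *\<^sub>R b) (\<Sum>b\<in>Basis. (x b + w b / 2) *\<^sub>R b)) = 0"
    unfolding Int_interval using b by (subst measure_lborel_cbox_eq) auto
  ultimately show ?thesis by simp
qed

text \<open>\<open>b0\<close> is the long direction, \<open>u / q\<close> the spacing of the centres
  along it, and \<open>w1 * Q \<le> u\<close> keeps the bars there from overlapping for every
  \<open>q \<le> Q\<close>. The bound \<open>8 \<le> Q\<close> guarantees enough odd denominators,
  and \<open>Q \<le> 2 ^ k\<close> turns logarithms of \<open>Q\<close> into factors
  \<open>k + 1\<close>.\<close>

locale slab_family =
  fixes b0 :: "'a::euclidean_space" and D Q u w1 w2 :: real and k :: nat
  assumes b0: "b0 \<in> Basis" and dim: "2 \<le> DIM('a)"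
    and D: "1 \<le> D" and Q: "8 \<le> Q" "Q \<le> 2 ^ k"
    and w1: "0 < w1" and w2: "0 < w2" and u: "w1 * Q \<le> u"
begin

definition denoms :: "nat set" where
  "denoms = {q. odd q \<and> Q / 2 \<le> real q \<and> real q \<le> Q}"

definition spacing :: "nat \<Rightarrow> 'a \<Rightarrow> real" where
  "spacing q b = (if b = b0 then u / q else 1 / (D * q))"

text \<open>Modulus \<open>1\<close> switches off the coprimality condition of
  \<open>centers\<close> in the transverse directions, so that one notion of comb serves all
  coordinates.\<close>

definition modulus :: "nat \<Rightarrow> 'a \<Rightarrow> nat" where
  "modulus q b = (if b = b0 then q else 1)"

definition width :: "'a \<Rightarrow> real" where
  "width b = (if b = b0 then w1 else w2)"

definition slabs :: "(nat \<times> ('a \<Rightarrow> int)) set" where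
  "slabs = Sigma denoms (\<lambda>q. PiE Basis (\<lambda>b. centers (spacing q b) (modulus q b)))"

definition slab_weight :: "nat \<times> ('a \<Rightarrow> int) \<Rightarrow> real" where
  "slab_weight i = (\<Prod>b\<in>Basis. comb_weight (spacing (fst i) b) (modulus (fst i) b) (width b)) / card denoms"

definition slab_lo :: "nat \<times> ('a \<Rightarrow> int) \<Rightarrow> 'a" where
  "slab_lo i = (\<Sum>b\<in>Basis. (spacing (fst i) b * real_of_int (snd i b) - width b / 2) *\<^sub>R b)"

definition slab_hi :: "nat \<times> ('a \<Rightarrow> int) \<Rightarrow> 'a" where
  "slab_hi i = (\<Sum>b\<in>Basis. (spacing (fst i) b * real_of_int (snd i b) + width b / 2) *\<^sub>R b)"

definition slab_density :: "'a \<Rightarrow> real" where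
  "slab_density x = (\<Sum>i\<in>slabs. slab_weight i * indicator (cbox (slab_lo i) (slab_hi i)) x)"

lemma u_pos: "0 < u"
  using u w1 Q mult_pos_pos[of w1 Q] by linarith

lemma width_pos: "0 < width b"
  unfolding width_def using w1 w2 by simp

lemma denoms_subset: "denoms \<subseteq> {1..nat \<lfloor>Q\<rfloor>}"
  unfolding denoms_def by (auto simp: le_nat_floor intro!: odd_pos Suc_leI)

lemma finite_denoms [simp]: "finite denoms"
  using denoms_subset by (rule finite_subset) simp

lemma denoms_pos: "q \<in> denoms \<Longrightarrow> 0 < q"
  unfolding denoms_def by (auto intro: odd_pos)

lemma spacing_pos: "q \<in> denoms \<Longrightarrow> 0 < spacing q b"
  unfolding spacing_def using denoms_pos u_pos D by auto

lemma modulus_pos: "q \<in> denoms \<Longrightarrow> 0 < modulus q b"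
  unfolding modulus_def using denoms_pos by auto

lemma finite_slabs: "finite slabs"
  unfolding slabs_def using spacing_pos by (intro finite_SigmaI finite_PiE finite_centers) auto

lemma card_denoms: "Q / 8 \<le> real (card denoms)"
proof -
  define J where "J = {j::int. (Q / 2 - 1) / 2 \<le> real_of_int j \<and> real_of_int j \<le> (Q - 1) / 2}"
  \<comment> \<open>The right-hand side is \<open>Q / 4 - 1\<close>; this is where
    \<open>8 \<le> Q\<close> enters.\<close>
  have "Q / 8 \<le> (Q - 1) / 2 - (Q / 2 - 1) / 2 - 1" using Q by (simp add: field_simps)
  also have "\<dots> \<le> real (card J)" unfolding J_def by (rule card_int_interval(1))
  also have "card J \<le> card denoms"
  proof (rule card_inj_on_le)
    have J0: "0 \<le> j" if "j \<in> J" for j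
    proof -
      have "0 \<le> (Q / 2 - 1) / 2" using Q by simp
      then have "0 \<le> real_of_int j" using that unfolding J_def by force
      then show ?thesis by simp
    qed
    show "inj_on (\<lambda>j. nat (2 * j + 1)) J" using J0 by (intro inj_onI) force
    show "(\<lambda>j. nat (2 * j + 1)) ` J \<subseteq> denoms"
    proof
      fix q assume "q \<in> (\<lambda>j. nat (2 * j + 1)) ` J"
      then obtain j where j: "j \<in> J" "q = nat (2 * j + 1)" by blast
      then have "int q = 2 * j + 1" using J0 by simp
      then have "odd q" by presburger
      moreover have "real q = 2 * real_of_int j + 1"
        using \<open>int q = 2 * j + 1\<close> by (metis of_int_of_nat_eq of_int_add of_int_mult of_int_numeral of_int_1)
      ultimately have "odd q" "real q = 2 * real_of_int j + 1" by blast+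
      then show "q \<in> denoms" using j(1) unfolding denoms_def J_def by (simp add: field_simps)
    qed
  qed simp
  finally show ?thesis by simp
qed

lemma card_denoms_pos: "0 < real (card denoms)"
  using card_denoms Q by linarith

lemma slab_weight_nonneg: "i \<in> slabs \<Longrightarrow> 0 \<le> slab_weight i"
  unfolding slab_weight_def slabs_def
  by (intro divide_nonneg_nonneg prod_nonneg comb_weight_nonneg ballI)
     (auto simp: spacing_pos width_pos order_less_imp_le)

text \<open>For one denominator the numerators range over a product set and the boxes are products,
  so the mass factorises. The coordinates are coupled only through the common
  \<open>q\<close>.\<close>

lemma mass_slab_density:
  "mass slab_density (cbox a c)
    = (\<Sum>q\<in>denoms. \<Prod>b\<in>Basis. comb (spacing q b) (modulus q b) (width b) (a \<bullet> b) (c \<bullet> b)) / card denoms"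
proof -
  have "mass slab_density (cbox a c)
    = (\<integral>x. (\<Sum>i\<in>slabs. slab_weight i * indicator (cbox a c \<inter> cbox (slab_lo i) (slab_hi i)) x) \<partial>lborel)"
    unfolding mass_def slab_density_def
    by (intro Bochner_Integration.integral_cong) (auto simp: sum_distrib_left indicator_def intro!: sum.cong)
  also have "\<dots> = (\<Sum>i\<in>slabs. slab_weight i * measure lborel (cbox a c \<inter> cbox (slab_lo i) (slab_hi i)))"
    using emeasure_lborel_cbox_finite unfolding Int_interval
    by (subst Bochner_Integration.integral_sum)
       (auto intro!: integrable_mult_right integrable_real_indicator)
  also have "\<dots> = (\<Sum>i\<in>slabs. slab_weight i *
      (\<Prod>b\<in>Basis. overlap (a \<bullet> b) (c \<bullet> b) (spacing (fst i) b * real_of_int (snd i b)) (width b)))"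
    unfolding slab_lo_def slab_hi_def
    using width_pos by (intro sum.cong refl arg_cong2[where f = "(*)"] measure_cbox_Int_centered) (auto intro: order_less_imp_le)
  also have "\<dots> = (\<Sum>q\<in>denoms. \<Sum>p\<in>PiE Basis (\<lambda>b. centers (spacing q b) (modulus q b)). slab_weight (q, p) *
      (\<Prod>b\<in>Basis. overlap (a \<bullet> b) (c \<bullet> b) (spacing q b * real_of_int (p b)) (width b)))"
    unfolding slabs_def by (subst sum.Sigma) (auto intro!: finite_PiE finite_centers simp: spacing_pos split_def)
  also have "\<dots> = (\<Sum>q\<in>denoms. (\<Prod>b\<in>Basis. comb (spacing q b) (modulus q b) (width b) (a \<bullet> b) (c \<bullet> b)) / card denoms)"
  proof (rule sum.cong[OF refl])
    fix q assume q: "q \<in> denoms"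
    have "(\<Prod>b\<in>Basis. comb (spacing q b) (modulus q b) (width b) (a \<bullet> b) (c \<bullet> b))
      = (\<Prod>b\<in>Basis. comb_weight (spacing q b) (modulus q b) (width b)) *
        (\<Prod>b\<in>Basis. \<Sum>p\<in>centers (spacing q b) (modulus q b). overlap (a \<bullet> b) (c \<bullet> b) (spacing q b * real_of_int p) (width b))"
      unfolding comb_def by (rule prod.distrib)
    also have "(\<Prod>b\<in>Basis. \<Sum>p\<in>centers (spacing q b) (modulus q b). overlap (a \<bullet> b) (c \<bullet> b) (spacing q b * real_of_int p) (width b))
      = (\<Sum>p\<in>PiE Basis (\<lambda>b. centers (spacing q b) (modulus q b)).
           \<Prod>b\<in>Basis. overlap (a \<bullet> b) (c \<bullet> b) (spacing q b * real_of_int (p b)) (width b))"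
      using spacing_pos[OF q] by (intro prod_sum_PiE) auto
    finally show "(\<Sum>p\<in>PiE Basis (\<lambda>b. centers (spacing q b) (modulus q b)). slab_weight (q, p) *
        (\<Prod>b\<in>Basis. overlap (a \<bullet> b) (c \<bullet> b) (spacing q b * real_of_int (p b)) (width b)))
      = (\<Prod>b\<in>Basis. comb (spacing q b) (modulus q b) (width b) (a \<bullet> b) (c \<bullet> b)) / card denoms"
      unfolding slab_weight_def by (simp add: sum_distrib_left sum_divide_distrib)
  qed
  finally show ?thesis by (simp add: sum_divide_distrib)
qed

text \<open>The period of the comb is exactly \<open>u\<close> in direction \<open>b0\<close>,
  whatever \<open>q\<close> is, and at most \<open>1 / D\<close> in the others; so a single error
  \<open>e\<close> serves all denominators. The maximum with \<open>0\<close> keeps the factors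
  nonnegative, as monotonicity of products requires.\<close>

lemma mass_slab_density_bounds:
  assumes ac: "\<And>b. b \<in> Basis \<Longrightarrow> 0 \<le> a \<bullet> b \<and> a \<bullet> b \<le> c \<bullet> b \<and> c \<bullet> b \<le> 1"
    and e: "w1 + u \<le> e" "w2 + 1 / D \<le> e"
  shows "mass slab_density (cbox a c) \<le> (\<Prod>b\<in>Basis. c \<bullet> b - a \<bullet> b + e)"
    and "(\<Prod>b\<in>Basis. max 0 (c \<bullet> b - a \<bullet> b - e)) \<le> mass slab_density (cbox a c)"
proof -
  have err: "width b + spacing q b * modulus q b \<le> e" if q: "q \<in> denoms" for q b
  proof (cases "b = b0")
    case True
    then show ?thesis using e denoms_pos[OF q] unfolding width_def spacing_def modulus_def by simp
  next
    case False
    have "1 / (D * q) \<le> 1 / D"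
      using D denoms_pos[OF q] by (intro divide_left_mono) auto
    then show ?thesis using e False unfolding width_def spacing_def modulus_def by simp
  qed
  have up: "comb (spacing q b) (modulus q b) (width b) (a \<bullet> b) (c \<bullet> b) \<le> c \<bullet> b - a \<bullet> b + e"
    if q: "q \<in> denoms" and b: "b \<in> Basis" for q b
    using comb_le[OF spacing_pos[OF q] modulus_pos[OF q] width_pos, of "a \<bullet> b" "c \<bullet> b" b b b] ac[OF b] err[OF q, of b]
    by simp
  have nn: "0 \<le> comb (spacing q b) (modulus q b) (width b) x y" if q: "q \<in> denoms" for q b x y
    using spacing_pos[OF q] width_pos by (intro comb_nonneg) (auto intro: order_less_imp_le)
  have lo: "max 0 (c \<bullet> b - a \<bullet> b - e) \<le> comb (spacing q b) (modulus q b) (width b) (a \<bullet> b) (c \<bullet> b)"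
    if q: "q \<in> denoms" and b: "b \<in> Basis" for q b
    using comb_ge[OF spacing_pos[OF q] modulus_pos[OF q] width_pos, of "a \<bullet> b" "c \<bullet> b" b b b] ac[OF b] err[OF q, of b]
      nn[OF q, of b "a \<bullet> b" "c \<bullet> b"]
    by simp
  have "(\<Sum>q\<in>denoms. \<Prod>b\<in>Basis. comb (spacing q b) (modulus q b) (width b) (a \<bullet> b) (c \<bullet> b))
     \<le> (\<Sum>q\<in>denoms. \<Prod>b\<in>Basis. c \<bullet> b - a \<bullet> b + e)"
    using up nn by (intro sum_mono prod_mono) auto
  then show "mass slab_density (cbox a c) \<le> (\<Prod>b\<in>Basis. c \<bullet> b - a \<bullet> b + e)"
    unfolding mass_slab_density using card_denoms_pos by (simp add: pos_divide_le_eq mult.commute)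
  have "(\<Sum>q\<in>denoms. \<Prod>b\<in>Basis. max 0 (c \<bullet> b - a \<bullet> b - e))
    \<le> (\<Sum>q\<in>denoms. \<Prod>b\<in>Basis. comb (spacing q b) (modulus q b) (width b) (a \<bullet> b) (c \<bullet> b))"
    using lo by (intro sum_mono prod_mono) auto
  then show "(\<Prod>b\<in>Basis. max 0 (c \<bullet> b - a \<bullet> b - e)) \<le> mass slab_density (cbox a c)"
    unfolding mass_slab_density using card_denoms_pos by (simp add: pos_le_divide_eq mult.commute)
qed

end

lemma power_add_le:
  fixes x y :: real
  assumes "0 \<le> x" "0 \<le> y"
  shows "(x + y) ^ m \<le> 2 ^ m * (x ^ m + y ^ m)"
proof -
  have "(x + y) ^ m \<le> (2 * max x y) ^ m" using assms by (intro power_mono) auto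
  also have "\<dots> = 2 ^ m * max x y ^ m" by (rule power_mult_distrib)
  also have "max x y ^ m \<le> x ^ m + y ^ m" using assms by (simp add: max_def)
  finally show ?thesis by simp
qed

section \<open>Energy of the density of one level\<close>

context slab_family
begin

text \<open>Two regimes for the long direction: the first bound is meant for cells at least as long
  as the period \<open>u\<close>, the second for shorter ones, where the density is at most
  \<open>u / (w1 * totient q)\<close>.\<close>

lemma comb_main_le:
  assumes q: "q \<in> denoms" and ac: "a \<le> c"
  shows "comb (u / q) q w1 a c \<le> (c - a) + w1 + u"
    and "comb (u / q) q w1 a c \<le> 2 * u * (real k + 1) / (Q * w1) * (c - a)"
proof -
  have q0: "0 < q" using denoms_pos[OF q] .
  have qQ: "Q / 2 \<le> real q" "real q \<le> Q" using q unfolding denoms_def by auto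
  have \<theta>: "0 < u / q" using q0 u_pos by simp
  show "comb (u / q) q w1 a c \<le> (c - a) + w1 + u"
    using comb_le[OF \<theta> q0 w1 ac] q0 by simp
  have "w1 * q \<le> w1 * Q" using w1 qQ by (intro mult_left_mono) auto
  then have w1q: "w1 \<le> u / q" using q0 u by (simp add: field_simps)
  have "real q \<le> 2 ^ k" using qQ Q by linarith
  then have "q \<le> 2 ^ k" by (simp flip: of_nat_le_iff)
  then have "real q \<le> totient q * (real k + 1)" by (rule totient_lower_bound[OF q0])
  then have tot: "Q \<le> 2 * (totient q * (real k + 1))" using qQ by linarith
  have tot0: "0 < real (totient q)" using q0 by simp
  have "comb_weight (u / q) q w1 = u / w1 * (1 / totient q)"
    unfolding comb_weight_def using q0 by simp
  also have "1 / totient q \<le> 2 * (real k + 1) / Q"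
    using tot tot0 Q by (simp add: field_simps)
  then have "u / w1 * (1 / totient q) \<le> u / w1 * (2 * (real k + 1) / Q)"
    using u_pos w1 by (intro mult_left_mono) auto
  also have "\<dots> = 2 * u * (real k + 1) / (Q * w1)" by (simp add: field_simps)
  finally have "comb_weight (u / q) q w1 * (c - a) \<le> 2 * u * (real k + 1) / (Q * w1) * (c - a)"
    using ac by (intro mult_right_mono) auto
  then show "comb (u / q) q w1 a c \<le> 2 * u * (real k + 1) / (Q * w1) * (c - a)"
    using comb_le_weight[OF \<theta> w1 w1q ac, of q] by linarith
qed

lemma sum_gcd_denoms_le:
  assumes "0 < m"
  shows "(\<Sum>q\<in>denoms. \<Sum>q'\<in>denoms. real (gcd q q') ^ m) \<le> Q ^ (m + 1) * (real k + 1)"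
proof -
  define M where "M = nat \<lfloor>Q\<rfloor>"
  have M: "0 < M" "real M \<le> Q" unfolding M_def using Q by auto
  then have "real M \<le> 2 ^ k" using Q by linarith
  then have Mk: "M \<le> 2 ^ k" by (simp flip: of_nat_le_iff)
  have sub: "denoms \<subseteq> {1..M}" using denoms_subset unfolding M_def .
  have "(\<Sum>q\<in>denoms. \<Sum>q'\<in>denoms. real (gcd q q') ^ m) \<le> (\<Sum>q\<in>denoms. \<Sum>q'\<in>{1..M}. real (gcd q q') ^ m)"
    using sub by (intro sum_mono sum_mono2) auto
  also have "\<dots> \<le> (\<Sum>q\<in>{1..M}. \<Sum>q'\<in>{1..M}. real (gcd q q') ^ m)"
    using sub by (intro sum_mono2) (auto intro!: sum_nonneg)
  also have "\<dots> \<le> real M ^ (m + 1) * harm M" by (rule sum_gcd_power_le[OF assms])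
  also have "\<dots> \<le> Q ^ (m + 1) * (real k + 1)"
    using M harm_le_Suc[OF M(1) Mk] Q by (intro mult_mono power_mono harm_nonneg) auto
  finally show ?thesis .
qed

text \<open>Expanding the square produces pairs of denominators; as the cells form a product grid,
  the sum over cells then factorises for each pair.\<close>

lemma energy_slab_density:
  "energy slab_density t
    = (\<Sum>q\<in>denoms. \<Sum>q'\<in>denoms. \<Prod>b\<in>Basis. \<Sum>i\<in>{0..2 ^ t :: int}.
         comb (spacing q b) (modulus q b) (width b) (real_of_int i / 2 ^ t) ((real_of_int i + 1) / 2 ^ t)
       * comb (spacing q' b) (modulus q' b) (width b) (real_of_int i / 2 ^ t) ((real_of_int i + 1) / 2 ^ t))
      / (card denoms)\<^sup>2"
proof -
  define X where "X q b i = comb (spacing q b) (modulus q b) (width b) (real_of_int i / 2 ^ t) ((real_of_int i + 1) / 2 ^ t)"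
    for q b i
  have "mass slab_density (cell t z) = (\<Sum>q\<in>denoms. \<Prod>b\<in>Basis. X q b (z b)) / card denoms" for z
    unfolding cell_def mass_slab_density X_def by (simp cong: prod.cong)
  then have "energy slab_density t = (\<Sum>z\<in>cells t. (\<Sum>q\<in>denoms. \<Prod>b\<in>Basis. X q b (z b))\<^sup>2) / (card denoms)\<^sup>2"
    unfolding energy_def by (simp add: power_divide flip: sum_divide_distrib)
  also have "(\<Sum>z\<in>cells t. (\<Sum>q\<in>denoms. \<Prod>b\<in>Basis. X q b (z b))\<^sup>2)
    = (\<Sum>z\<in>cells t. \<Sum>q\<in>denoms. \<Sum>q'\<in>denoms. \<Prod>b\<in>Basis. X q b (z b) * X q' b (z b))"
    by (simp add: power2_eq_square sum_product prod.distrib)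
  also have "\<dots> = (\<Sum>q\<in>denoms. \<Sum>z\<in>cells t. \<Sum>q'\<in>denoms. \<Prod>b\<in>Basis. X q b (z b) * X q' b (z b))"
    by (rule sum.swap)
  also have "\<dots> = (\<Sum>q\<in>denoms. \<Sum>q'\<in>denoms. \<Sum>z\<in>cells t. \<Prod>b\<in>Basis. X q b (z b) * X q' b (z b))"
    by (intro sum.cong refl sum.swap)
  also have "\<dots> = (\<Sum>q\<in>denoms. \<Sum>q'\<in>denoms. \<Prod>b\<in>Basis. \<Sum>i\<in>{0..2 ^ t}. X q b i * X q' b i)"
    unfolding cells_def by (intro sum.cong refl prod_sum_PiE[symmetric]) auto
  finally show ?thesis unfolding X_def .
qed

text \<open>Along \<open>b0\<close> each comb value is bounded by \<open>K\<close>; the decay in the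
  other \<open>m\<close> directions comes from correlations of combs. The last term is the average
  over pairs of the \<open>m\<close>-th power of the coincidence excess:
  \<open>Q ^ (m + 1) * (k + 1) / (D * Q^2) ^ m\<close>, divided by the squared number of
  denominators.\<close>

lemma energy_slab_density_le:
  assumes K: "\<And>q i. q \<in> denoms \<Longrightarrow> comb (u / q) q w1 (real_of_int i / 2 ^ t) ((real_of_int i + 1) / 2 ^ t) \<le> K"
  defines "m \<equiv> DIM('a) - 1" and "r \<equiv> 1 / 2 ^ t :: real"
  shows "energy slab_density t
     \<le> 2 * 2 ^ t * K\<^sup>2 * (16 * r / max r w2) ^ m * (max r w2 ^ m + 64 * (real k + 1) / (D ^ m * Q ^ (m + 1)))"
proof -
  define \<sigma> where "\<sigma> = max r w2"
  have r: "0 < r" unfolding r_def by simp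
  have \<sigma>: "0 < \<sigma>" "r \<le> \<sigma>" "w2 \<le> \<sigma>" unfolding \<sigma>_def using w2 by auto
  have m: "0 < m" unfolding m_def using dim by simp
  define X where "X q b i = comb (spacing q b) (modulus q b) (width b) (real_of_int i / 2 ^ t) ((real_of_int i + 1) / 2 ^ t)"
    for q b i
  have X0: "0 \<le> X q b i" if "q \<in> denoms" for q b i
    unfolding X_def using spacing_pos[OF that] width_pos by (intro comb_nonneg) (auto intro: order_less_imp_le)
  have XK: "X q b0 i \<le> K" if "q \<in> denoms" for q i
    using K[OF that] unfolding X_def spacing_def modulus_def width_def by simp
  have K0: "0 \<le> K"
  proof -
    obtain q where "q \<in> denoms" using card_denoms_pos by fastforce
    then show ?thesis using X0 XK order_trans by blast
  qed
  \<comment> \<open>The \<open>gcd\<close> term of \<open>sum_comb_pair_le\<close> up to a constant,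
    with \<open>q\<close> and \<open>q'\<close> replaced by the comparable \<open>Q\<close>.\<close>
  define y where "y q q' = real (gcd q q') / (D * Q\<^sup>2)" for q q'
  have y0: "0 \<le> y q q'" for q q' unfolding y_def using D by simp
  have main: "(\<Sum>i\<in>{0..2 ^ t}. X q b0 i * X q' b0 i) \<le> 2 * 2 ^ t * K\<^sup>2"
    if "q \<in> denoms" "q' \<in> denoms" for q q'
  proof -
    have "(\<Sum>i\<in>{0..2 ^ t}. X q b0 i * X q' b0 i) \<le> (\<Sum>i\<in>{0..2 ^ t :: int}. K * K)"
      using XK X0 that K0 by (intro sum_mono mult_mono) auto
    also have "\<dots> = (2 ^ t + 1) * K\<^sup>2" by (simp add: power2_eq_square nat_add_distrib nat_power_eq)
    also have "\<dots> \<le> (2 * 2 ^ t) * K\<^sup>2" by (intro mult_right_mono) auto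
    finally show ?thesis .
  qed
  have other: "(\<Sum>i\<in>{0..2 ^ t}. X q b i * X q' b i) \<le> 8 * r / \<sigma> * (\<sigma> + y q q')"
    if q: "q \<in> denoms" "q' \<in> denoms" and b: "b \<noteq> b0" for q q' b
  proof -
    have qQ: "Q / 2 \<le> real q" "Q / 2 \<le> real q'" using q unfolding denoms_def by auto
    have "(Q / 2) * (Q / 2) \<le> real q * real q'" using qQ Q by (intro mult_mono) auto
    then have qq: "Q\<^sup>2 / 4 \<le> real q * real q'" by (simp add: power2_eq_square)
    have "(\<Sum>i\<in>{0..2 ^ t}. X q b i * X q' b i)
      \<le> min 1 (r / w2) * (4 * (w2 + r) + 2 * real (gcd q q') / (D * q * q'))"
      using sum_comb_pair_le[OF denoms_pos[OF q(1)] denoms_pos[OF q(2)] D w2, of t] b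
      unfolding X_def spacing_def modulus_def width_def r_def by simp
    also have "min 1 (r / w2) = r / \<sigma>" unfolding \<sigma>_def using w2 r by (simp add: min_def max_def field_simps)
    also have "4 * (w2 + r) + 2 * real (gcd q q') / (D * q * q') \<le> 8 * (\<sigma> + y q q')"
    proof -
      have "D * (Q\<^sup>2 / 4) \<le> D * (real q * real q')" using qq D by (intro mult_left_mono) auto
      then have "2 * real (gcd q q') / (D * q * q') \<le> 2 * real (gcd q q') / (D * (Q\<^sup>2 / 4))"
        using D Q denoms_pos[OF q(1)] denoms_pos[OF q(2)] by (intro divide_left_mono) (auto simp: mult.assoc)
      also have "\<dots> = 8 * y q q'" unfolding y_def by simp
      finally have "2 * real (gcd q q') / (D * q * q') \<le> 8 * y q q'" .
      moreover have "4 * (w2 + r) \<le> 8 * \<sigma>" using add_mono[OF \<sigma>(3,2)] by simp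
      ultimately show ?thesis unfolding distrib_left[of 8] by (rule add_mono[rotated])
    qed
    then have "r / \<sigma> * (4 * (w2 + r) + 2 * real (gcd q q') / (D * q * q')) \<le> r / \<sigma> * (8 * (\<sigma> + y q q'))"
      using r \<sigma> by (intro mult_left_mono) auto
    finally show ?thesis by (simp add: mult_ac)
  qed
  have prod_le: "(\<Prod>b\<in>Basis. \<Sum>i\<in>{0..2 ^ t}. X q b i * X q' b i)
     \<le> 2 * 2 ^ t * K\<^sup>2 * (16 * r / \<sigma>) ^ m * (\<sigma> ^ m + y q q' ^ m)"
    if q: "q \<in> denoms" "q' \<in> denoms" for q q'
  proof -
    have "(\<Prod>b\<in>Basis. \<Sum>i\<in>{0..2 ^ t}. X q b i * X q' b i)
      = (\<Sum>i\<in>{0..2 ^ t}. X q b0 i * X q' b0 i) * (\<Prod>b\<in>Basis - {b0}. \<Sum>i\<in>{0..2 ^ t}. X q b i * X q' b i)"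
      using b0 by (intro prod.remove) auto
    also have "\<dots> \<le> (2 * 2 ^ t * K\<^sup>2) * (\<Prod>b\<in>Basis - {b0}. 8 * r / \<sigma> * (\<sigma> + y q q'))"
      using main[OF q] other[OF q] X0 q by (intro mult_mono prod_mono prod_nonneg) (auto intro!: sum_nonneg)
    also have "(\<Prod>b\<in>Basis - {b0}. 8 * r / \<sigma> * (\<sigma> + y q q')) = (8 * r / \<sigma>) ^ m * (\<sigma> + y q q') ^ m"
      unfolding m_def power_mult_distrib[symmetric] using b0 by (simp add: card_Diff_singleton)
    also have "\<dots> \<le> (8 * r / \<sigma>) ^ m * (2 ^ m * (\<sigma> ^ m + y q q' ^ m))"
      using r \<sigma> y0 by (intro mult_left_mono power_add_le) auto
    also have "\<dots> = (16 * r / \<sigma>) ^ m * (\<sigma> ^ m + y q q' ^ m)"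
      by (simp add: mult.assoc[symmetric] flip: power_mult_distrib)
    finally show ?thesis by (simp add: mult.assoc mult_left_mono)
  qed
  have "(\<Sum>q\<in>denoms. \<Sum>q'\<in>denoms. y q q' ^ m) = (\<Sum>q\<in>denoms. \<Sum>q'\<in>denoms. real (gcd q q') ^ m) / (D * Q\<^sup>2) ^ m"
    unfolding y_def by (simp add: power_divide sum_divide_distrib)
  also have "\<dots> \<le> Q ^ (m + 1) * (real k + 1) / (D * Q\<^sup>2) ^ m"
    using sum_gcd_denoms_le[OF m] D by (intro divide_right_mono) auto
  \<comment> \<open>\<open>Q / 8\<close> is the lower bound for the number of denominators; its
    square produces the constant \<open>64\<close>.\<close>
  also have "\<dots> = (Q / 8)\<^sup>2 * (64 * (real k + 1) / (D ^ m * Q ^ (m + 1)))"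
    using D Q by (simp add: field_simps power_mult_distrib power2_eq_square power_add)
  also have "\<dots> \<le> (card denoms)\<^sup>2 * (64 * (real k + 1) / (D ^ m * Q ^ (m + 1)))"
    using card_denoms D Q by (intro mult_right_mono power_mono) auto
  finally have ysum: "(\<Sum>q\<in>denoms. \<Sum>q'\<in>denoms. y q q' ^ m) \<le> (card denoms)\<^sup>2 * (64 * (real k + 1) / (D ^ m * Q ^ (m + 1)))" .
  define A where "A = 2 * 2 ^ t * K\<^sup>2 * (16 * r / \<sigma>) ^ m"
  have A: "0 \<le> A" unfolding A_def using r \<sigma> by simp
  have "(\<Sum>q\<in>denoms. \<Sum>q'\<in>denoms. \<Prod>b\<in>Basis. \<Sum>i\<in>{0..2 ^ t}. X q b i * X q' b i)
     \<le> (\<Sum>q\<in>denoms. \<Sum>q'\<in>denoms. A * (\<sigma> ^ m + y q q' ^ m))"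
    using prod_le unfolding A_def by (intro sum_mono) auto
  also have "\<dots> = A * ((card denoms)\<^sup>2 * \<sigma> ^ m + (\<Sum>q\<in>denoms. \<Sum>q'\<in>denoms. y q q' ^ m))"
    by (simp add: sum.distrib power2_eq_square distrib_left flip: sum_distrib_left)
  also have "\<dots> \<le> A * ((card denoms)\<^sup>2 * \<sigma> ^ m + (card denoms)\<^sup>2 * (64 * (real k + 1) / (D ^ m * Q ^ (m + 1))))"
    using A ysum by (intro mult_left_mono) auto
  also have "\<dots> = A * (\<sigma> ^ m + 64 * (real k + 1) / (D ^ m * Q ^ (m + 1))) * (card denoms)\<^sup>2"
    by (simp add: algebra_simps)
  finally have "energy slab_density t \<le> A * (\<sigma> ^ m + 64 * (real k + 1) / (D ^ m * Q ^ (m + 1)))"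
    unfolding energy_slab_density X_def[symmetric] using card_denoms_pos by (subst pos_divide_le_eq) auto
  then show ?thesis unfolding A_def \<sigma>_def .
qed

end

section \<open>Uniform bounds over the levels\<close>

lemma polynomial_le_exponential:
  fixes \<delta> :: real
  assumes "0 < \<delta>"
  obtains C where "0 < C" "\<And>k::nat. real k + 1 \<le> C * 2 powr (\<delta> * k)"
proof -
  define C where "C = 1 + 1 / (\<delta> * ln 2)"
  have \<delta>: "0 < \<delta> * ln 2" using assms by simp
  show ?thesis
  proof (rule that[of C])
    show "0 < C" unfolding C_def using \<delta> by (simp add: add_pos_pos)
    fix k :: nat
    have "1 + \<delta> * ln 2 * k \<le> exp (\<delta> * ln 2 * k)" by (rule exp_ge_add_one_self)
    also have "\<dots> = 2 powr (\<delta> * k)" by (simp add: powr_def mult_ac)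
    finally have e: "1 + \<delta> * ln 2 * k \<le> 2 powr (\<delta> * k)" .
    have "real k + 1 = 1 + (\<delta> * ln 2 * k) / (\<delta> * ln 2)" using assms by simp
    also have "\<dots> \<le> 2 powr (\<delta> * k) + 2 powr (\<delta> * k) / (\<delta> * ln 2)"
    proof (rule add_mono)
      show "1 \<le> 2 powr (\<delta> * k)" using e \<delta> by (meson add_increasing2 le_add_same_cancel1 mult_nonneg_nonneg of_nat_0_le_iff order_less_imp_le order_trans)
      show "(\<delta> * ln 2 * k) / (\<delta> * ln 2) \<le> 2 powr (\<delta> * k) / (\<delta> * ln 2)"
        using e \<delta> by (intro divide_right_mono) auto
    qed
    also have "\<dots> = C * 2 powr (\<delta> * k)" unfolding C_def by (simp add: distrib_right)
    finally show "real k + 1 \<le> C * 2 powr (\<delta> * k)" .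
  qed
qed

lemma two_powr_tendsto_0:
  fixes x :: real
  assumes "x < 0"
  shows "(\<lambda>k::nat. 2 powr (x * k)) \<longlonglongrightarrow> 0"
proof -
  have "(\<lambda>k::nat. (2 powr x) ^ k) \<longlonglongrightarrow> 0"
    using assms powr_less_mono[of x 0 2] by (intro LIMSEQ_realpow_zero) auto
  then show ?thesis by (simp add: powr_powr flip: powr_realpow)
qed

lemma R_k_powr: "R_k k powr x = 2 powr (x * k)"
  unfolding R_k_def by (simp add: powr_powr mult.commute flip: powr_realpow)

lemma R_k_eq: "R_k k = 2 powr k"
  unfolding R_k_def by (simp add: powr_realpow)

text \<open>The factor of \<open>p1 / q\<close> in the first coordinate of a slab centre, with the
  parameter \<open>b\<close> set to \<open>1/2\<close>.\<close>

definition u_k :: "nat \<Rightarrow> real \<Rightarrow> nat \<Rightarrow> real" where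
  "u_k n a k = 2 * R_k k / (D_k n a (1/2) k)\<^sup>2"

section \<open>The exponents of \<open>D_k\<close> and \<open>Q_k\<close> at
  \<open>b = 1/2\<close>\<close>

context
  fixes n :: nat and a :: real
  assumes n: "2 \<le> n" and a: "3/4 < a" "a \<le> 1"
begin

definition D_exponent :: real where
  "D_exponent = (real n - (real n - 1) * a + real n * (1/2)) / (real n + 1)"

definition Q_exponent :: real where
  "Q_exponent = (real n - 1) / (real n + 1) * (2 * a - 1/2 - 1)"

lemma D_eq: "D_k n a (1/2) k = 2 powr (D_exponent * k)"
  unfolding D_k_def R_k_powr D_exponent_def ..

lemma Q_eq: "Q_k n a (1/2) k = 2 powr (Q_exponent * k)"
  unfolding Q_k_def R_k_powr Q_exponent_def ..

lemma D_exponent_gt_half: "1 / 2 < D_exponent"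
proof -
  define X where "X = (real n - 1) * a"
  have "X \<le> (real n - 1) * 1" unfolding X_def using n a by (intro mult_left_mono) auto
  moreover have "2 \<le> real n" using n by simp
  ultimately have "1 / 2 * (real n + 1) < real n - X + real n * (1/2)" by argo
  then have "1 / 2 < (real n - X + real n * (1/2)) / (real n + 1)" by (subst pos_less_divide_eq) auto
  then show ?thesis unfolding D_exponent_def X_def .
qed

lemma D_exponent_pos: "0 < D_exponent"
  using D_exponent_gt_half by linarith

text \<open>Here \<open>3/4 < a\<close> enters: it makes \<open>Q_k\<close> tend to infinity, so
  that \<open>8 \<le> Q_k\<close> holds from some level on.\<close>

lemma Q_exponent_pos: "0 < Q_exponent"
  unfolding Q_exponent_def using n a by simp

lemma Q_exponent_eq: "Q_exponent = 3 / 2 - 2 * D_exponent"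
  unfolding D_exponent_def Q_exponent_def by (simp add: divide_simps) (simp add: algebra_simps)

lemma Q_exponent_less: "Q_exponent < 1 / 2"
  using D_exponent_gt_half unfolding Q_exponent_eq by simp

text \<open>The source of \<open>(n - 1) * a\<close> in the dimension: with
  \<open>m = n - 1\<close>, the denominator \<open>D ^ m * Q ^ (m + 1)\<close> in the energy bound
  becomes the power \<open>(n - 1) * a\<close> of \<open>R_k\<close>.\<close>

lemma exponent_identity: "(real n - 1) * D_exponent + real n * Q_exponent = (real n - 1) * a"
proof -
  have "((real n - 1) * D_exponent + real n * Q_exponent) * (real n + 1) = (real n - 1) * a * (real n + 1)"
    unfolding D_exponent_def Q_exponent_def by (simp add: distrib_right) (simp add: algebra_simps)
  then show ?thesis by simp
qed

lemma u_eq: "u_k n a k = 2 * 2 powr (- (1/2 - Q_exponent) * k)"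
proof -
  have "(2 powr (D_exponent * k))\<^sup>2 = 2 powr (2 * D_exponent * k)"
    by (simp add: power2_eq_square mult_ac flip: powr_add)
  then have "u_k n a k = 2 * (2 powr k / 2 powr (2 * D_exponent * k))"
    unfolding u_k_def D_eq R_k_eq by simp
  also have "2 powr k / 2 powr (2 * D_exponent * k) = 2 powr (- (1/2 - Q_exponent) * k)"
    unfolding powr_diff[symmetric] Q_exponent_eq by (simp add: algebra_simps)
  finally show ?thesis .
qed

text \<open>The spacing \<open>u / Q\<close> in the long direction is twice
  \<open>R_k k powr (-1/2)\<close>: consecutive bars are disjoint for \<open>c \<le> 1\<close>, yet
  a fixed proportion of the line is covered before coprimality is imposed.\<close>

lemma u_eq_Q: "u_k n a k = 2 * R_k k powr (-1/2) * Q_k n a (1/2) k"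
  unfolding u_eq Q_eq R_k_powr by (simp add: algebra_simps flip: powr_add)

lemma D_power_Q_power: "D_k n a (1/2) k ^ (n - 1) * Q_k n a (1/2) k ^ n = 2 powr ((real n - 1) * a * k)"
proof -
  have "D_k n a (1/2) k ^ (n - 1) * Q_k n a (1/2) k ^ n = 2 powr (((real n - 1) * D_exponent + real n * Q_exponent) * k)"
    unfolding D_eq Q_eq using n
    by (simp add: powr_powr of_nat_diff algebra_simps powr_add[symmetric] flip: powr_realpow)
  then show ?thesis unfolding exponent_identity .
qed

lemma D_ge_1: "1 \<le> D_k n a (1/2) k"
  unfolding D_eq using D_exponent_pos by (intro ge_one_powr_ge_zero) auto

lemma Q_le: "Q_k n a (1/2) k \<le> 2 ^ k"
proof -
  have "Q_k n a (1/2) k \<le> 2 powr (1 * real k)"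
    unfolding Q_eq using Q_exponent_less by (intro powr_mono mult_right_mono) auto
  then show ?thesis by (simp add: powr_realpow)
qed

lemma eventually_Q_ge: "\<exists>k0. \<forall>k\<ge>k0. 8 \<le> Q_k n a (1/2) k"
proof -
  have "(\<lambda>k::nat. 2 powr (- Q_exponent * k)) \<longlonglongrightarrow> 0" using Q_exponent_pos by (intro two_powr_tendsto_0) auto
  then have "\<forall>\<^sub>F k::nat in sequentially. 2 powr (- Q_exponent * k) < 1 / 8" by (rule order_tendstoD) simp
  then obtain k0 where k0: "\<And>k. k \<ge> k0 \<Longrightarrow> 2 powr (- Q_exponent * real k) < 1 / 8"
    unfolding eventually_sequentially by blast
  have "8 \<le> Q_k n a (1/2) k" if "k \<ge> k0" for k
    using k0[OF that] unfolding Q_eq by (simp add: powr_minus field_simps)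
  then show ?thesis by blast
qed

definition err :: "real \<Rightarrow> nat \<Rightarrow> real" where
  "err c k = c * R_k k powr (-1/2) + u_k n a k + c * R_k k powr (-1) + 1 / D_k n a (1/2) k"

lemma err_tendsto_0: "err c \<longlonglongrightarrow> 0"
proof -
  have D: "1 / D_k n a (1/2) k = 2 powr (- D_exponent * k)" for k unfolding D_eq by (simp add: powr_minus field_simps)
  have "(\<lambda>k. c * 2 powr (-1/2 * real k) + 2 * 2 powr (- (1/2 - Q_exponent) * k) + c * 2 powr (-1 * real k) + 2 powr (- D_exponent * k))
    \<longlonglongrightarrow> c * 0 + 2 * 0 + c * 0 + 0"
    using D_exponent_pos Q_exponent_less by (intro tendsto_intros two_powr_tendsto_0) auto
  then show ?thesis unfolding err_def[abs_def] D u_eq R_k_powr by simp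
qed

lemma slab_family_k:
  fixes b0 :: "'a::euclidean_space"
  assumes "b0 \<in> Basis" "DIM('a) = n" "0 < c" "c \<le> 1" "8 \<le> Q_k n a (1/2) k"
  shows "slab_family b0 (D_k n a (1/2) k) (Q_k n a (1/2) k) (u_k n a k)
           (c * R_k k powr (-1/2)) (c * R_k k powr (-1)) k"
proof
  have R: "0 < R_k k powr x" for x unfolding R_k_def by simp
  show "b0 \<in> Basis" "2 \<le> DIM('a)" "1 \<le> D_k n a (1/2) k" "8 \<le> Q_k n a (1/2) k" "Q_k n a (1/2) k \<le> 2 ^ k"
    using assms n D_ge_1 Q_le by auto
  show "0 < c * R_k k powr (-1/2)" "0 < c * R_k k powr (-1)" using assms R by auto
  have "c * R_k k powr (-1/2) * Q_k n a (1/2) k \<le> 2 * R_k k powr (-1/2) * Q_k n a (1/2) k"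
    using assms R by (intro mult_right_mono) auto
  then show "c * R_k k powr (-1/2) * Q_k n a (1/2) k \<le> u_k n a k" unfolding u_eq_Q .
qed

text \<open>With cell side \<open>r\<close>, the number of cells gives \<open>r powr (-1)\<close>,
  the squared comb bound gives \<open>r powr (2 - 2 * \<epsilon>)\<close>, and the transverse part
  gives \<open>r powr p\<close>. The three losses of \<open>\<epsilon>\<close> absorb the factors
  \<open>k + 1\<close>.\<close>

lemma energy_k_le:
  fixes b0 :: "'a::euclidean_space"
  assumes b0: "b0 \<in> Basis" "DIM('a) = n" and c: "0 < c" "c \<le> 1"
    and \<epsilon>: "0 < \<epsilon>" "\<epsilon> \<le> 1/4"
  obtains C where "\<And>k t. 8 \<le> Q_k n a (1/2) k \<Longrightarrow>
     energy (slab_family.slab_density b0 (D_k n a (1/2) k) (Q_k n a (1/2) k) (u_k n a k)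
           (c * R_k k powr (-1/2)) (c * R_k k powr (-1))) t
     \<le> C * 2 powr (- (1 + (real n - 1) * a - 3 * \<epsilon>) * t)"
proof -
  define m where "m = DIM('a) - 1"
  have m: "real m = real n - 1" "n = m + 1" "1 \<le> real m" unfolding m_def b0 using n by auto
  define p where "p = real m * a - \<epsilon>"
  have "1 * (3/4) \<le> real m * a" using m a by (intro mult_mono) auto
  moreover have "real m * a \<le> real m * 1" using m a by (intro mult_left_mono) auto
  ultimately have p: "0 \<le> p" "p \<le> real m" unfolding p_def using \<epsilon> by auto
  \<comment> \<open>The decay rate of the period: \<open>u\<close> is
    \<open>2 * 2 powr (- \<kappa> * k)\<close>.\<close>
  define \<kappa> where "\<kappa> = 1/2 - Q_exponent"
  have \<kappa>: "0 < \<kappa>" "\<kappa> \<le> 1" unfolding \<kappa>_def using Q_exponent_less Q_exponent_pos by auto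
  \<comment> \<open>The exponent \<open>\<kappa> * \<epsilon>\<close> is chosen so that
    \<open>k + 1\<close> is bounded by a constant times \<open>(2 / u) powr \<epsilon>\<close>, that
    is, by a small power of the period.\<close>
  obtain C3 where C3: "0 < C3" "\<And>k::nat. real k + 1 \<le> C3 * 2 powr (\<kappa> * \<epsilon> * k)"
    using polynomial_le_exponential[of "\<kappa> * \<epsilon>"] \<kappa> \<epsilon> by auto
  \<comment> \<open>\<open>3\<close> serves cells not shorter than the period, where
    \<open>r + w1 + u \<le> 3 * r\<close>; \<open>8 * C3 / c\<close> serves the shorter
    ones.\<close>
  define C1 where "C1 = 3 + 8 * C3 / c"
  have C1: "0 < C1" unfolding C1_def using C3 c by (simp add: add_pos_pos)
  define C where "C = 2 * C1\<^sup>2 * 16 ^ m * (1 + 64 * C3 / c powr p)"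
  show ?thesis
  proof (rule that[of C])
    fix k t :: nat assume Q8: "8 \<le> Q_k n a (1/2) k"
    define D where "D = D_k n a (1/2) k"
    define Q where "Q = Q_k n a (1/2) k"
    define u where "u = u_k n a k"
    define w1 where "w1 = c * R_k k powr (-1/2)"
    define w2 where "w2 = c * R_k k powr (-1)"
    interpret slab_family b0 D Q u w1 w2 k
      unfolding D_def Q_def u_def w1_def w2_def using slab_family_k b0 c Q8 by blast
    define r where "r = (1 / 2 ^ t :: real)"
    have r: "0 < r" "r \<le> 1" unfolding r_def by auto
    have r_powr: "r powr x = 2 powr (- x * t)" for x
      unfolding r_def by (simp add: powr_divide powr_minus powr_powr field_simps flip: powr_realpow)
    have u_k: "u = 2 * 2 powr (- \<kappa> * k)" unfolding u_def u_eq \<kappa>_def by simp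
    have w1u: "w1 \<le> u" using u w1 Q mult_left_mono[of 1 Q w1] by linarith
    have ratio: "2 * u * (real k + 1) / (Q * w1) = 4 / c * (real k + 1)"
      unfolding u_def u_eq_Q w1_def Q_def[symmetric] using Q c by (simp add: field_simps R_k_def)
    have K: "comb (u / q) q w1 (real_of_int i / 2 ^ t) ((real_of_int i + 1) / 2 ^ t) \<le> C1 * r powr (1 - \<epsilon>)"
      if q: "q \<in> denoms" for q i
    proof -
      have len: "(real_of_int i + 1) / 2 ^ t - real_of_int i / 2 ^ t = r"
        unfolding r_def by (simp add: add_divide_distrib)
      have le: "real_of_int i / 2 ^ t \<le> (real_of_int i + 1) / 2 ^ t" by (simp add: divide_right_mono)
      note bounds = comb_main_le[OF q le, unfolded len ratio]
      show ?thesis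
      proof (cases "u \<le> r")
        case True
        have "r powr 1 \<le> r powr (1 - \<epsilon>)" using r \<epsilon> by (intro powr_mono') auto
        then have "3 * r \<le> 3 * r powr (1 - \<epsilon>)" using r by simp
        also have "\<dots> \<le> C1 * r powr (1 - \<epsilon>)" unfolding C1_def using C3 c by (intro mult_right_mono) auto
        finally show ?thesis using bounds(1) True w1u by linarith
      next
        case False
        \<comment> \<open>For cells shorter than the period, \<open>r < u\<close> converts the loss
          in \<open>k\<close> into a loss \<open>r powr (- \<epsilon>)\<close>, which does not
          depend on the level.\<close>
        have "2 / u = 2 powr (\<kappa> * k)"
          unfolding u_k by (simp add: powr_minus field_simps)
        then have "2 powr (\<kappa> * \<epsilon> * k) = (2 / u) powr \<epsilon>"
          by (simp add: powr_powr mult_ac)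
        also have "\<dots> \<le> (2 / r) powr \<epsilon>"
          using False r \<epsilon> by (intro powr_mono2 divide_left_mono) auto
        also have "\<dots> = 2 powr \<epsilon> * r powr (- \<epsilon>)" using r by (simp add: powr_divide powr_minus field_simps)
        also have "\<dots> \<le> 2 powr 1 * r powr (- \<epsilon>)" using \<epsilon> by (intro mult_right_mono powr_mono) auto
        finally have k2: "2 powr (\<kappa> * \<epsilon> * k) \<le> 2 * r powr (- \<epsilon>)" by simp
        have "real k + 1 \<le> C3 * 2 powr (\<kappa> * \<epsilon> * k)" by (rule C3)
        also have "\<dots> \<le> C3 * (2 * r powr (- \<epsilon>))" using k2 C3 by (intro mult_left_mono) auto
        finally have "4 / c * (real k + 1) * r \<le> 4 / c * (C3 * (2 * r powr (- \<epsilon>))) * r"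
          using c r by (intro mult_right_mono mult_left_mono) auto
        also have "\<dots> = 8 * C3 / c * (r powr (- \<epsilon>) * r powr 1)" using r by simp
        also have "r powr (- \<epsilon>) * r powr 1 = r powr (1 - \<epsilon>)" unfolding powr_add[symmetric] by simp
        also have "8 * C3 / c * r powr (1 - \<epsilon>) \<le> C1 * r powr (1 - \<epsilon>)"
          unfolding C1_def by (intro mult_right_mono) auto
        finally show ?thesis using bounds(2) by linarith
      qed
    qed
    \<comment> \<open>The larger of cell side and slab thickness, so that cells finer and coarser
      than the slabs are treated together.\<close>
    define \<sigma> where "\<sigma> = max r w2"
    have "R_k k powr (-1) \<le> 1" unfolding R_k_powr using powr_mono[of "-1 * real k" 0 2] by simp
    then have "w2 \<le> 1" unfolding w2_def using c mult_mono[of c 1 "R_k k powr (-1)" 1] by simp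
    then have \<sigma>: "0 < \<sigma>" "\<sigma> \<le> 1" "r \<le> \<sigma>" "w2 \<le> \<sigma>" unfolding \<sigma>_def using r by auto
    have "\<sigma> ^ m = \<sigma> powr m" using \<sigma> by (simp add: powr_realpow)
    also have "\<dots> \<le> \<sigma> powr p" using \<sigma> p by (intro powr_mono') auto
    finally have \<sigma>m: "\<sigma> ^ m \<le> \<sigma> powr p" .
    have tail: "64 * (real k + 1) / (D ^ m * Q ^ (m + 1)) \<le> 64 * C3 / c powr p * \<sigma> powr p"
    proof -
      have "D ^ m * Q ^ (m + 1) = 2 powr (real m * a * k)"
        unfolding D_def Q_def using D_power_Q_power[of k] unfolding m(2) by simp
      then have "64 * (real k + 1) / (D ^ m * Q ^ (m + 1)) = 64 * (real k + 1) * 2 powr (- (real m * a * k))"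
        by (simp add: powr_minus field_simps)
      also have "\<dots> \<le> 64 * (C3 * 2 powr (\<epsilon> * k)) * 2 powr (- (real m * a * k))"
      proof -
        have "\<kappa> * \<epsilon> * k \<le> 1 * \<epsilon> * k" using \<kappa> \<epsilon> by (intro mult_right_mono) auto
        then have "2 powr (\<kappa> * \<epsilon> * k) \<le> 2 powr (\<epsilon> * k)" by (intro powr_mono) auto
        then have "C3 * 2 powr (\<kappa> * \<epsilon> * k) \<le> C3 * 2 powr (\<epsilon> * k)" using C3 by (intro mult_left_mono) auto
        then show ?thesis using C3(2)[of k] by (intro mult_right_mono mult_left_mono) auto
      qed
      also have "\<dots> = 64 * C3 * 2 powr (- p * k)"
        unfolding p_def by (simp add: algebra_simps flip: powr_add)
      also have "2 powr (- p * k) = (w2 / c) powr p"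
        unfolding w2_def R_k_powr using c by (simp add: powr_powr mult_ac)
      also have "\<dots> \<le> (\<sigma> / c) powr p" using \<sigma> c p w2 by (intro powr_mono2 divide_right_mono) auto
      also have "\<dots> = \<sigma> powr p / c powr p" using \<sigma> c by (simp add: powr_divide)
      finally show ?thesis using C3 by (simp add: mult_left_mono)
    qed
    \<comment> \<open>Since \<open>r \<le> \<sigma>\<close> and \<open>p \<le> m\<close>, lowering
      the exponent to \<open>p\<close> only enlarges the ratio. The powers of
      \<open>\<sigma>\<close> then cancel against the bounds on \<open>\<sigma> ^ m\<close> and on
      the arithmetic term, leaving \<open>r powr p\<close>.\<close>
    have "(16 * r / \<sigma>) ^ m = 16 ^ m * (r / \<sigma>) powr m"
      using r \<sigma> by (simp add: powr_realpow power_mult_distrib power_divide)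
    also have "\<dots> \<le> 16 ^ m * (r / \<sigma>) powr p"
      using r \<sigma> p by (intro mult_left_mono powr_mono') auto
    also have "\<dots> = 16 ^ m * (r powr p / \<sigma> powr p)" using r \<sigma> by (simp add: powr_divide)
    finally have ratio_m: "(16 * r / \<sigma>) ^ m \<le> 16 ^ m * (r powr p / \<sigma> powr p)" .
    have "energy slab_density t
      \<le> 2 * 2 ^ t * (C1 * r powr (1 - \<epsilon>))\<^sup>2 * (16 * r / \<sigma>) ^ m * (\<sigma> ^ m + 64 * (real k + 1) / (D ^ m * Q ^ (m + 1)))"
      using energy_slab_density_le[OF K, folded r_def] unfolding \<sigma>_def m_def by simp
    also have "\<dots> \<le> 2 * 2 ^ t * (C1 * r powr (1 - \<epsilon>))\<^sup>2 * (16 ^ m * (r powr p / \<sigma> powr p))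
        * (\<sigma> powr p + 64 * C3 / c powr p * \<sigma> powr p)"
      using \<sigma> r \<sigma>m tail ratio_m D Q by (intro mult_mono add_mono mult_nonneg_nonneg) auto
    also have "\<dots> = C * (2 ^ t * (r powr (1 - \<epsilon>))\<^sup>2 * r powr p)"
      unfolding C_def using \<sigma> c by (simp add: field_simps power_mult_distrib)
    also have "2 ^ t * (r powr (1 - \<epsilon>))\<^sup>2 * r powr p = r powr (-1) * (r powr (1 - \<epsilon>) * r powr (1 - \<epsilon>)) * r powr p"
    proof -
      have "r powr (-1) = 2 ^ t" unfolding r_powr by (simp add: powr_realpow)
      then show ?thesis by (simp only: power2_eq_square)
    qed
    also have "\<dots> = r powr (1 + (real n - 1) * a - 3 * \<epsilon>)"
      unfolding powr_add[symmetric] p_def m by (simp add: algebra_simps)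
    also have "\<dots> = 2 powr (- (1 + (real n - 1) * a - 3 * \<epsilon>) * t)" by (rule r_powr)
    finally show "energy (slab_family.slab_density b0 (D_k n a (1/2) k) (Q_k n a (1/2) k) (u_k n a k)
           (c * R_k k powr (-1/2)) (c * R_k k powr (-1))) t
     \<le> C * 2 powr (- (1 + (real n - 1) * a - 3 * \<epsilon>) * t)"
      unfolding D_def Q_def u_def w1_def w2_def .
  qed
qed

end

section \<open>The set of divergence\<close>

text \<open>The comb errors vanish in the limit, so the mass is squeezed between two products
  converging to the volume. Levels are shifted by \<open>k0\<close> because
  \<open>8 \<le> Q_k\<close> holds only from there on.\<close>

lemma mass_slab_density_tendsto:
  fixes b0 :: "'a::euclidean_space" and l h :: 'a
  assumes n: "2 \<le> DIM('a)" and a: "3/4 < a" "a \<le> 1" and b0: "b0 \<in> Basis" and c: "0 < c" "c \<le> 1"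
    and k0: "\<And>k. 8 \<le> Q_k DIM('a) a (1/2) (k + k0)"
    and sub: "cbox l h \<subseteq> cbox 0 One"
  shows "(\<lambda>k. mass (slab_family.slab_density b0 (D_k DIM('a) a (1/2) (k + k0)) (Q_k DIM('a) a (1/2) (k + k0))
            (u_k DIM('a) a (k + k0)) (c * R_k (k + k0) powr (-1/2)) (c * R_k (k + k0) powr (-1))) (cbox l h))
          \<longlonglongrightarrow> measure lborel (cbox l h)"
    (is "(\<lambda>k. mass (?g k) _) \<longlonglongrightarrow> _")
proof (cases "cbox l h = {}")
  case True
  then show ?thesis by (simp add: mass_def)
next
  case False
  then have lh: "\<And>b. b \<in> Basis \<Longrightarrow> l \<bullet> b \<le> h \<bullet> b" by (simp add: box_ne_empty)
  then have lh1: "0 \<le> l \<bullet> b \<and> l \<bullet> b \<le> h \<bullet> b \<and> h \<bullet> b \<le> 1" if "b \<in> Basis" for b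
    using sub that by (auto simp: subset_box)
  define e where "e k = err DIM('a) a c (k + k0)" for k
  have e: "e \<longlonglongrightarrow> 0"
    unfolding e_def using err_tendsto_0[OF n a, of c] by (rule LIMSEQ_ignore_initial_segment)
  have bounds: "(\<Prod>b\<in>Basis. max 0 (h \<bullet> b - l \<bullet> b - e k)) \<le> mass (?g k) (cbox l h) \<and>
      mass (?g k) (cbox l h) \<le> (\<Prod>b\<in>Basis. h \<bullet> b - l \<bullet> b + e k)" for k
  proof -
    interpret slab_family b0 "D_k DIM('a) a (1/2) (k + k0)" "Q_k DIM('a) a (1/2) (k + k0)" "u_k DIM('a) a (k + k0)"
      "c * R_k (k + k0) powr (-1/2)" "c * R_k (k + k0) powr (-1)" "k + k0"
      by (rule slab_family_k[OF n a b0 refl c k0])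
    have "c * R_k (k + k0) powr (-1/2) + u_k DIM('a) a (k + k0) \<le> e k"
         "c * R_k (k + k0) powr (-1) + 1 / D_k DIM('a) a (1/2) (k + k0) \<le> e k"
      unfolding e_def err_def[OF n a] using w1 w2 u_pos divide_pos_pos[OF zero_less_one less_le_trans[OF zero_less_one D]]
      by linarith+
    then show ?thesis using mass_slab_density_bounds lh1 by blast
  qed
  have "(\<lambda>k. \<Prod>b\<in>Basis. max 0 (h \<bullet> b - l \<bullet> b - e k)) \<longlonglongrightarrow> (\<Prod>b\<in>Basis. max 0 (h \<bullet> b - l \<bullet> b - 0))"
    by (intro tendsto_intros e)
  also have "(\<Prod>b\<in>Basis. max 0 (h \<bullet> b - l \<bullet> b - 0)) = measure lborel (cbox l h)"
    using lh by (simp add: content_cbox max_def inner_diff_left cong: prod.cong)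
  finally have lo: "(\<lambda>k. \<Prod>b\<in>Basis. max 0 (h \<bullet> b - l \<bullet> b - e k)) \<longlonglongrightarrow> measure lborel (cbox l h)" .
  have "(\<lambda>k. \<Prod>b\<in>Basis. h \<bullet> b - l \<bullet> b + e k) \<longlonglongrightarrow> (\<Prod>b\<in>Basis. h \<bullet> b - l \<bullet> b + 0)"
    by (intro tendsto_intros e)
  also have "(\<Prod>b\<in>Basis. h \<bullet> b - l \<bullet> b + 0) = measure lborel (cbox l h)"
    using lh by (simp add: content_cbox inner_diff_left)
  finally have hi: "(\<lambda>k. \<Prod>b\<in>Basis. h \<bullet> b - l \<bullet> b + e k) \<longlonglongrightarrow> measure lborel (cbox l h)" .
  show ?thesis
    by (rule tendsto_sandwich[OF _ _ lo hi]) (use bounds in auto)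
qed

text \<open>Joins the arithmetic and the soft half in an arbitrary Euclidean space. The sets
  \<open>B k\<close> are left abstract, so that concrete coordinates enter only through the
  inclusion of slabs.\<close>

lemma ex_slabs_hausdorff_measure_nonzero:
  fixes b0 :: "'a::euclidean_space"
  assumes n: "2 \<le> DIM('a)" and a: "3/4 < a" "a \<le> 1" and b0: "b0 \<in> Basis" and c: "0 < c" "c \<le> 1"
    and c0: "0 < c0" "c0 \<le> 1"
    and s: "0 < s" "s < 1 + (real DIM('a) - 1) * a"
  obtains k0 where "\<And>k. k0 \<le> k \<Longrightarrow> slab_family b0 (D_k DIM('a) a (1/2) k) (Q_k DIM('a) a (1/2) k)
            (u_k DIM('a) a k) (c * R_k k powr (-1/2)) (c * R_k k powr (-1)) k"
    "\<And>B. (\<And>k i. k0 \<le> k \<Longrightarrow> i \<in> slab_family.slabs b0 (D_k DIM('a) a (1/2) k) (Q_k DIM('a) a (1/2) k) (u_k DIM('a) a k) \<Longrightarrow>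
         cbox (slab_family.slab_lo b0 (D_k DIM('a) a (1/2) k) (u_k DIM('a) a k) (c * R_k k powr (-1/2)) (c * R_k k powr (-1)) i)
              (slab_family.slab_hi b0 (D_k DIM('a) a (1/2) k) (u_k DIM('a) a k) (c * R_k k powr (-1/2)) (c * R_k k powr (-1)) i)
         \<subseteq> B k) \<Longrightarrow>
      hausdorff_measure s (cbox 0 (c0 *\<^sub>R One) \<inter> (\<Inter>N. \<Union>k\<in>{N..}. B k)) \<noteq> 0"
proof -
  \<comment> \<open>The energy bound loses \<open>3 * \<epsilon>\<close>; a quarter of the gap
    leaves its exponent strictly above \<open>s\<close>.\<close>
  define \<epsilon> where "\<epsilon> = min (1/4) ((1 + (real DIM('a) - 1) * a - s) / 4)"
  have \<epsilon>: "0 < \<epsilon>" "\<epsilon> \<le> 1/4" unfolding \<epsilon>_def using s by auto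
  have \<epsilon>s: "\<epsilon> \<le> (1 + (real DIM('a) - 1) * a - s) / 4" unfolding \<epsilon>_def by (rule min.cobounded2)
  obtain k0 where k0: "\<And>k. k0 \<le> k \<Longrightarrow> 8 \<le> Q_k DIM('a) a (1/2) k"
    using eventually_Q_ge[OF n a] by blast
  let ?D = "\<lambda>k. D_k DIM('a) a (1/2) k" and ?Q = "\<lambda>k. Q_k DIM('a) a (1/2) k" and ?u = "\<lambda>k. u_k DIM('a) a k"
    and ?w1 = "\<lambda>k. c * R_k k powr (-1/2)" and ?w2 = "\<lambda>k. c * R_k k powr (-1)"
  have fam: "slab_family b0 (?D k) (?Q k) (?u k) (?w1 k) (?w2 k) k" if "k0 \<le> k" for k
    by (rule slab_family_k[OF n a b0 refl c k0[OF that]])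
  obtain C where C: "\<And>k t. 8 \<le> ?Q k \<Longrightarrow>
     energy (slab_family.slab_density b0 (?D k) (?Q k) (?u k) (?w1 k) (?w2 k)) t
     \<le> C * 2 powr (- (1 + (real DIM('a) - 1) * a - 3 * \<epsilon>) * t)"
    using energy_k_le[OF n a b0 refl c \<epsilon>(1,2)] by blast
  define I where "I k = slab_family.slabs b0 (?D (k + k0)) (?Q (k + k0)) (?u (k + k0))" for k
  define w where "w k = slab_family.slab_weight b0 (?D (k + k0)) (?Q (k + k0)) (?u (k + k0)) (?w1 (k + k0)) (?w2 (k + k0))" for k
  define lo where "lo k = slab_family.slab_lo b0 (?D (k + k0)) (?u (k + k0)) (?w1 (k + k0)) (?w2 (k + k0))" for k
  define hi where "hi k = slab_family.slab_hi b0 (?D (k + k0)) (?u (k + k0)) (?w1 (k + k0)) (?w2 (k + k0))" for k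
  define g where "g k = slab_family.slab_density b0 (?D (k + k0)) (?Q (k + k0)) (?u (k + k0)) (?w1 (k + k0)) (?w2 (k + k0))" for k
  interpret box_sequence g I w lo hi "c0 *\<^sub>R One" C "1 + (real DIM('a) - 1) * a - 3 * \<epsilon>"
  proof
    fix k
    have kf: "slab_family b0 (?D (k + k0)) (?Q (k + k0)) (?u (k + k0)) (?w1 (k + k0)) (?w2 (k + k0)) (k + k0)"
      by (rule fam) simp
    show "finite (I k)" unfolding I_def by (rule slab_family.finite_slabs[OF kf])
    show "0 \<le> w k i" if "i \<in> I k" for i
      using slab_family.slab_weight_nonneg[OF kf] that unfolding w_def I_def by blast
    show "g k x = (\<Sum>i\<in>I k. w k i * indicator (cbox (lo k i) (hi k i)) x)" for x
      unfolding g_def I_def w_def lo_def hi_def by (rule slab_family.slab_density_def[OF kf])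
    show "energy (g k) t \<le> C * 2 powr (- (1 + (real DIM('a) - 1) * a - 3 * \<epsilon>) * real t)" for t
      unfolding g_def by (rule C[OF k0]) simp
  next
    fix b :: 'a assume "b \<in> Basis"
    then show "0 < (c0 *\<^sub>R One) \<bullet> b" "(c0 *\<^sub>R One) \<bullet> b \<le> 1" using c0 by auto
  next
    fix l h :: 'a assume "cbox l h \<subseteq> cbox 0 (c0 *\<^sub>R One)"
    also have "\<dots> \<subseteq> cbox 0 One" using c0 by (auto simp: subset_box)
    finally show "(\<lambda>k. mass (g k) (cbox l h)) \<longlonglongrightarrow> measure lborel (cbox l h)"
      unfolding g_def by (intro mass_slab_density_tendsto n a b0 c k0) auto
  qed
  show ?thesis
  proof (rule that[of k0])
    show "slab_family b0 (?D k) (?Q k) (?u k) (?w1 k) (?w2 k) k" if "k0 \<le> k" for k by (rule fam[OF that])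
    fix B assume B: "\<And>k i. k0 \<le> k \<Longrightarrow> i \<in> slab_family.slabs b0 (?D k) (?Q k) (?u k) \<Longrightarrow>
         cbox (slab_family.slab_lo b0 (?D k) (?u k) (?w1 k) (?w2 k) i)
              (slab_family.slab_hi b0 (?D k) (?u k) (?w1 k) (?w2 k) i) \<subseteq> B k"
    \<comment> \<open>Position \<open>k\<close> of the sequence stands for level
      \<open>k + k0\<close>; since \<open>k + k0\<close> is at least \<open>k\<close>, the limsup of
      the \<open>B k\<close> still contains that of the boxes.\<close>
    have boxes: "boxes k \<subseteq> B (k + k0)" for k
      unfolding boxes_def I_def lo_def hi_def using B[of "k + k0"] by (intro UN_least) simp
    have "cbox 0 (c0 *\<^sub>R One) \<inter> (\<Inter>N. \<Union>k\<in>{N..}. boxes k) \<subseteq> cbox 0 (c0 *\<^sub>R One) \<inter> (\<Inter>N. \<Union>k\<in>{N..}. B k)"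
    proof (intro Int_mono order_refl INT_greatest)
      fix N
      have "(\<Union>k\<in>{N..}. boxes k) \<subseteq> (\<Union>k\<in>{N..}. B k)"
      proof
        fix x assume "x \<in> (\<Union>k\<in>{N..}. boxes k)"
        then obtain k where k: "N \<le> k" "x \<in> boxes k" by auto
        then have "x \<in> B (k + k0)" using boxes by blast
        then show "x \<in> (\<Union>k\<in>{N..}. B k)" using k(1) by (intro UN_I[of "k + k0"]) auto
      qed
      then show "(\<Inter>N. \<Union>k\<in>{N..}. boxes k) \<subseteq> (\<Union>k\<in>{N..}. B k)" by blast
    qed
    then have "hausdorff_measure s (cbox 0 (c0 *\<^sub>R One) \<inter> (\<Inter>N. \<Union>k\<in>{N..}. boxes k))
        \<le> hausdorff_measure s (cbox 0 (c0 *\<^sub>R One) \<inter> (\<Inter>N. \<Union>k\<in>{N..}. B k))"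
      by (rule hausdorff_measure_mono)
    moreover have "hausdorff_measure s (cbox 0 (c0 *\<^sub>R One) \<inter> (\<Inter>N. \<Union>k\<in>{N..}. boxes k)) \<noteq> 0"
      using \<epsilon> \<epsilon>s s by (intro hausdorff_measure_limsup_nonzero) auto
    ultimately show "hausdorff_measure s (cbox 0 (c0 *\<^sub>R One) \<inter> (\<Inter>N. \<Union>k\<in>{N..}. B k)) \<noteq> 0" by auto
  qed
qed

text \<open>Two constants, because the estimates use slabs with \<open>c' \<le> 1\<close> while
  \<open>c\<close> is any positive number; enlarging the constant about the same centres only
  enlarges the slabs.\<close>

lemma slab_subset_F_k:
  fixes a c c' :: real
  defines "n \<equiv> DIM(real \<times> (real^'m))"
  assumes c: "c' \<le> c" and q: "i \<in> slab_family.slabs ((1, 0) :: real \<times> (real^'m)) (D_k n a (1/2) k) (Q_k n a (1/2) k) (u_k n a k)"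
    and fam: "slab_family ((1, 0) :: real \<times> (real^'m)) (D_k n a (1/2) k) (Q_k n a (1/2) k) (u_k n a k)
       (c' * R_k k powr (-1/2)) (c' * R_k k powr (-1)) k"
  shows "cbox (slab_family.slab_lo (1, 0) (D_k n a (1/2) k) (u_k n a k) (c' * R_k k powr (-1/2)) (c' * R_k k powr (-1)) i)
              (slab_family.slab_hi (1, 0) (D_k n a (1/2) k) (u_k n a k) (c' * R_k k powr (-1/2)) (c' * R_k k powr (-1)) i)
         \<subseteq> (F_k a (1/2) c k :: (real \<times> (real^'m)) set)"
proof
  define D where "D = D_k n a (1/2) k"
  define Q where "Q = Q_k n a (1/2) k"
  define u where "u = u_k n a k"
  define w1 where "w1 = c' * R_k k powr (-1/2)"
  define w2 where "w2 = c' * R_k k powr (-1)"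
  interpret slab_family "(1, 0) :: real \<times> (real^'m)" D Q u w1 w2 k
    using fam unfolding D_def Q_def u_def w1_def w2_def .
  obtain q p where i: "i = (q, p)" by (cases i)
  have qd: "q \<in> denoms" and p: "\<And>b. b \<in> Basis \<Longrightarrow> p b \<in> centers (spacing q b) (modulus q b)"
    using q unfolding i D_def[symmetric] Q_def[symmetric] u_def[symmetric] slabs_def by auto
  define e :: "'m \<Rightarrow> real \<times> (real^'m)" where "e j = (0, axis j 1)" for j
  have e: "e j \<in> Basis" "e j \<noteq> (1, 0)" for j
    unfolding e_def Basis_prod_def by (auto simp: axis_in_Basis_iff)
  have b0: "((1, 0) :: real \<times> (real^'m)) \<in> Basis" unfolding Basis_prod_def by auto
  have cop: "coprime (p (1, 0)) (int q)" using p[OF b0] unfolding centers_def modulus_def by simp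
  have odd: "odd q" "1 \<le> q" "real q \<le> Q" using qd denoms_pos[OF qd] unfolding denoms_def by auto
  fix x assume "x \<in> cbox (slab_family.slab_lo (1, 0) (D_k n a (1/2) k) (u_k n a k) (c' * R_k k powr (-1/2)) (c' * R_k k powr (-1)) i)
              (slab_family.slab_hi (1, 0) (D_k n a (1/2) k) (u_k n a k) (c' * R_k k powr (-1/2)) (c' * R_k k powr (-1)) i)"
  then have "x \<in> cbox (slab_lo i) (slab_hi i)" unfolding D_def[symmetric] u_def[symmetric] w1_def[symmetric] w2_def[symmetric] .
  then have xb: "spacing q b * real_of_int (p b) - width b / 2 \<le> x \<bullet> b
      \<and> x \<bullet> b \<le> spacing q b * real_of_int (p b) + width b / 2" if "b \<in> Basis" for b
    using that unfolding mem_box slab_lo_def slab_hi_def i by simp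
  have x: "\<bar>x \<bullet> b - spacing q b * real_of_int (p b)\<bar> \<le> width b / 2" if "b \<in> Basis" for b
    using xb[OF that] by (simp only: abs_le_iff) linarith
  have R: "0 \<le> R_k k powr y" for y by simp
  have "\<bar>fst x - 2 * real_of_int (p (1, 0)) * R_k k / (real_of_int (int q) * D\<^sup>2)\<bar> \<le> c * R_k k powr (-1/2) / 2"
  proof -
    have "\<bar>fst x - u / q * real_of_int (p (1, 0))\<bar> \<le> w1 / 2"
      using x[OF b0] unfolding spacing_def width_def by (simp add: inner_prod_def)
    also have "w1 / 2 \<le> c * R_k k powr (-1/2) / 2"
      unfolding w1_def using c R by (intro divide_right_mono mult_right_mono) auto
    finally show ?thesis unfolding u_def u_k_def D_def by (simp add: mult_ac)
  qed
  moreover have "\<bar>snd x $ j - real_of_int (p (e j)) / (D * real_of_int (int q))\<bar> \<le> c * R_k k powr (-1) / 2" for j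
  proof -
    have "\<bar>snd x $ j - real_of_int (p (e j)) / (D * real_of_int (int q))\<bar> \<le> w2 / 2"
      using x[OF e(1)[of j]] e(2)[of j] unfolding spacing_def width_def
      by (simp add: e_def inner_prod_def inner_axis)
    also have "w2 / 2 \<le> c * R_k k powr (-1) / 2"
      unfolding w2_def using c R by (intro divide_right_mono mult_right_mono) auto
    finally show ?thesis .
  qed
  ultimately have mem: "x \<in> slab (c * R_k k powr (-1/2)) (c * R_k k powr (-1))
      (2 * real_of_int (p (1, 0)) * R_k k / (real_of_int (int q) * D\<^sup>2))
      (\<chi> j. real_of_int (p (e j)) / (D * real_of_int (int q)))"
    unfolding slab_def by simp
  have adm: "admissible (p (1, 0)) (\<lambda>j. p (e j)) (int q) \<and> 1 \<le> int q \<and> real_of_int (int q) \<le> Q"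
  proof -
    \<comment> \<open>Odd denominators fall under neither parity condition, so the transverse
      numerators are unrestricted.\<close>
    have "int q mod 4 \<noteq> 0" "int q mod 4 \<noteq> 2" using odd(1) by presburger+
    then show ?thesis using cop odd unfolding admissible_def by (simp add: coprime_iff_gcd_eq_1)
  qed
  have n: "CARD('m) + 1 = n" unfolding n_def by simp
  show "x \<in> F_k a (1/2) c k"
    unfolding F_k_def Let_def n D_def[symmetric] Q_def[symmetric] using mem adm by blast
qed

theorem theorem5p5:
  fixes a b c c0 :: real
  assumes "3/4 < a" and "a \<le> 1" and "b = 1/2"
    and "0 < c0" and "c0 \<le> 1" and "0 < c"
  shows "hausdorff_dim (divergence_set a b c \<inter> cube c0 :: (real \<times> (real^'m::finite)) set)
           \<ge> ereal (1 + real CARD('m) * a)"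
proof -
  let ?X = "divergence_set a b c \<inter> cube c0 :: (real \<times> (real^'m)) set"
  let ?b0 = "(1, 0) :: real \<times> (real^'m)"
  have "ereal (1 + real CARD('m) * a) \<le> ereal s" if s: "0 < s" "hausdorff_measure s ?X = 0" for s
  proof (rule ccontr)
    assume "\<not> ereal (1 + real CARD('m) * a) \<le> ereal s"
    then have s': "s < 1 + (real DIM(real \<times> (real^'m)) - 1) * a" by simp
    have dim: "2 \<le> DIM(real \<times> (real^'m))" by (simp add: Suc_leI)
    have b0: "?b0 \<in> Basis" unfolding Basis_prod_def by auto
    \<comment> \<open>The slabs are shrunk to a constant at most \<open>1\<close>; a lower bound for
      the smaller limsup set is enough.\<close>
    have c': "0 < min c 1" "min c 1 \<le> 1" "min c 1 \<le> c" using assms by auto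
    obtain k0 where k0: "\<And>k. k0 \<le> k \<Longrightarrow> slab_family ?b0 (D_k DIM(real \<times> (real^'m)) a (1/2) k) (Q_k DIM(real \<times> (real^'m)) a (1/2) k)
            (u_k DIM(real \<times> (real^'m)) a k) (min c 1 * R_k k powr (-1/2)) (min c 1 * R_k k powr (-1)) k"
      and H: "\<And>B. (\<And>k i. k0 \<le> k \<Longrightarrow> i \<in> slab_family.slabs ?b0 (D_k DIM(real \<times> (real^'m)) a (1/2) k) (Q_k DIM(real \<times> (real^'m)) a (1/2) k) (u_k DIM(real \<times> (real^'m)) a k) \<Longrightarrow>
         cbox (slab_family.slab_lo ?b0 (D_k DIM(real \<times> (real^'m)) a (1/2) k) (u_k DIM(real \<times> (real^'m)) a k) (min c 1 * R_k k powr (-1/2)) (min c 1 * R_k k powr (-1)) i)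
              (slab_family.slab_hi ?b0 (D_k DIM(real \<times> (real^'m)) a (1/2) k) (u_k DIM(real \<times> (real^'m)) a k) (min c 1 * R_k k powr (-1/2)) (min c 1 * R_k k powr (-1)) i)
         \<subseteq> B k) \<Longrightarrow>
      hausdorff_measure s (cbox 0 (c0 *\<^sub>R One) \<inter> (\<Inter>N. \<Union>k\<in>{N..}. B k)) \<noteq> 0"
      using ex_slabs_hausdorff_measure_nonzero[OF dim assms(1,2) b0 c'(1,2) assms(4,5) s(1) s'] by blast
    have "hausdorff_measure s (cbox 0 (c0 *\<^sub>R One) \<inter> (\<Inter>N. \<Union>k\<in>{N..}. F_k a (1/2) c k :: (real \<times> (real^'m)) set)) \<noteq> 0"
      using slab_subset_F_k[OF c'(3) _ k0] by (intro H)
    moreover have "cbox 0 (c0 *\<^sub>R One) \<inter> (\<Inter>N. \<Union>k\<in>{N..}. F_k a (1/2) c k) \<subseteq> ?X"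
    proof -
      have "x \<in> cube c0" if "x \<in> cbox 0 (c0 *\<^sub>R One)" for x :: "real \<times> (real^'m)"
      proof -
        have x: "0 \<le> x \<bullet> v \<and> x \<bullet> v \<le> c0" if "v \<in> Basis" for v
          using \<open>x \<in> cbox 0 (c0 *\<^sub>R One)\<close> that by (simp add: mem_box)
        have "(0, axis j 1) \<in> (Basis :: (real \<times> (real^'m)) set)" for j
          unfolding Basis_prod_def by (auto simp: axis_in_Basis_iff)
        from x[OF this] x[OF b0] show ?thesis
          unfolding cube_def by (simp add: inner_prod_def inner_axis)
      qed
      then show ?thesis unfolding divergence_set_def assms(3) by blast
    qed
    ultimately show False
      using s(2) hausdorff_measure_mono[of "cbox 0 (c0 *\<^sub>R One) \<inter> (\<Inter>N. \<Union>k\<in>{N..}. F_k a (1/2) c k)" ?X s] by simp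
  qed
  then show ?thesis unfolding hausdorff_dim_def by (intro Inf_greatest) blast
qed

end
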